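(* Let $\mathcal{S}^+=\mathcal{S}^+_{N,p,q,r,0}$ be an Inoue surface of type $\mathcal{S}^+$ with parameter $z=0$, and let $\theta$ be the closed one-form on $\mathcal{S}^+$ induced by $\frac{dt}{t}$ (the Lee form of Tricerri's metric). Then $$H^1_\theta(\mathcal{S}^+)\simeq\mathbb{R},\qquad H^2_\theta(\mathcal{S}^+)\simeq\mathbb{R}^2,\qquad H^3_\theta(\mathcal{S}^+)\simeq\mathbb{R},$$ and both $H^0_\theta(\mathcal{S}^+)$ and $H^4_\theta(\mathcal{S}^+)$ vanish.
   Context: Morse-Novikov cohomology: for a closed real one-form $\eta$ on a smooth manifold $M$, put $d_\eta=d-\eta\wedge\cdot$ on smooth real forms $\Omega^\bullet(M)$; then $d_\eta^2=0$ and $H^\bullet_\eta(M)$ denotes the cohomology of $(\Omega^\bullet(M),d_\eta)$. Inoue surface $\mathcal{S}^+_{N,p,q,r,z}$: let $N=(n_{ij})\in\mathrm{SL}_2(\mathbb{Z})$ have real eigenvalues $\alpha>1$ and $1/\alpha$, with real eigenvectors $(a_1,a_2)^t$ and $(b_1,b_2)^t$ corresponding to $\alpha$ and $1/\alpha$ respectively. Fix integers $p,q,r$ with $r\neq0$ and a complex number $z$. Put $$e_i=\tfrac12 n_{i1}(n_{i1}-1)a_1b_1+\tfrac12 n_{i2}(n_{i2}-1)a_2b_2+n_{i1}n_{i2}b_1a_2,\quad i=1,2,$$ and define $c_1,c_2$ by $(c_1,c_2)=(c_1,c_2)N^t+(e_1,e_2)+\frac{b_1a_2-b_2a_1}{r}(p,q)$.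 Let $G^+_{N,p,q,r,z}$ be the group of affine transformations of $\mathbb{R}^3\times\mathbb{R}^+$ (coordinates $x,y,w,t$, with $t>0$) generated by $$g_0(x,y,w,t)=(x+\operatorname{Re}z,\,y+\operatorname{Im}z,\,\alpha w,\,\alpha t),$$ $$g_i(x,y,w,t)=(x+b_iw+c_i,\,y+b_it,\,w+a_i,\,t),\ i=1,2,$$ $$g_3(x,y,w,t)=\left(x+\tfrac{b_1a_2-b_2a_1}{r},\,y,\,w,\,t\right).$$ Then $\mathcal{S}^+_{N,p,q,r,z}=(\mathbb{R}^3\times\mathbb{R}^+)/G^+_{N,p,q,r,z}$. The form $\frac{dt}{t}$ is invariant and descends to the quotient. *)

theory Defs
  imports "HOL-Analysis.Analysis" "HOL-Algebra.Bij" "HOL-Algebra.Generated_Groups"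
begin

section \<open>Smooth functions and differential forms on open subsets of a Euclidean space\<close>

text \<open>Only used for open sets, where the derivative is determined by the values on the set.\<close>

primrec Ck_on :: "nat \<Rightarrow> 'a::euclidean_space set \<Rightarrow> ('a \<Rightarrow> 'b::real_normed_vector) \<Rightarrow> bool" where
  "Ck_on 0 U f \<longleftrightarrow> continuous_on U f"
| "Ck_on (Suc n) U f \<longleftrightarrow>
     (\<forall>x\<in>U. f differentiable (at x)) \<and> (\<forall>v. Ck_on n U (\<lambda>x. frechet_derivative f (at x) v))"

definition smooth_on :: "'a::euclidean_space set \<Rightarrow> ('a \<Rightarrow> 'b::real_normed_vector) \<Rightarrow> bool" where
  "smooth_on U f \<longleftrightarrow> (\<forall>n. Ck_on n U f)"

text \<open>
  A differential form sends a point \<open>x\<close> and a list of \<open>k\<close> tangent vectors to a real number.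
  The degree \<open>k\<close> is not part of the type. A \<open>k\<close>-form on \<open>U\<close> is required to be \<open>0\<close> on lists
  of length other than \<open>k\<close> and at points outside \<open>U\<close>, so that equality of forms is
  equality of functions.
\<close>

type_synonym 'a form = "'a \<Rightarrow> 'a list \<Rightarrow> real"

definition alternating_multilinear :: "nat \<Rightarrow> ('a::real_vector list \<Rightarrow> real) \<Rightarrow> bool" where
  "alternating_multilinear k m \<longleftrightarrow>
     (\<forall>vs i. length vs = k \<and> i < k \<longrightarrow> linear (\<lambda>v. m (vs[i := v]))) \<and>
     (\<forall>vs i j. length vs = k \<and> i < j \<and> j < k \<and> vs ! i = vs ! j \<longrightarrow> m vs = 0)"

definition is_form :: "nat \<Rightarrow> 'a::euclidean_space set \<Rightarrow> 'a form \<Rightarrow> bool" where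
  "is_form k U \<beta> \<longleftrightarrow>
     (\<forall>x vs. x \<notin> U \<or> length vs \<noteq> k \<longrightarrow> \<beta> x vs = 0) \<and>
     (\<forall>x\<in>U. alternating_multilinear k (\<beta> x)) \<and>
     (\<forall>vs. smooth_on U (\<lambda>x. \<beta> x vs))"

definition omit :: "nat \<Rightarrow> 'a list \<Rightarrow> 'a list" where
  "omit i vs = take i vs @ drop (Suc i) vs"

text \<open>
  \<open>(d\<beta>)\<^sub>x(v\<^sub>0,\<dots>,v\<^sub>k) = \<Sum>\<^sub>i (-1)\<^sup>i D\<beta>\<^sub>x(v\<^sub>i)(v\<^sub>0,\<dots>,v\<^sub>i omitted,\<dots>,v\<^sub>k)\<close>, and the wedge product
  with a one-form in the matching normalisation
  \<open>(\<eta>\<and>\<beta>)\<^sub>x(v\<^sub>0,\<dots>,v\<^sub>k) = \<Sum>\<^sub>i (-1)\<^sup>i \<eta>\<^sub>x(v\<^sub>i) \<beta>\<^sub>x(v\<^sub>0,\<dots>,v\<^sub>i omitted,\<dots>,v\<^sub>k)\<close>.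
\<close>

definition ext_deriv :: "'a::euclidean_space set \<Rightarrow> 'a form \<Rightarrow> 'a form" where
  "ext_deriv U \<beta> = (\<lambda>x vs. if x \<in> U then
     (\<Sum>i<length vs. (-1) ^ i * frechet_derivative (\<lambda>y. \<beta> y (omit i vs)) (at x) (vs ! i)) else 0)"

definition wedge1 :: "'a form \<Rightarrow> 'a form \<Rightarrow> 'a form" where
  "wedge1 \<eta> \<beta> = (\<lambda>x vs. \<Sum>i<length vs. (-1) ^ i * \<eta> x [vs ! i] * \<beta> x (omit i vs))"

definition pullback :: "('a::euclidean_space \<Rightarrow> 'a) \<Rightarrow> 'a form \<Rightarrow> 'a form" where
  "pullback f \<beta> = (\<lambda>x vs. \<beta> (f x) (map (frechet_derivative f (at x)) vs))"


section \<open>Differential forms on a manifold given by an atlas\<close>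

text \<open>A chart \<open>(D, \<phi>)\<close> consists of its domain \<open>D\<close> and a coordinate map \<open>\<phi>\<close>, injective on \<open>D\<close>.\<close>

type_synonym ('m, 'a) chart = "'m set \<times> ('m \<Rightarrow> 'a)"

definition chart_image :: "('m, 'a) chart \<Rightarrow> 'a set" where
  "chart_image c = snd c ` fst c"

definition transition :: "('m, 'a) chart \<Rightarrow> ('m, 'a) chart \<Rightarrow> 'a \<Rightarrow> 'a" where
  "transition c c' = snd c' \<circ> inv_into (fst c) (snd c)"

text \<open>
  A form on the manifold is the family of its coordinate expressions in all charts of the
  atlas \<open>A\<close>; these have to correspond to each other under the changes of coordinates.
\<close>

type_synonym ('m, 'a) mform = "('m, 'a) chart \<Rightarrow> 'a form"

definition forms :: "('m, 'a::euclidean_space) chart set \<Rightarrow> nat \<Rightarrow> ('m, 'a) mform set" where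
  "forms A k = {\<omega>.
     (\<forall>c\<in>A. is_form k (chart_image c) (\<omega> c)) \<and>
     (\<forall>c. c \<notin> A \<longrightarrow> \<omega> c = (\<lambda>x vs. 0)) \<and>
     (\<forall>c\<in>A. \<forall>c'\<in>A. \<forall>x \<in> snd c ` (fst c \<inter> fst c').
        \<omega> c x = pullback (transition c c') (\<omega> c') x)}"

definition mform_zero :: "('m, 'a) mform" where
  "mform_zero = (\<lambda>c x vs. 0)"

definition mform_add :: "('m, 'a) mform \<Rightarrow> ('m, 'a) mform \<Rightarrow> ('m, 'a) mform" where
  "mform_add \<omega> \<omega>' = (\<lambda>c x vs. \<omega> c x vs + \<omega>' c x vs)"

definition mform_scale :: "real \<Rightarrow> ('m, 'a) mform \<Rightarrow> ('m, 'a) mform" where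
  "mform_scale s \<omega> = (\<lambda>c x vs. s * \<omega> c x vs)"


section \<open>Morse-Novikov cohomology\<close>

definition twisted_d ::
    "('m, 'a::euclidean_space) mform \<Rightarrow> ('m, 'a) mform \<Rightarrow> ('m, 'a) mform" where
  "twisted_d \<eta> \<omega> = (\<lambda>c x vs. ext_deriv (chart_image c) (\<omega> c) x vs - wedge1 (\<eta> c) (\<omega> c) x vs)"

definition cocycles ::
    "('m, 'a::euclidean_space) chart set \<Rightarrow> ('m, 'a) mform \<Rightarrow> nat \<Rightarrow> ('m, 'a) mform set" where
  "cocycles A \<eta> k = {\<omega> \<in> forms A k. twisted_d \<eta> \<omega> = mform_zero}"

definition coboundaries ::
    "('m, 'a::euclidean_space) chart set \<Rightarrow> ('m, 'a) mform \<Rightarrow> nat \<Rightarrow> ('m, 'a) mform set" where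
  "coboundaries A \<eta> k = (case k of 0 \<Rightarrow> {mform_zero} | Suc j \<Rightarrow> twisted_d \<eta> ` forms A j)"

definition cohomologous :: "('m, 'a::euclidean_space) chart set \<Rightarrow> ('m, 'a) mform \<Rightarrow> nat \<Rightarrow>
    (('m, 'a) mform \<times> ('m, 'a) mform) set" where
  "cohomologous A \<eta> k = {(\<omega>, \<omega>') \<in> cocycles A \<eta> k \<times> cocycles A \<eta> k.
     \<exists>\<beta> \<in> coboundaries A \<eta> k. \<omega>' = mform_add \<omega> \<beta>}"

definition cohomology :: "('m, 'a::euclidean_space) chart set \<Rightarrow> ('m, 'a) mform \<Rightarrow> nat \<Rightarrow>
    ('m, 'a) mform set set" where
  "cohomology A \<eta> k = cocycles A \<eta> k // cohomologous A \<eta> k"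

definition coh_class :: "('m, 'a::euclidean_space) chart set \<Rightarrow> ('m, 'a) mform \<Rightarrow> nat \<Rightarrow>
    ('m, 'a) mform \<Rightarrow> ('m, 'a) mform set" where
  "coh_class A \<eta> k \<omega> = cohomologous A \<eta> k `` {\<omega>}"

text \<open>
  \<open>F\<close> is an isomorphism of real vector spaces from the \<open>k\<close>-th cohomology onto \<open>'v\<close>; the
  vector space operations on classes are those of representatives.
\<close>

definition cohomology_iso :: "('m, 'a::euclidean_space) chart set \<Rightarrow> ('m, 'a) mform \<Rightarrow> nat \<Rightarrow>
    (('m, 'a) mform set \<Rightarrow> 'v::real_vector) \<Rightarrow> bool" where
  "cohomology_iso A \<eta> k F \<longleftrightarrow>
     bij_betw F (cohomology A \<eta> k) UNIV \<and>
     (\<forall>\<omega> \<in> cocycles A \<eta> k. \<forall>\<omega>' \<in> cocycles A \<eta> k.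
        F (coh_class A \<eta> k (mform_add \<omega> \<omega>')) = F (coh_class A \<eta> k \<omega>) + F (coh_class A \<eta> k \<omega>')) \<and>
     (\<forall>s. \<forall>\<omega> \<in> cocycles A \<eta> k.
        F (coh_class A \<eta> k (mform_scale s \<omega>)) = s *\<^sub>R F (coh_class A \<eta> k \<omega>))"


section \<open>Quotients by a discrete group of diffeomorphisms\<close>

definition orbit_map :: "('a \<Rightarrow> 'a) set \<Rightarrow> 'a \<Rightarrow> 'a set" where
  "orbit_map G x = (\<lambda>g. g x) ` G"

text \<open>
  The smooth structure on the quotient of the open set \<open>X\<close> by a free and properly
  discontinuous action of \<open>G\<close>: the points are the orbits, and the charts are the inverses
  of the projection restricted to open sets on which it is injective.
\<close>

definition quotient_atlas ::
    "'a::euclidean_space set \<Rightarrow> ('a \<Rightarrow> 'a) set \<Rightarrow> ('a set, 'a) chart set" where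
  "quotient_atlas X G = {(orbit_map G ` V, inv_into V (orbit_map G)) | V.
     open V \<and> V \<subseteq> X \<and> inj_on (orbit_map G) V}"

text \<open>
  The form on the quotient induced by an invariant form \<open>\<beta>\<close> on \<open>X\<close>. As the charts of the
  quotient atlas are local inverses of the projection, the projection is the identity in
  these coordinates, and the form whose pullback along the projection is \<open>\<beta>\<close> is expressed
  in each chart by the restriction of \<open>\<beta>\<close> to its image.
\<close>

definition induced_form ::
    "'a::euclidean_space set \<Rightarrow> ('a \<Rightarrow> 'a) set \<Rightarrow> 'a form \<Rightarrow> ('a set, 'a) mform" where
  "induced_form X G \<beta> =
     (\<lambda>c x vs. if c \<in> quotient_atlas X G \<and> x \<in> chart_image c then \<beta> x vs else 0)"


section \<open>Inoue surfaces of type \<open>S\<^sup>+\<close>\<close>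

type_synonym R4 = "real \<times> real \<times> real \<times> real"

definition inoue_cover :: "R4 set" where
  "inoue_cover = {(x, y, w, t). t > 0}"

definition inoue_e :: "int^2^2 \<Rightarrow> real^2 \<Rightarrow> real^2 \<Rightarrow> real^2" where
  "inoue_e N a b = (\<chi> i.
       1/2 * of_int (N$i$1) * (of_int (N$i$1) - 1) * a$1 * b$1
     + 1/2 * of_int (N$i$2) * (of_int (N$i$2) - 1) * a$2 * b$2
     + of_int (N$i$1) * of_int (N$i$2) * b$1 * a$2)"

definition inoue_g0 :: "real \<Rightarrow> complex \<Rightarrow> R4 \<Rightarrow> R4" where
  "inoue_g0 \<alpha> z = (\<lambda>(x, y, w, t). (x + Re z, y + Im z, \<alpha> * w, \<alpha> * t))"

definition inoue_g :: "real^2 \<Rightarrow> real^2 \<Rightarrow> real^2 \<Rightarrow> 2 \<Rightarrow> R4 \<Rightarrow> R4" where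
  "inoue_g a b c i = (\<lambda>(x, y, w, t). (x + b$i * w + c$i, y + b$i * t, w + a$i, t))"

definition inoue_g3 :: "real^2 \<Rightarrow> real^2 \<Rightarrow> int \<Rightarrow> R4 \<Rightarrow> R4" where
  "inoue_g3 a b r = (\<lambda>(x, y, w, t). (x + (b$1 * a$2 - b$2 * a$1) / of_int r, y, w, t))"

text \<open>The restrictions are needed because elements of \<open>BijGroup\<close> are extensional functions.\<close>

definition inoue_group ::
    "real \<Rightarrow> real^2 \<Rightarrow> real^2 \<Rightarrow> real^2 \<Rightarrow> int \<Rightarrow> complex \<Rightarrow> (R4 \<Rightarrow> R4) set" where
  "inoue_group \<alpha> a b c r z = generate (BijGroup inoue_cover)
     ((\<lambda>g. restrict g inoue_cover) `
        {inoue_g0 \<alpha> z, inoue_g a b c 1, inoue_g a b c 2, inoue_g3 a b r})"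

definition inoue_surface ::
    "real \<Rightarrow> real^2 \<Rightarrow> real^2 \<Rightarrow> real^2 \<Rightarrow> int \<Rightarrow> complex \<Rightarrow> (R4 set, R4) chart set" where
  "inoue_surface \<alpha> a b c r z = quotient_atlas inoue_cover (inoue_group \<alpha> a b c r z)"

definition dt_over_t :: "R4 form" where
  "dt_over_t = (\<lambda>(x, y, w, t) vs. case vs of [(vx, vy, vw, vt)] \<Rightarrow> vt / t | _ \<Rightarrow> 0)"

definition lee_form ::
    "real \<Rightarrow> real^2 \<Rightarrow> real^2 \<Rightarrow> real^2 \<Rightarrow> int \<Rightarrow> complex \<Rightarrow> (R4 set, R4) mform" where
  "lee_form \<alpha> a b c r z = induced_form inoue_cover (inoue_group \<alpha> a b c r z) dt_over_t"

end

theory Submission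
  imports Defs "HOL-Library.Function_Algebras"
begin

text \<open>
  The surface is the quotient of the contractible cover \<open>X = {t > 0}\<close> by the group generated by
  \<open>g\<^sub>0, g\<^sub>1, g\<^sub>2, g\<^sub>3\<close>, and forms on it are invariant forms on \<open>X\<close> (\<open>push_surj\<close>). Writing such a form as
  \<open>t \<gamma>\<close> turns \<open>d\<^sub>\<theta>\<close> into \<open>d\<close>, because \<open>d\<^sub>\<theta> (t \<gamma>) = t d\<gamma>\<close>, and invariance of \<open>t \<gamma>\<close> into invariance of \<open>\<gamma>\<close> under
  \<open>g\<^sub>1, g\<^sub>2, g\<^sub>3\<close> together with \<open>\<alpha> g\<^sub>0\<^sup>* \<gamma> = \<gamma>\<close> (\<open>twisted_d_untwist\<close>). Geometrically, the surface is a
  bundle over the circle with coordinate \<open>log t\<close>, its fibre is the Heisenberg nilmanifold given by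
  \<open>g\<^sub>1, g\<^sub>2, g\<^sub>3\<close>, and the twist multiplies the monodromy by \<open>\<alpha>\<close>.

  The cohomology is computed along the tower of coverings \<open>X \<rightarrow> X/g\<^sub>3 \<rightarrow> X/(g\<^sub>3, g\<^sub>1) \<rightarrow> X/(g\<^sub>3, g\<^sub>1, g\<^sub>2) \<rightarrow> S\<close>, in
  which every step divides by an infinite cyclic group with generator \<open>h\<close>. On the forms of the
  upper storey \<open>h\<^sup>* - 1\<close> is surjective: a bump function in a coordinate that \<open>h\<close> translates splits a
  form into two halves, and on either half a geometric series is locally finite
  (\<open>transfer_equation\<close>). Hence there is a Wang sequence, and the cohomology of the lower storey
  consists of the kernel of \<open>h\<^sup>* - 1\<close> and, shifted by one degree, of its cokernel
  (\<open>represents_cohomology_fixed_Suc\<close>). The tower starts with the Poincare lemma on the convex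
  set \<open>X\<close>. Cohomology groups are described by explicit subspaces of closed forms, as the action
  of the next generator has to be known.

  After three steps one has the cohomology of the nilmanifold, with Betti numbers \<open>1, 2, 2, 1\<close>. With
  \<open>u = y/t\<close> and \<open>\<zeta> = dx - u dw\<close> it is spanned by \<open>1\<close>; \<open>du, dw\<close>; \<open>du \<and> \<zeta>, dw \<and> \<zeta>\<close>; \<open>du \<and> dw \<and> \<zeta>\<close>
  (\<open>represents_3\<close>, \<open>represents_3_eigen\<close>). The map \<open>g\<^sub>0\<close> divides \<open>u\<close> by \<open>\<alpha>\<close>, multiplies \<open>w\<close> by \<open>\<alpha>\<close> and
  preserves \<open>\<zeta>\<close>, so \<open>\<alpha> g\<^sub>0\<^sup>*\<close> has the eigenvalues \<open>\<alpha>\<close>; \<open>1, \<alpha>\<^sup>2\<close>; \<open>1, \<alpha>\<^sup>2\<close>; \<open>\<alpha>\<close> on these classes. Only the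
  eigenvalue \<open>1\<close> contributes to the last step (\<open>represents_4\<close>): with \<open>s = log t / log \<alpha>\<close>, the twisted
  cohomology, after division by \<open>t\<close>, is spanned by \<open>du\<close> in degree \<open>1\<close>, by \<open>du \<and> \<zeta>\<close> and \<open>ds \<and> du\<close> in degree \<open>2\<close> and by
  \<open>ds \<and> du \<and> \<zeta>\<close> in degree \<open>3\<close>.
\<close>

section \<open>Smooth functions\<close>

lemma frechet_derivative_cong_open:
  assumes "open U" "x \<in> U" "\<And>y. y \<in> U \<Longrightarrow> f y = g y"
  shows "frechet_derivative f (at x) = frechet_derivative g (at x)"
    and "f differentiable (at x) \<longleftrightarrow> g differentiable (at x)"
proof -
  have "(f has_derivative D) (at x) \<longleftrightarrow> (g has_derivative D) (at x)" for D
    using assms by (metis has_derivative_transform_within_open)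
  then show "frechet_derivative f (at x) = frechet_derivative g (at x)"
    and "f differentiable (at x) \<longleftrightarrow> g differentiable (at x)"
    by (simp_all add: frechet_derivative_def differentiable_def)
qed

lemma frechet_derivativeI:
  "(f has_derivative D) (at x) \<Longrightarrow> frechet_derivative f (at x) = D"
  using frechet_derivative_at by metis

lemma has_frechet_derivative:
  "f differentiable (at x) \<Longrightarrow> (f has_derivative frechet_derivative f (at x)) (at x)"
  by (simp add: frechet_derivative_works)

lemma Ck_on_cong:
  assumes "open U" "\<And>x. x \<in> U \<Longrightarrow> f x = g x"
  shows "Ck_on n U f \<longleftrightarrow> Ck_on n U g"
  using assms(2)
proof (induction n arbitrary: f g)
  case 0
  then show ?case by (simp cong: continuous_on_cong)
next
  case (Suc n)
  note eq = frechet_derivative_cong_open[OF assms(1) _ Suc.prems]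
  have "Ck_on n U (\<lambda>x. frechet_derivative f (at x) v) \<longleftrightarrow> Ck_on n U (\<lambda>x. frechet_derivative g (at x) v)" for v
    by (rule Suc.IH) (simp add: eq(1))
  moreover have "(\<forall>x\<in>U. f differentiable (at x)) \<longleftrightarrow> (\<forall>x\<in>U. g differentiable (at x))"
    using eq(2) by auto
  ultimately show ?case by simp
qed

lemma smooth_on_cong:
  assumes "open U" "\<And>x. x \<in> U \<Longrightarrow> f x = g x"
  shows "smooth_on U f \<longleftrightarrow> smooth_on U g"
  unfolding smooth_on_def using Ck_on_cong[OF assms] by simp

text \<open>Smoothness by coinduction: a class of differentiable functions that contains the directional
  derivatives of its members consists of smooth functions.\<close>

lemma smooth_on_coinduct [consumes 2, case_names step]:
  assumes "open U" "P f"
    and step: "\<And>f. P f \<Longrightarrow> (\<forall>x\<in>U. f differentiable (at x)) \<and>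
                (\<forall>v. \<exists>g. P g \<and> (\<forall>x\<in>U. frechet_derivative f (at x) v = g x))"
  shows "smooth_on U f"
proof -
  have "Ck_on n U f" if "P f" for n f
    using that
  proof (induction n arbitrary: f)
    case 0
    then have "\<forall>x\<in>U. f differentiable (at x)" using step by blast
    then show ?case
      by (simp add: continuous_at_imp_continuous_on differentiable_imp_continuous_within)
  next
    case (Suc n)
    have "Ck_on n U (\<lambda>x. frechet_derivative f (at x) v)" for v
    proof -
      obtain g where "P g" "\<forall>x\<in>U. frechet_derivative f (at x) v = g x"
        using step[OF Suc.prems] by blast
      with Suc.IH[of g] Ck_on_cong[OF assms(1), of "\<lambda>x. frechet_derivative f (at x) v" g n]
      show ?thesis by simp
    qed
    with step[OF Suc.prems] show ?case by simp
  qed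
  with assms(2) show ?thesis by (simp add: smooth_on_def)
qed

lemma smooth_on_imp_differentiable: "smooth_on U f \<Longrightarrow> x \<in> U \<Longrightarrow> f differentiable (at x)"
  unfolding smooth_on_def by (metis Ck_on.simps(2))

lemma smooth_on_has_derivative:
  "smooth_on U f \<Longrightarrow> x \<in> U \<Longrightarrow> (f has_derivative frechet_derivative f (at x)) (at x)"
  by (simp add: smooth_on_imp_differentiable has_frechet_derivative)

lemma smooth_on_derivative: "smooth_on U f \<Longrightarrow> smooth_on U (\<lambda>x. frechet_derivative f (at x) v)"
  unfolding smooth_on_def by (metis Ck_on.simps(2))

lemma smooth_on_imp_continuous_on: "smooth_on U f \<Longrightarrow> continuous_on U f"
  unfolding smooth_on_def by (metis Ck_on.simps(1))

lemma smooth_on_subset: "smooth_on U f \<Longrightarrow> V \<subseteq> U \<Longrightarrow> smooth_on V f"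
proof -
  have "Ck_on n U f \<Longrightarrow> V \<subseteq> U \<Longrightarrow> Ck_on n V f" for n
    by (induction n arbitrary: f) (auto intro: continuous_on_subset)
  then show "smooth_on U f \<Longrightarrow> V \<subseteq> U \<Longrightarrow> smooth_on V f"
    unfolding smooth_on_def by blast
qed

lemma smooth_on_local:
  assumes "\<And>x. x \<in> U \<Longrightarrow> \<exists>V. open V \<and> x \<in> V \<and> smooth_on V f"
  shows "smooth_on U f"
proof -
  have "Ck_on n U f" if "\<And>x. x \<in> U \<Longrightarrow> \<exists>V. open V \<and> x \<in> V \<and> smooth_on V f" for n f
    using that
  proof (induction n arbitrary: f)
    case 0
    have "continuous (at x) f" if "x \<in> U" for x
      using 0[OF that] smooth_on_imp_continuous_on
      by (metis continuous_on_eq_continuous_at)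
    then show ?case by (simp add: continuous_at_imp_continuous_on)
  next
    case (Suc n)
    have "f differentiable (at x)" if "x \<in> U" for x
      using Suc.prems[OF that] smooth_on_imp_differentiable by blast
    moreover have "Ck_on n U (\<lambda>x. frechet_derivative f (at x) v)" for v
    proof (rule Suc.IH)
      fix x assume "x \<in> U"
      then obtain V where "open V" "x \<in> V" "smooth_on V f" using Suc.prems by blast
      then show "\<exists>V. open V \<and> x \<in> V \<and> smooth_on V (\<lambda>x. frechet_derivative f (at x) v)"
        using smooth_on_derivative by blast
    qed
    ultimately show ?case by simp
  qed
  then show ?thesis using assms unfolding smooth_on_def[of U f] by blast
qed

lemma smooth_on_const [simp]: assumes "open U" shows "smooth_on U (\<lambda>x. c)"
proof -
  show ?thesis
    by (rule smooth_on_coinduct[where P="\<lambda>f. \<exists>c. f = (\<lambda>x. c)"])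
       (use assms in \<open>auto simp: frechet_derivative_const\<close>)
qed

lemma smooth_on_bounded_linear:
  assumes "open U" "bounded_linear f" shows "smooth_on U f"
proof -
  have D: "(f has_derivative f) (at x)" for x
    using assms(2) by (rule bounded_linear_imp_has_derivative)
  have eq: "frechet_derivative f (at x) = f" for x by (rule frechet_derivativeI[OF D])
  show ?thesis
  proof (rule smooth_on_coinduct[where P="\<lambda>g. g = f \<or> (\<exists>c. g = (\<lambda>x. c))"])
    fix g assume "g = f \<or> (\<exists>c. g = (\<lambda>x. c))"
    then show "(\<forall>x\<in>U. g differentiable (at x)) \<and>
      (\<forall>v. \<exists>h. (h = f \<or> (\<exists>c. h = (\<lambda>x. c))) \<and> (\<forall>x\<in>U. frechet_derivative g (at x) v = h x))"
    proof
      assume "g = f"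
      moreover have "f differentiable (at x)" for x using D by (auto simp: differentiable_def)
      moreover have "\<exists>h. (h = f \<or> (\<exists>c. h = (\<lambda>x. c))) \<and> (\<forall>x\<in>U. f v = h x)" for v
        by (rule exI[of _ "\<lambda>x. f v"]) auto
      ultimately show ?thesis by (simp add: eq)
    next
      assume "\<exists>c. g = (\<lambda>x. c)"
      then show ?thesis by (auto simp: frechet_derivative_const)
    qed
  qed (use assms in auto)
qed

lemma Ck_on_Suc_imp: "Ck_on (Suc n) U f \<Longrightarrow> Ck_on n U f"
proof (induction n arbitrary: f)
  case 0
  then show ?case
    by (simp add: continuous_at_imp_continuous_on differentiable_imp_continuous_within)
qed auto

lemma Ck_on_add:
  assumes "open U" "Ck_on n U f" "Ck_on n U g"
  shows "Ck_on n U (\<lambda>x. f x + g x)"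
  using assms(2,3)
proof (induction n arbitrary: f g)
  case 0 then show ?case by (simp add: continuous_on_add)
next
  case (Suc n)
  have D: "((\<lambda>x. f x + g x) has_derivative (\<lambda>v. frechet_derivative f (at x) v + frechet_derivative g (at x) v)) (at x)"
    if "x \<in> U" for x
    using Suc.prems that by (intro has_derivative_add has_frechet_derivative) auto
  have "Ck_on n U (\<lambda>x. frechet_derivative (\<lambda>x. f x + g x) (at x) v)" for v
    using Suc.IH[of "\<lambda>x. frechet_derivative f (at x) v" "\<lambda>x. frechet_derivative g (at x) v"] Suc.prems
    by (subst Ck_on_cong[OF assms(1), where g="\<lambda>x. frechet_derivative f (at x) v + frechet_derivative g (at x) v"])
       (auto simp: frechet_derivativeI[OF D])
  then show ?case using D by (auto simp: differentiable_def)
qed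

lemma smooth_on_add:
  assumes "open U" "smooth_on U f" "smooth_on U g"
  shows "smooth_on U (\<lambda>x. f x + g x)"
  using assms Ck_on_add unfolding smooth_on_def by blast

lemma Ck_on_mult:
  fixes f g :: "'a::euclidean_space \<Rightarrow> real"
  assumes "open U" "Ck_on n U f" "Ck_on n U g"
  shows "Ck_on n U (\<lambda>x. f x * g x)"
  using assms(2,3)
proof (induction n arbitrary: f g)
  case 0 then show ?case by (simp add: continuous_on_mult)
next
  case (Suc n)
  have D: "((\<lambda>x. f x * g x) has_derivative (\<lambda>v. f x * frechet_derivative g (at x) v + frechet_derivative f (at x) v * g x)) (at x)"
    if "x \<in> U" for x
    using Suc.prems that by (intro has_derivative_mult has_frechet_derivative) auto
  have "Ck_on n U (\<lambda>x. frechet_derivative (\<lambda>x. f x * g x) (at x) v)" for v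
  proof (subst Ck_on_cong[OF assms(1)])
    show "Ck_on n U (\<lambda>x. f x * frechet_derivative g (at x) v + frechet_derivative f (at x) v * g x)"
      using Suc.prems by (intro Ck_on_add[OF assms(1)] Suc.IH Ck_on_Suc_imp[of n U f] Ck_on_Suc_imp[of n U g]) auto
  qed (simp add: frechet_derivativeI[OF D])
  then show ?case using D by (auto simp: differentiable_def)
qed

lemma smooth_on_mult:
  fixes f g :: "'a::euclidean_space \<Rightarrow> real"
  assumes "open U" "smooth_on U f" "smooth_on U g"
  shows "smooth_on U (\<lambda>x. f x * g x)"
  using assms Ck_on_mult unfolding smooth_on_def by blast

lemma smooth_on_sum:
  assumes "open U" "\<And>i. i \<in> I \<Longrightarrow> smooth_on U (f i)"
  shows "smooth_on U (\<lambda>x. \<Sum>i\<in>I. f i x)"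
  using assms(2) by (induction I rule: infinite_finite_induct) (simp_all add: smooth_on_add smooth_on_const[OF assms(1)] assms(1))

lemma smooth_on_minus:
  fixes f :: "'a::euclidean_space \<Rightarrow> real"
  assumes "open U" "smooth_on U f"
  shows "smooth_on U (\<lambda>x. - f x)"
  using smooth_on_mult[OF assms(1) smooth_on_const[OF assms(1), of "-1"] assms(2)] by simp

lemma smooth_on_diff:
  fixes f g :: "'a::euclidean_space \<Rightarrow> real"
  assumes "open U" "smooth_on U f" "smooth_on U g"
  shows "smooth_on U (\<lambda>x. f x - g x)"
  using smooth_on_add[OF assms(1,2) smooth_on_minus[OF assms(1,3)]] by simp

lemma smooth_on_compose_affine:
  assumes "open U" "open V" "smooth_on V f" "h ` U \<subseteq> V"
    and h: "\<And>x. (h has_derivative L) (at x)"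
  shows "smooth_on U (\<lambda>x. f (h x))"
proof (rule smooth_on_coinduct[where P="\<lambda>k. \<exists>f. smooth_on V f \<and> k = (\<lambda>x. f (h x))"])
  fix k assume "\<exists>f. smooth_on V f \<and> k = (\<lambda>x. f (h x))"
  then obtain f where s: "smooth_on V f" and k: "k = (\<lambda>x. f (h x))" by blast
  have D: "(k has_derivative (\<lambda>v. frechet_derivative f (at (h x)) (L v))) (at x)" if "x \<in> U" for x
    unfolding k using that assms(4)
    by (intro has_derivative_compose[OF h]) (auto intro: smooth_on_has_derivative[OF s])
  have "\<exists>k'. (\<exists>f. smooth_on V f \<and> k' = (\<lambda>x. f (h x))) \<and> (\<forall>x\<in>U. frechet_derivative k (at x) v = k' x)" for v
    using smooth_on_derivative[OF s, of "L v"] D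
    by (intro exI[of _ "\<lambda>x. frechet_derivative f (at (h x)) (L v)"])
       (auto simp: frechet_derivativeI[OF D])
  then show "(\<forall>x\<in>U. k differentiable (at x)) \<and> (\<forall>v. \<exists>k'. (\<exists>f. smooth_on V f \<and> k' = (\<lambda>x. f (h x))) \<and> (\<forall>x\<in>U. frechet_derivative k (at x) v = k' x))"
    using D by (auto simp: differentiable_def)
qed (use assms in auto)

lemma Ck_on_compose_real:
  fixes g :: "real \<Rightarrow> real" and l :: "'a::euclidean_space \<Rightarrow> real"
  assumes "open U" "l ` U \<subseteq> V" "smooth_on V g" "Ck_on n U l"
  shows "Ck_on n U (\<lambda>x. g (l x))"
  using assms(3,4)
proof (induction n arbitrary: g)
  case 0
  then show ?case
    using assms(2) continuous_on_compose2 smooth_on_imp_continuous_on by (metis Ck_on.simps(1))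
next
  case (Suc n)
  have D: "((\<lambda>x. g (l x)) has_derivative (\<lambda>v. frechet_derivative g (at (l x)) 1 * frechet_derivative l (at x) v)) (at x)"
    if "x \<in> U" for x
  proof -
    have "(g has_derivative frechet_derivative g (at (l x))) (at (l x))"
      using that assms(2) by (intro smooth_on_has_derivative[OF Suc.prems(1)]) auto
    moreover from this have "frechet_derivative g (at (l x)) = (\<lambda>v. frechet_derivative g (at (l x)) 1 * v)"
      by (intro ext) (metis has_derivative_linear linear_cmul mult.commute mult.right_neutral real_scaleR_def)
    ultimately have g: "(g has_derivative (\<lambda>v. frechet_derivative g (at (l x)) 1 * v)) (at (l x))" by simp
    show ?thesis
      by (rule has_derivative_compose[where f=l and g=g, OF _ g])
         (use Suc.prems(2) that in \<open>simp add: has_frechet_derivative\<close>)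
  qed
  have "Ck_on n U (\<lambda>x. frechet_derivative (\<lambda>x. g (l x)) (at x) v)" for v
  proof (subst Ck_on_cong[OF assms(1)])
    show "Ck_on n U (\<lambda>x. frechet_derivative g (at (l x)) 1 * frechet_derivative l (at x) v)"
      by (intro Ck_on_mult[OF assms(1)] Suc.IH[OF smooth_on_derivative[OF Suc.prems(1)]])
         (use Suc.prems(2) Ck_on_Suc_imp[OF Suc.prems(2)] in simp_all)
  qed (simp add: frechet_derivativeI[OF D])
  then show ?case using D by (auto simp: differentiable_def)
qed

lemma smooth_on_compose_real:
  fixes g :: "real \<Rightarrow> real" and l :: "'a::euclidean_space \<Rightarrow> real"
  assumes "open U" "l ` U \<subseteq> V" "smooth_on V g" "smooth_on U l"
  shows "smooth_on U (\<lambda>x. g (l x))"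
  using Ck_on_compose_real[OF assms(1-3)] assms(4) unfolding smooth_on_def by blast

text \<open>For functions of one variable the directional derivatives are the multiples of a single function.\<close>

lemma smooth_on_real_coinduct:
  fixes f :: "real \<Rightarrow> real"
  assumes "open U" "P f"
    and step: "\<And>f. P f \<Longrightarrow> \<exists>g. (\<forall>x\<in>U. (f has_real_derivative g x) (at x)) \<and> (\<forall>c. P (\<lambda>x. c * g x))"
  shows "smooth_on U f"
proof (rule smooth_on_coinduct[where P=P, OF assms(1,2)])
  fix f assume "P f"
  then obtain g where g: "\<forall>x\<in>U. (f has_real_derivative g x) (at x)" "\<forall>c. P (\<lambda>x. c * g x)"
    using step by blast
  then have "\<forall>x\<in>U. frechet_derivative f (at x) = (*) (g x)"
    by (auto intro!: frechet_derivativeI simp: has_field_derivative_def)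
  moreover have "f differentiable (at x)" if "x \<in> U" for x
    using g(1) that by (auto simp: has_field_derivative_def differentiable_def)
  ultimately show "(\<forall>x\<in>U. f differentiable (at x)) \<and>
      (\<forall>v. \<exists>g. P g \<and> (\<forall>x\<in>U. frechet_derivative f (at x) v = g x))"
    using g(2) by (metis mult.commute)
qed

lemma smooth_on_inverse_real: "smooth_on {0<..} (inverse :: real \<Rightarrow> real)"
proof (rule smooth_on_real_coinduct[where P="\<lambda>f. \<exists>c n. f = (\<lambda>x::real. c * inverse x ^ n)"])
  show "\<exists>c n. inverse = (\<lambda>x::real. c * inverse x ^ n)"
    by (rule exI[of _ 1], rule exI[of _ 1]) auto
next
  fix f :: "real \<Rightarrow> real" assume "\<exists>c n. f = (\<lambda>x. c * inverse x ^ n)"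
  then obtain c n where f: "f = (\<lambda>x. c * inverse x ^ n)" by blast
  have "(f has_real_derivative (- c * real n * inverse x ^ Suc n)) (at x)" if "x \<in> {0<..}" for x
  proof (cases n)
    case (Suc m)
    have "((\<lambda>x. c * inverse x ^ Suc m) has_real_derivative
        c * (real (Suc m) * (- (inverse x ^ Suc (Suc 0)) * inverse x ^ m))) (at x)"
      using DERIV_cmult[OF DERIV_power[OF DERIV_inverse[of x UNIV], of "Suc m"], of c] that by simp
    then show ?thesis unfolding f Suc by (simp add: algebra_simps)
  qed (simp add: f)
  moreover have "\<forall>c'. \<exists>c'' m. (\<lambda>x. c' * (- c * real n * inverse x ^ Suc n)) = (\<lambda>x. c'' * inverse x ^ m)"
    by (metis mult.assoc)
  ultimately show "\<exists>g. (\<forall>x\<in>{0<..}. (f has_real_derivative g x) (at x)) \<and>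
      (\<forall>c. \<exists>c' n. (\<lambda>x. c * g x) = (\<lambda>x. c' * inverse x ^ n))"
    by (intro exI[of _ "\<lambda>x. - c * real n * inverse x ^ Suc n"] conjI ballI)
qed auto

lemma smooth_on_inverse:
  fixes f :: "'a::euclidean_space \<Rightarrow> real"
  assumes "open U" "smooth_on U f" "\<And>x. x \<in> U \<Longrightarrow> f x > 0"
  shows "smooth_on U (\<lambda>x. inverse (f x))"
  using smooth_on_compose_real[OF assms(1) _ smooth_on_inverse_real assms(2)] assms(3) by auto

lemma smooth_on_divide:
  fixes f g :: "'a::euclidean_space \<Rightarrow> real"
  assumes "open U" "smooth_on U f" "smooth_on U g" "\<And>x. x \<in> U \<Longrightarrow> g x > 0"
  shows "smooth_on U (\<lambda>x. f x / g x)"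
  using smooth_on_mult[OF assms(1,2) smooth_on_inverse[OF assms(1,3,4)]] by (simp add: field_simps)

lemma smooth_on_ln:
  fixes f :: "'a::euclidean_space \<Rightarrow> real"
  assumes "open U" "smooth_on U f" "\<And>x. x \<in> U \<Longrightarrow> f x > 0"
  shows "smooth_on U (\<lambda>x. ln (f x))"
proof -
  have "smooth_on {0<..} (ln :: real \<Rightarrow> real)"
  proof (rule smooth_on_coinduct[where P="\<lambda>f. f = ln \<or> smooth_on {0<..} f"])
    fix g :: "real \<Rightarrow> real" assume "g = ln \<or> smooth_on {0<..} g"
    then show "(\<forall>x\<in>{0<..}. g differentiable (at x)) \<and>
        (\<forall>v. \<exists>h. (h = ln \<or> smooth_on {0<..} h) \<and> (\<forall>x\<in>{0<..}. frechet_derivative g (at x) v = h x))"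
    proof
      assume g: "g = ln"
      have D: "(ln has_derivative (\<lambda>v. inverse x * v)) (at x)" if "x > 0" for x :: real
        using DERIV_ln[OF that] by (simp add: has_field_derivative_def)
      have "\<exists>h. (h = ln \<or> smooth_on {0<..} h) \<and> (\<forall>x\<in>{0<..}. frechet_derivative g (at x) v = h x)" for v
        using smooth_on_mult[OF _ smooth_on_inverse_real smooth_on_const[of _ v]]
        by (intro exI[of _ "\<lambda>x. inverse x * v"]) (auto simp: g frechet_derivativeI[OF D])
      then show ?thesis using D by (auto simp: g differentiable_def)
    next
      assume "smooth_on {0<..} g"
      then show ?thesis using smooth_on_derivative[of _ g] smooth_on_imp_differentiable[of _ g] by blast
    qed
  qed auto
  then show ?thesis
    using smooth_on_compose_real[OF assms(1), of f "{0<..}" ln] assms(2,3) by auto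
qed

lemma DERIV_along_line:
  assumes "smooth_on U f" "y + s *\<^sub>R u \<in> U"
  shows "((\<lambda>s. f (y + s *\<^sub>R u)) has_real_derivative frechet_derivative f (at (y + s *\<^sub>R u)) u) (at s)"
proof -
  have g: "(f has_derivative frechet_derivative f (at (y + s *\<^sub>R u))) (at (y + s *\<^sub>R u))"
    using smooth_on_has_derivative[OF assms] .
  have comm: "(\<lambda>h. h * c) = (*) c" for c :: real by (auto simp: mult.commute)
  have "((\<lambda>s. y + s *\<^sub>R u) has_derivative (\<lambda>h. h *\<^sub>R u)) (at s)"
    by (auto intro!: derivative_eq_intros)
  from has_derivative_compose[OF this g]
  have "((\<lambda>s. f (y + s *\<^sub>R u)) has_derivative (\<lambda>h. frechet_derivative f (at (y + s *\<^sub>R u)) (h *\<^sub>R u))) (at s)" .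
  then show ?thesis
    using linear_cmul[OF has_derivative_linear[OF g]]
    by (simp add: has_field_derivative_def comm)
qed

text \<open>The mean value theorem, applied along \<open>u\<close> and then along \<open>v\<close>, turns the second difference
  into a mixed derivative at a nearby point. The left-hand side is symmetric in \<open>u\<close> and \<open>v\<close>,
  which is what makes mixed derivatives commute in the limit \<open>h \<rightarrow> 0\<close>.\<close>

lemma second_difference:
  fixes f :: "'a::euclidean_space \<Rightarrow> real"
  assumes f: "smooth_on U f" and h: "h > 0"
    and U: "\<And>s t. 0 \<le> s \<Longrightarrow> s \<le> h \<Longrightarrow> 0 \<le> t \<Longrightarrow> t \<le> h \<Longrightarrow> x + s *\<^sub>R u + t *\<^sub>R v \<in> U"
  shows "\<exists>s t. 0 \<le> s \<and> s \<le> h \<and> 0 \<le> t \<and> t \<le> h \<and>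
    f (x + h *\<^sub>R u + h *\<^sub>R v) - f (x + h *\<^sub>R u) - f (x + h *\<^sub>R v) + f x
      = h\<^sup>2 * frechet_derivative (\<lambda>y. frechet_derivative f (at y) u) (at (x + s *\<^sub>R u + t *\<^sub>R v)) v"
proof -
  define Du where "Du = (\<lambda>y. frechet_derivative f (at y) u)"
  have Du: "smooth_on U Du" unfolding Du_def by (rule smooth_on_derivative[OF f])
  define \<phi> where "\<phi> = (\<lambda>s. f (x + s *\<^sub>R u + h *\<^sub>R v) - f (x + s *\<^sub>R u))"
  have "(\<phi> has_real_derivative Du (x + s *\<^sub>R u + h *\<^sub>R v) - Du (x + s *\<^sub>R u)) (at s)"
    if "0 \<le> s" "s \<le> h" for s
  proof -
    have 1: "(x + h *\<^sub>R v) + s *\<^sub>R u \<in> U" using U[of s h] that h by (simp add: algebra_simps)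
    have 2: "x + s *\<^sub>R u \<in> U" using U[of s 0] that h by simp
    have "(\<phi> has_real_derivative Du ((x + h *\<^sub>R v) + s *\<^sub>R u) - Du (x + s *\<^sub>R u)) (at s)"
      using DERIV_diff[OF DERIV_along_line[OF f 1] DERIV_along_line[OF f 2]]
      unfolding \<phi>_def Du_def by (simp add: algebra_simps)
    then show ?thesis by (simp add: algebra_simps)
  qed
  from MVT2[OF h this] obtain s where s: "0 < s" "s < h"
    and 1: "\<phi> h - \<phi> 0 = h * (Du (x + s *\<^sub>R u + h *\<^sub>R v) - Du (x + s *\<^sub>R u))" by auto
  have "((\<lambda>t. Du (x + s *\<^sub>R u + t *\<^sub>R v)) has_real_derivative frechet_derivative Du (at (x + s *\<^sub>R u + t *\<^sub>R v)) v) (at t)"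
    if "0 \<le> t" "t \<le> h" for t
    using DERIV_along_line[OF Du U[of s t]] s that by simp
  from MVT2[OF h this] obtain t where t: "0 < t" "t < h"
    and 2: "Du (x + s *\<^sub>R u + h *\<^sub>R v) - Du (x + s *\<^sub>R u) = h * frechet_derivative Du (at (x + s *\<^sub>R u + t *\<^sub>R v)) v" by auto
  show ?thesis
    using s t 1 2 unfolding \<phi>_def Du_def
    by (intro exI[of _ s] exI[of _ t]) (simp add: algebra_simps power2_eq_square)
qed

lemma second_derivative_symmetric:
  fixes f :: "'a::euclidean_space \<Rightarrow> real"
  assumes U: "open U" and f: "smooth_on U f" and x: "x \<in> U"
  shows "frechet_derivative (\<lambda>y. frechet_derivative f (at y) u) (at x) v
       = frechet_derivative (\<lambda>y. frechet_derivative f (at y) v) (at x) u" (is "?A x = ?B x")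
proof (rule ccontr)
  assume neq: "?A x \<noteq> ?B x"
  define e where "e = \<bar>?A x - ?B x\<bar> / 2"
  have e: "e > 0" using neq by (simp add: e_def)
  have "continuous_on U ?A" "continuous_on U ?B"
    by (intro smooth_on_imp_continuous_on smooth_on_derivative f)+
  then have "isCont ?A x" "isCont ?B x"
    using U x continuous_on_eq_continuous_at by blast+
  then have "?A \<midarrow>x\<rightarrow> ?A x" "?B \<midarrow>x\<rightarrow> ?B x" by (simp_all add: isCont_def)
  then have "(?A \<longlongrightarrow> ?A x) (nhds x)" "(?B \<longlongrightarrow> ?B x) (nhds x)"
    by (simp_all add: tendsto_nhds_iff)
  then have "\<forall>\<^sub>F y in nhds x. dist (?A y) (?A x) < e" "\<forall>\<^sub>F y in nhds x. dist (?B y) (?B x) < e"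
    using e by (simp_all add: tendsto_iff)
  moreover have "\<forall>\<^sub>F y in nhds x. y \<in> U" using U x by (rule eventually_nhds_in_open)
  ultimately have "\<forall>\<^sub>F y in nhds x. dist (?A y) (?A x) < e \<and> dist (?B y) (?B x) < e \<and> y \<in> U"
    by eventually_elim blast
  then obtain d where d: "d > 0"
    and near: "\<And>y. dist y x < d \<Longrightarrow> dist (?A y) (?A x) < e \<and> dist (?B y) (?B x) < e \<and> y \<in> U"
    unfolding eventually_nhds_metric by blast
  define h where "h = d / (norm u + norm v + 1) / 2"
  have h: "h > 0" using d by (simp add: h_def add_nonneg_pos)
  have small: "dist (x + s *\<^sub>R u + t *\<^sub>R v) x < d" if "0 \<le> s" "s \<le> h" "0 \<le> t" "t \<le> h" for s t
  proof -
    have "dist (x + s *\<^sub>R u + t *\<^sub>R v) x \<le> s * norm u + t * norm v"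
      using norm_triangle_ineq[of "s *\<^sub>R u" "t *\<^sub>R v"] that by (simp add: dist_norm algebra_simps)
    also have "\<dots> \<le> h * norm u + h * norm v"
      using that by (intro add_mono mult_right_mono) auto
    also have "\<dots> \<le> h * (norm u + norm v + 1)" using h by (simp add: algebra_simps)
    also have "\<dots> = d / 2"
      using add_nonneg_pos[of "norm u + norm v" 1] by (simp add: h_def divide_simps)
    also have "\<dots> < d" using d by simp
    finally show ?thesis .
  qed
  obtain s t where st: "0 \<le> s" "s \<le> h" "0 \<le> t" "t \<le> h"
    and 1: "f (x + h *\<^sub>R u + h *\<^sub>R v) - f (x + h *\<^sub>R u) - f (x + h *\<^sub>R v) + f x = h\<^sup>2 * ?A (x + s *\<^sub>R u + t *\<^sub>R v)"
    using second_difference[OF f h, of x u v] small near by blast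
  have small': "dist (x + s *\<^sub>R v + t *\<^sub>R u) x < d" if "0 \<le> s" "s \<le> h" "0 \<le> t" "t \<le> h" for s t
    using small[of t s] that by (simp add: algebra_simps)
  obtain s' t' where st': "0 \<le> s'" "s' \<le> h" "0 \<le> t'" "t' \<le> h"
    and 2: "f (x + h *\<^sub>R v + h *\<^sub>R u) - f (x + h *\<^sub>R v) - f (x + h *\<^sub>R u) + f x = h\<^sup>2 * ?B (x + s' *\<^sub>R v + t' *\<^sub>R u)"
    using second_difference[OF f h, of x v u] small' near by blast
  have "h\<^sup>2 * ?A (x + s *\<^sub>R u + t *\<^sub>R v) = h\<^sup>2 * ?B (x + s' *\<^sub>R v + t' *\<^sub>R u)"
    using 1 2 by (simp add: algebra_simps)
  then have "?A (x + s *\<^sub>R u + t *\<^sub>R v) = ?B (x + s' *\<^sub>R v + t' *\<^sub>R u)" using h by simp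
  moreover have "dist (?A (x + s *\<^sub>R u + t *\<^sub>R v)) (?A x) < e" using near[OF small[OF st]] by blast
  moreover have "dist (?B (x + s' *\<^sub>R v + t' *\<^sub>R u)) (?B x) < e" using near[OF small'[OF st']] by blast
  ultimately show False unfolding e_def dist_real_def by argo
qed

section \<open>A smooth step function\<close>

text \<open>The functions \<open>p (1/x) exp (-1/x)\<close> for \<open>x > 0\<close>, continued by \<open>0\<close>. Allowing an arbitrary
  polynomial \<open>p\<close> makes the class closed under differentiation, also at the origin, because
  exponential decay beats polynomial growth.\<close>

definition flat_exp :: "real poly \<Rightarrow> real \<Rightarrow> real" where
  "flat_exp p x = (if x > 0 then poly p (inverse x) * exp (- inverse x) else 0)"

lemma tendsto_poly_times_exp_minus: "((\<lambda>u::real. poly p u * exp (- u)) \<longlongrightarrow> 0) at_top"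
proof -
  have "((\<lambda>u. \<Sum>i\<le>degree p. coeff p i * (u ^ i / exp u)) \<longlongrightarrow> (\<Sum>i\<le>degree p. coeff p i * 0)) at_top"
    by (intro tendsto_sum tendsto_mult tendsto_const tendsto_power_div_exp_0)
  then show ?thesis
    by (simp add: poly_altdef sum_divide_distrib exp_minus divide_inverse[symmetric])
qed

lemma flat_exp_DERIV:
  "(flat_exp p has_real_derivative flat_exp ([:0, 0, 1:] * (p - pderiv p)) x) (at x)"
proof -
  consider "x > 0" | "x < 0" | "x = 0" by linarith
  then show ?thesis
  proof cases
    case 1
    have "((\<lambda>x. poly p (inverse x) * exp (- inverse x)) has_real_derivative
        poly ([:0, 0, 1:] * (p - pderiv p)) (inverse x) * exp (- inverse x)) (at x)"
      using 1 by (auto intro!: derivative_eq_intros poly_DERIV[THEN DERIV_chain2] simp: algebra_simps power2_eq_square)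
    then show ?thesis
      using 1 by (rule_tac has_field_derivative_transform_within_open[where S="{0<..}"])
        (auto simp: flat_exp_def)
  next
    case 2
    have "((\<lambda>x. 0) has_real_derivative 0) (at x)" by simp
    then show ?thesis
      using 2 by (subst flat_exp_def, rule_tac has_field_derivative_transform_within_open[where S="{..<0}"])
        (auto simp: flat_exp_def)
  next
    case 3
    have "((\<lambda>h. flat_exp p h / h) \<longlongrightarrow> 0) (at 0)"
    proof (rule filterlim_split_at)
      have "((\<lambda>h. poly (pCons 0 p) (inverse h) * exp (- inverse h)) \<longlongrightarrow> 0) (at_right 0)"
        by (rule filterlim_compose[OF tendsto_poly_times_exp_minus filterlim_inverse_at_top_right])
      then show "((\<lambda>h. flat_exp p h / h) \<longlongrightarrow> 0) (at_right 0)"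
        by (rule Lim_transform_eventually)
           (auto simp: eventually_at_filter flat_exp_def field_simps)
      show "((\<lambda>h. flat_exp p h / h) \<longlongrightarrow> 0) (at_left 0)"
        by (rule Lim_transform_eventually[of "\<lambda>h. 0"])
           (auto simp: eventually_at_filter flat_exp_def)
    qed
    then show ?thesis by (simp add: 3 DERIV_def flat_exp_def)
  qed
qed

lemma flat_exp_smooth: "smooth_on UNIV (flat_exp p)"
proof (rule smooth_on_real_coinduct[where P="\<lambda>f. \<exists>p. f = flat_exp p"])
  fix f assume "\<exists>p. f = flat_exp p"
  then obtain p where f: "f = flat_exp p" by blast
  have "\<exists>p'. (\<lambda>x. c * flat_exp p x) = flat_exp p'" for c p
    by (rule exI[of _ "smult c p"]) (auto simp: flat_exp_def)
  then show "\<exists>g. (\<forall>x\<in>UNIV. (f has_real_derivative g x) (at x)) \<and> (\<forall>c. \<exists>p. (\<lambda>x. c * g x) = flat_exp p)"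
    unfolding f using flat_exp_DERIV by (intro exI[of _ "flat_exp ([:0, 0, 1:] * (p - pderiv p))"]) blast
qed auto

text \<open>The step splits an invariant form into a part supported on one side of a hypersurface and a
  part supported on the other side.\<close>

definition smooth_step :: "real \<Rightarrow> real" where
  "smooth_step s = flat_exp 1 s / (flat_exp 1 s + flat_exp 1 (1 - s))"

lemma smooth_step_0: "s \<le> 0 \<Longrightarrow> smooth_step s = 0"
  by (simp add: smooth_step_def flat_exp_def)

lemma smooth_step_1: "s \<ge> 1 \<Longrightarrow> smooth_step s = 1"
  by (simp add: smooth_step_def flat_exp_def)

lemma smooth_on_smooth_step: "smooth_on UNIV smooth_step"
proof -
  have "smooth_on UNIV (\<lambda>s. flat_exp 1 (1 - s))"
    by (rule smooth_on_compose_affine[OF _ _ flat_exp_smooth, of _ _ "\<lambda>x. - x"])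
       (auto intro!: derivative_eq_intros)
  moreover have "flat_exp 1 s + flat_exp 1 (1 - s) > 0" for s
    by (cases "s > 0"; cases "s < 1") (auto simp: flat_exp_def add_pos_pos)
  ultimately show ?thesis
    unfolding smooth_step_def by (intro smooth_on_divide smooth_on_add flat_exp_smooth) auto
qed

section \<open>Alternating forms\<close>

text \<open>Forms are functions. With the pointwise vector space structure, spaces of forms become
  subspaces of a real vector space, so that spans and linear maps are available for them.\<close>

instantiation "fun" :: (type, real_vector) real_vector
begin

definition scaleR_fun :: "real \<Rightarrow> ('a \<Rightarrow> 'b) \<Rightarrow> 'a \<Rightarrow> 'b"
  where "scaleR_fun r f = (\<lambda>x. r *\<^sub>R f x)"

instance
  by standard (simp_all add: scaleR_fun_def fun_eq_iff scaleR_add_right scaleR_add_left)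

end

lemma scaleR_fun_apply [simp]: "(r *\<^sub>R f) x = r *\<^sub>R f x"
  by (simp add: scaleR_fun_def)

declare plus_fun_apply [simp] zero_fun_apply [simp] minus_apply [simp] uminus_apply [simp]

text \<open>Alternation has to be checked on neighbouring arguments only. The list patterns
  \<open>xs @ v # ys\<close> suit inductions over lists better than positions do.\<close>

lemma alternating_multilinear_iff:
  "alternating_multilinear k m \<longleftrightarrow>
     (\<forall>xs ys. Suc (length xs + length ys) = k \<longrightarrow> linear (\<lambda>v. m (xs @ v # ys))) \<and>
     (\<forall>xs ys v. Suc (Suc (length xs + length ys)) = k \<longrightarrow> m (xs @ v # v # ys) = 0)"
  (is "_ \<longleftrightarrow> ?lin \<and> ?adj")
proof
  assume m: "alternating_multilinear k m"
  have "linear (\<lambda>v. m (xs @ v # ys))" if "Suc (length xs + length ys) = k" for xs ys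
  proof -
    have "linear (\<lambda>v. m ((xs @ 0 # ys)[length xs := v]))"
      using m[unfolded alternating_multilinear_def, THEN conjunct1, rule_format, of "xs @ 0 # ys" "length xs"]
        that by simp
    then show ?thesis by simp
  qed
  moreover have "m (xs @ v # v # ys) = 0" if "Suc (Suc (length xs + length ys)) = k" for xs ys v
  proof -
    have "length (xs @ v # v # ys) = k" "length xs < Suc (length xs)" "Suc (length xs) < k"
      "(xs @ v # v # ys) ! length xs = (xs @ v # v # ys) ! Suc (length xs)"
      using that by (auto simp: nth_append)
    then show ?thesis using m unfolding alternating_multilinear_def by blast
  qed
  ultimately show "?lin \<and> ?adj" by blast
next
  assume "?lin \<and> ?adj"
  then have lin: "\<And>xs ys. Suc (length xs + length ys) = k \<Longrightarrow> linear (\<lambda>v. m (xs @ v # ys))"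
    and adj: "\<And>xs ys v. Suc (Suc (length xs + length ys)) = k \<Longrightarrow> m (xs @ v # v # ys) = 0" by blast+
  have swap: "m (xs @ a # b # ys) = - m (xs @ b # a # ys)"
    if "Suc (Suc (length xs + length ys)) = k" for xs ys a b
  proof -
    have 1: "m (xs @ (a + b) # c # ys) = m (xs @ a # c # ys) + m (xs @ b # c # ys)" for c
      using linear_add[OF lin[of xs "c # ys"], of a b] that by simp
    have 2: "m (xs @ c # (a + b) # ys) = m (xs @ c # a # ys) + m (xs @ c # b # ys)" for c
      using linear_add[OF lin[of "xs @ [c]" "ys"], of a b] that by simp
    show ?thesis using adj[OF that, of "a + b"] adj[OF that, of a] adj[OF that, of b]
      by (simp add: 1 2)
  qed
  \<comment> \<open>Two equal arguments are brought next to each other by swaps of neighbours.\<close>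
  have eq: "m (xs @ v # ys @ v # zs) = 0" if "Suc (Suc (length xs + length ys + length zs)) = k" for xs ys zs v
    using that
  proof (induction ys arbitrary: xs)
    case Nil then show ?case using adj by simp
  next
    case (Cons y ys)
    have "m (xs @ v # (y # ys) @ v # zs) = - m (xs @ y # v # ys @ v # zs)"
      using swap[of xs "ys @ v # zs" v y] Cons.prems by simp
    also have "\<dots> = 0" using Cons.IH[of "xs @ [y]"] Cons.prems by simp
    finally show ?case .
  qed
  show "alternating_multilinear k m"
    unfolding alternating_multilinear_def
  proof (intro conjI allI impI)
    fix vs :: "'a list" and i assume "length vs = k \<and> i < k"
    then show "linear (\<lambda>v. m (vs[i := v]))"
      using lin[of "take i vs" "drop (Suc i) vs"] by (simp add: upd_conv_take_nth_drop)
  next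
    fix vs :: "'a list" and i j
    assume a: "length vs = k \<and> i < j \<and> j < k \<and> vs ! i = vs ! j"
    define xs ys zs where "xs = take i vs" and "ys = take (j - Suc i) (drop (Suc i) vs)" and "zs = drop (Suc j) vs"
    have "vs = xs @ vs ! i # drop (Suc i) vs"
      unfolding xs_def using a by (intro id_take_nth_drop) auto
    moreover have "drop (Suc i) vs = ys @ drop (Suc i) vs ! (j - Suc i) # drop (Suc (j - Suc i)) (drop (Suc i) vs)"
      unfolding ys_def using a by (intro id_take_nth_drop) auto
    ultimately have "vs = xs @ vs ! i # ys @ vs ! i # zs"
      using a by (simp add: zs_def)
    moreover from this have "Suc (Suc (length xs + length ys + length zs)) = k"
      using a by (metis add.assoc add_Suc_right length_Cons length_append)
    ultimately show "m vs = 0" using eq by metis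
  qed
qed

lemma alternating_multilinear_linear:
  "alternating_multilinear k m \<Longrightarrow> Suc (length xs + length ys) = k \<Longrightarrow> linear (\<lambda>v. m (xs @ v # ys))"
  unfolding alternating_multilinear_iff by blast

lemma alternating_multilinear_zero:
  "alternating_multilinear k m \<Longrightarrow> Suc (Suc (length xs + length ys)) = k \<Longrightarrow> m (xs @ v # v # ys) = 0"
  unfolding alternating_multilinear_iff by blast

lemma alternating_multilinear_Cons:
  assumes "alternating_multilinear (Suc k) m"
  shows "alternating_multilinear k (\<lambda>ws. m (x # ws))"
  unfolding alternating_multilinear_iff
  using alternating_multilinear_linear[OF assms, of "x # xs" for xs]
    alternating_multilinear_zero[OF assms, of "x # xs" for xs] by simp

text \<open>
  The alternating sum \<open>\<Sum>\<^sub>i (-1)\<^sup>i A v\<^sub>i (v\<^sub>0,\<dots>,v\<^sub>i omitted,\<dots>,v\<^sub>k)\<close> behind both the exterior derivative and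
  the wedge product with a one-form. Splitting off the first vector turns the sign bookkeeping
  into list induction.
\<close>

primrec alt_sum :: "('a \<Rightarrow> 'a list \<Rightarrow> real) \<Rightarrow> 'a list \<Rightarrow> real" where
  "alt_sum A [] = 0"
| "alt_sum A (v # vs) = A v vs - alt_sum (\<lambda>u ws. A u (v # ws)) vs"

lemma omit_Cons [simp]: "omit 0 (v # vs) = vs" "omit (Suc i) (v # vs) = v # omit i vs"
  by (simp_all add: omit_def)

lemma alt_sum_eq: "(\<Sum>i<length vs. (-1) ^ i * A (vs ! i) (omit i vs)) = alt_sum A vs"
proof (induction vs arbitrary: A)
  case (Cons v vs)
  show ?case
    using Cons.IH[of "\<lambda>u ws. A u (v # ws)"]
    by (simp add: sum.lessThan_Suc_shift sum_negf del: sum.lessThan_Suc)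
qed simp

lemma alt_sum_cong:
  "(\<And>v ws. v \<in> set vs \<Longrightarrow> Suc (length ws) = length vs \<Longrightarrow> A v ws = B v ws) \<Longrightarrow> alt_sum A vs = alt_sum B vs"
proof (induction vs arbitrary: A B)
  case (Cons v vs)
  have "alt_sum (\<lambda>u ws. A u (v # ws)) vs = alt_sum (\<lambda>u ws. B u (v # ws)) vs"
    by (rule Cons.IH) (simp add: Cons.prems)
  then show ?case by (simp add: Cons.prems)
qed simp

lemma alt_sum_zero: "alt_sum (\<lambda>v ws. 0) vs = 0"
  by (induction vs) simp_all

lemma alt_sum_add: "alt_sum (\<lambda>v ws. A v ws + B v ws) vs = alt_sum A vs + alt_sum B vs"
  by (induction vs arbitrary: A B) simp_all

lemma alt_sum_diff: "alt_sum (\<lambda>v ws. A v ws - B v ws) vs = alt_sum A vs - alt_sum B vs"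
  by (induction vs arbitrary: A B) simp_all

lemma alt_sum_scale: "alt_sum (\<lambda>v ws. r * A v ws) vs = r * alt_sum A vs"
  by (induction vs arbitrary: A) (simp_all add: algebra_simps)

lemma alt_sum_map: "alt_sum A (map L vs) = alt_sum (\<lambda>v ws. A (L v) (map L ws)) vs"
  by (induction vs arbitrary: A) simp_all

lemma alt_sum_linear:
  assumes "\<And>u ws. Suc (length ws) = length vs \<Longrightarrow> linear (\<lambda>v. B v u ws)"
  shows "linear (\<lambda>v. alt_sum (B v) vs)"
  using assms
proof (induction vs arbitrary: B)
  case (Cons x vs)
  have "linear (\<lambda>v. alt_sum (\<lambda>u ws. B v u (x # ws)) vs)"
    by (rule Cons.IH) (simp add: Cons.prems)
  moreover have "linear (\<lambda>v. B v x vs)" by (simp add: Cons.prems)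
  ultimately show ?case by (simp add: linear_compose_sub)
qed (simp add: module_hom_zero)

text \<open>Antisymmetrising in one more argument: two equal neighbours either both stay in the
  alternating argument or contribute two terms of opposite sign.\<close>

lemma alternating_alt_sum:
  assumes "\<And>u. alternating_multilinear k (A u)" "\<And>ws. length ws = k \<Longrightarrow> linear (\<lambda>u. A u ws)"
  shows "alternating_multilinear (Suc k) (alt_sum A)"
proof -
  have "linear (\<lambda>v. alt_sum A (xs @ v # ys))" if "length xs + length ys = k" for xs ys
    using assms that
  proof (induction xs arbitrary: A k)
    case Nil
    have "linear (\<lambda>v. A u (v # ws))" if "Suc (length ws) = length ys" for u ws
      using alternating_multilinear_linear[OF Nil.prems(1)[of u], of "[]" ws] Nil.prems(3) that by simp
    then have "linear (\<lambda>v. alt_sum (\<lambda>u ws. A u (v # ws)) ys)"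
      by (rule alt_sum_linear[where B="\<lambda>v u ws. A u (v # ws)"])
    moreover have "linear (\<lambda>v. A v ys)" using Nil.prems by simp
    ultimately show ?case by (simp add: linear_compose_sub)
  next
    case (Cons x xs)
    then obtain j where k: "k = Suc j" by auto
    have alt: "alternating_multilinear j (\<lambda>ws. A u (x # ws))" for u
      using Cons.prems(1)[of u] unfolding k by (rule alternating_multilinear_Cons)
    have "linear (\<lambda>v. alt_sum (\<lambda>u ws. A u (x # ws)) (xs @ v # ys))"
      by (rule Cons.IH[OF alt]) (use Cons.prems k in auto)
    moreover have "linear (\<lambda>v. A x (xs @ v # ys))"
      using alternating_multilinear_linear[OF Cons.prems(1)[of x], of xs ys] Cons.prems(3) by simp
    ultimately show ?case by (simp add: linear_compose_sub)
  qed
  moreover have "alt_sum A (xs @ v # v # ys) = 0" if "Suc (length xs + length ys) = k" for xs ys v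
    using assms that
  proof (induction xs arbitrary: A k)
    case Nil
    have "A u (v # v # ws) = 0" if "Suc (length ws) = length ys" for u ws
      using alternating_multilinear_zero[OF Nil.prems(1)[of u], of "[]" ws v] Nil.prems(3) that by simp
    then have "alt_sum (\<lambda>u ws. A u (v # v # ws)) ys = alt_sum (\<lambda>u ws. 0) ys"
      by (intro alt_sum_cong) simp
    then show ?case by (simp add: alt_sum_zero)
  next
    case (Cons x xs)
    then obtain j where k: "k = Suc j" by auto
    have alt: "alternating_multilinear j (\<lambda>ws. A u (x # ws))" for u
      using Cons.prems(1)[of u] unfolding k by (rule alternating_multilinear_Cons)
    have "alt_sum (\<lambda>u ws. A u (x # ws)) (xs @ v # v # ys) = 0"
      by (rule Cons.IH[OF alt]) (use Cons.prems k in auto)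
    moreover have "A x (xs @ v # v # ys) = 0"
      using alternating_multilinear_zero[OF Cons.prems(1)[of x], of xs ys v] Cons.prems(3) by simp
    ultimately show ?case by simp
  qed
  ultimately show ?thesis unfolding alternating_multilinear_iff by simp
qed

text \<open>The cancellation behind \<open>d \<circ> d = 0\<close> and \<open>\<eta> \<and> \<eta> = 0\<close>: exchanging the two omitted vectors
  changes the sign.\<close>

lemma alt_sum_alt_sum_symmetric:
  assumes "\<And>u v ws. H u v ws = H v u ws"
  shows "alt_sum (\<lambda>u. alt_sum (H u)) vs = 0"
  using assms
proof (induction vs arbitrary: H)
  case (Cons x vs)
  have "alt_sum (\<lambda>u ws. alt_sum (\<lambda>v zs. H u v (x # zs)) ws) vs = 0"
    by (rule Cons.IH) (simp add: Cons.prems)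
  moreover have "H u x = H x u" for u using Cons.prems by blast
  ultimately show ?case by (simp add: alt_sum_diff)
qed simp

lemma alternating_multilinear_add:
  "alternating_multilinear k m \<Longrightarrow> alternating_multilinear k m' \<Longrightarrow> alternating_multilinear k (\<lambda>vs. m vs + m' vs)"
  unfolding alternating_multilinear_iff by (auto intro: linear_compose_add)

lemma alternating_multilinear_scale:
  "alternating_multilinear k m \<Longrightarrow> alternating_multilinear k (\<lambda>vs. r * m vs)"
  unfolding alternating_multilinear_iff using linear_compose_scale_right[where c=r] by fastforce

lemma alternating_multilinear_map:
  assumes "alternating_multilinear k m" "linear L"
  shows "alternating_multilinear k (\<lambda>vs. m (map L vs))"
proof -
  have "linear (\<lambda>v. m (map L xs @ L v # map L ys))" if "Suc (length xs + length ys) = k" for xs ys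
  proof -
    have "linear (\<lambda>v. m (map L xs @ v # map L ys))"
      using assms(1) that unfolding alternating_multilinear_iff by auto
    from linear_compose[OF assms(2) this] show ?thesis by (simp add: o_def)
  qed
  with assms(1) show ?thesis unfolding alternating_multilinear_iff by simp
qed

section \<open>The de Rham complex of an open set\<close>

definition diff_forms :: "'a::euclidean_space set \<Rightarrow> nat \<Rightarrow> 'a form set" where
  "diff_forms U k = {\<beta>. is_form k U \<beta>}"

definition fun_form :: "'a::euclidean_space set \<Rightarrow> ('a \<Rightarrow> real) \<Rightarrow> 'a form" where
  "fun_form U f = (\<lambda>x vs. if x \<in> U \<and> vs = [] then f x else 0)"

definition fun_mult :: "('a \<Rightarrow> real) \<Rightarrow> 'a form \<Rightarrow> 'a form" where
  "fun_mult f \<beta> = (\<lambda>x vs. f x * \<beta> x vs)"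

lemma fun_mult_apply [simp]: "fun_mult f \<beta> x vs = f x * \<beta> x vs"
  by (simp add: fun_mult_def)

lemma ext_deriv_alt_sum:
  "ext_deriv U \<beta> x vs = (if x \<in> U then alt_sum (\<lambda>v ws. frechet_derivative (\<lambda>y. \<beta> y ws) (at x) v) vs else 0)"
  by (simp add: ext_deriv_def flip: alt_sum_eq)

lemma wedge1_alt_sum: "wedge1 \<eta> \<beta> x vs = alt_sum (\<lambda>v ws. \<eta> x [v] * \<beta> x ws) vs"
  by (simp add: wedge1_def mult.assoc flip: alt_sum_eq)

lemma diff_forms_zero:
  "\<beta> \<in> diff_forms U k \<Longrightarrow> x \<notin> U \<or> length vs \<noteq> k \<Longrightarrow> \<beta> x vs = 0"
  unfolding diff_forms_def is_form_def by blast

lemma diff_forms_alternating: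
  "\<beta> \<in> diff_forms U k \<Longrightarrow> x \<in> U \<Longrightarrow> alternating_multilinear k (\<beta> x)"
  unfolding diff_forms_def is_form_def by blast

lemma diff_forms_smooth: "\<beta> \<in> diff_forms U k \<Longrightarrow> smooth_on U (\<lambda>x. \<beta> x vs)"
  unfolding diff_forms_def is_form_def by blast

lemma diff_formsI:
  assumes "\<And>x vs. x \<notin> U \<or> length vs \<noteq> k \<Longrightarrow> \<beta> x vs = 0"
    "\<And>x. x \<in> U \<Longrightarrow> alternating_multilinear k (\<beta> x)" "\<And>vs. smooth_on U (\<lambda>x. \<beta> x vs)"
  shows "\<beta> \<in> diff_forms U k"
  using assms unfolding diff_forms_def is_form_def by blast

lemma diff_forms_has_derivative:
  "\<beta> \<in> diff_forms U k \<Longrightarrow> x \<in> U \<Longrightarrow>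
    ((\<lambda>y. \<beta> y vs) has_derivative frechet_derivative (\<lambda>y. \<beta> y vs) (at x)) (at x)"
  using diff_forms_smooth smooth_on_has_derivative by blast

lemma alternating_multilinear_empty: "alternating_multilinear 0 m"
  by (simp add: alternating_multilinear_iff)

lemma fun_form_in_diff_forms:
  assumes "open U" "smooth_on U f" shows "fun_form U f \<in> diff_forms U 0"
proof (rule diff_formsI)
  show "smooth_on U (\<lambda>x. fun_form U f x vs)" for vs
    by (cases "vs = []") (simp_all add: fun_form_def assms smooth_on_cong[OF assms(1), of _ f])
qed (auto simp: fun_form_def alternating_multilinear_empty)

lemma diff_forms_0_eq_fun_form:
  assumes "\<beta> \<in> diff_forms U 0" shows "\<beta> = fun_form U (\<lambda>x. \<beta> x [])"
  using diff_forms_zero[OF assms] by (auto simp: fun_form_def fun_eq_iff)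

lemma fun_mult_in_diff_forms:
  assumes "open U" "smooth_on U f" "\<beta> \<in> diff_forms U k"
  shows "fun_mult f \<beta> \<in> diff_forms U k"
proof (rule diff_formsI)
  show "smooth_on U (\<lambda>x. fun_mult f \<beta> x vs)" for vs
    using smooth_on_mult[OF assms(1,2) diff_forms_smooth[OF assms(3)]] by simp
  show "alternating_multilinear k (fun_mult f \<beta> x)" if "x \<in> U" for x
    using alternating_multilinear_scale[OF diff_forms_alternating[OF assms(3) that]]
    by (simp add: fun_mult_def)
qed (simp add: diff_forms_zero[OF assms(3)])

lemma subspace_diff_forms:
  assumes "open U" shows "subspace (diff_forms U k)"
proof (rule subspaceI)
  show "0 \<in> diff_forms U k"
    by (rule diff_formsI) (auto simp: alternating_multilinear_iff assms module_hom_zero)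
  show "\<beta> + \<gamma> \<in> diff_forms U k" if "\<beta> \<in> diff_forms U k" "\<gamma> \<in> diff_forms U k" for \<beta> \<gamma>
  proof (rule diff_formsI)
    show "alternating_multilinear k ((\<beta> + \<gamma>) x)" if "x \<in> U" for x
      using alternating_multilinear_add[OF diff_forms_alternating[OF \<open>\<beta> \<in> _\<close> that] diff_forms_alternating[OF \<open>\<gamma> \<in> _\<close> that]]
      by (simp add: plus_fun_def)
    show "smooth_on U (\<lambda>x. (\<beta> + \<gamma>) x vs)" for vs
      using smooth_on_add[OF assms diff_forms_smooth[OF \<open>\<beta> \<in> _\<close>] diff_forms_smooth[OF \<open>\<gamma> \<in> _\<close>]] by simp
  qed (simp add: diff_forms_zero[OF \<open>\<beta> \<in> _\<close>] diff_forms_zero[OF \<open>\<gamma> \<in> _\<close>])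
  show "r *\<^sub>R \<beta> \<in> diff_forms U k" if "\<beta> \<in> diff_forms U k" for r \<beta>
    using fun_mult_in_diff_forms[OF assms smooth_on_const[OF assms] that, of r]
    by (simp add: fun_mult_def scaleR_fun_def)
qed

lemma ext_deriv_in_diff_forms:
  assumes "open U" "\<beta> \<in> diff_forms U k"
  shows "ext_deriv U \<beta> \<in> diff_forms U (Suc k)"
proof (rule diff_formsI)
  let ?D = "\<lambda>x v ws. frechet_derivative (\<lambda>y. \<beta> y ws) (at x) v"
  note D = diff_forms_has_derivative[OF assms(2)]
  fix x vs
  have "?D x v ws = 0" if "length ws \<noteq> k" for v ws
    using diff_forms_zero[OF assms(2)] that by (simp add: frechet_derivative_const)
  then have "alt_sum (?D x) vs = alt_sum (\<lambda>v ws. 0) vs" if "length vs \<noteq> Suc k"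
    using that by (intro alt_sum_cong) auto
  then show "ext_deriv U \<beta> x vs = 0" if "x \<notin> U \<or> length vs \<noteq> Suc k"
    using that by (auto simp: ext_deriv_alt_sum alt_sum_zero)
next
  let ?D = "\<lambda>x v ws. frechet_derivative (\<lambda>y. \<beta> y ws) (at x) v"
  note D = diff_forms_has_derivative[OF assms(2)]
  fix x assume x: "x \<in> U"
  have "linear (\<lambda>v. ?D x u (xs @ v # ys))" if "Suc (length xs + length ys) = k" for u xs ys
  proof (rule linearI)
    fix a b
    have "((\<lambda>y. \<beta> y (xs @ (a + b) # ys)) has_derivative (\<lambda>u. ?D x u (xs @ a # ys) + ?D x u (xs @ b # ys))) (at x)"
    proof (rule has_derivative_transform_within_open[OF has_derivative_add[OF D[OF x] D[OF x]] assms(1) x])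
      fix y assume "y \<in> U"
      then show "\<beta> y (xs @ a # ys) + \<beta> y (xs @ b # ys) = \<beta> y (xs @ (a + b) # ys)"
        using linear_add[OF alternating_multilinear_linear[OF diff_forms_alternating[OF assms(2)] that]] by simp
    qed
    then show "?D x u (xs @ (a + b) # ys) = ?D x u (xs @ a # ys) + ?D x u (xs @ b # ys)"
      by (simp add: frechet_derivativeI)
  next
    fix r a
    have "((\<lambda>y. \<beta> y (xs @ (r *\<^sub>R a) # ys)) has_derivative (\<lambda>u. r *\<^sub>R ?D x u (xs @ a # ys))) (at x)"
    proof (rule has_derivative_transform_within_open[OF has_derivative_scaleR_right[OF D[OF x]] assms(1) x])
      fix y assume "y \<in> U"
      then show "r *\<^sub>R \<beta> y (xs @ a # ys) = \<beta> y (xs @ (r *\<^sub>R a) # ys)"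
        using linear_cmul[OF alternating_multilinear_linear[OF diff_forms_alternating[OF assms(2)] that]] by simp
    qed
    then show "?D x u (xs @ (r *\<^sub>R a) # ys) = r *\<^sub>R ?D x u (xs @ a # ys)"
      by (simp add: frechet_derivativeI)
  qed
  moreover have "?D x u (xs @ v # v # ys) = 0" if "Suc (Suc (length xs + length ys)) = k" for u v xs ys
  proof -
    have "frechet_derivative (\<lambda>y. \<beta> y (xs @ v # v # ys)) (at x) = frechet_derivative (\<lambda>y. 0) (at x)"
      by (rule frechet_derivative_cong_open(1)[OF assms(1) x])
         (rule alternating_multilinear_zero[OF diff_forms_alternating[OF assms(2)] that])
    then show ?thesis by (simp add: frechet_derivative_const)
  qed
  ultimately have "alternating_multilinear k (?D x u)" for u
    unfolding alternating_multilinear_iff by blast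
  moreover have "linear (\<lambda>u. ?D x u ws)" for ws using has_derivative_linear[OF D[OF x]] .
  ultimately have "alternating_multilinear (Suc k) (alt_sum (?D x))"
    by (intro alternating_alt_sum) auto
  moreover have "ext_deriv U \<beta> x = alt_sum (?D x)" using x by (simp add: ext_deriv_alt_sum fun_eq_iff)
  ultimately show "alternating_multilinear (Suc k) (ext_deriv U \<beta> x)" by simp
next
  fix vs
  have "smooth_on U (\<lambda>x. \<Sum>i<length vs. (-1) ^ i * frechet_derivative (\<lambda>y. \<beta> y (omit i vs)) (at x) (vs ! i))"
    by (intro smooth_on_sum smooth_on_mult smooth_on_const smooth_on_derivative diff_forms_smooth[OF assms(2)] assms(1))
  then show "smooth_on U (\<lambda>x. ext_deriv U \<beta> x vs)"
    by (subst smooth_on_cong[OF assms(1)]) (auto simp: ext_deriv_def)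
qed

lemma ext_deriv_add:
  assumes "\<beta> \<in> diff_forms U k" "\<gamma> \<in> diff_forms U l"
  shows "ext_deriv U (\<beta> + \<gamma>) = ext_deriv U \<beta> + ext_deriv U \<gamma>"
proof (intro ext)
  fix x vs
  have "frechet_derivative (\<lambda>y. (\<beta> + \<gamma>) y ws) (at x) v
      = frechet_derivative (\<lambda>y. \<beta> y ws) (at x) v + frechet_derivative (\<lambda>y. \<gamma> y ws) (at x) v" if "x \<in> U" for ws v
    using frechet_derivativeI[OF has_derivative_add[OF diff_forms_has_derivative[OF assms(1) that]
        diff_forms_has_derivative[OF assms(2) that]]] by simp
  then show "ext_deriv U (\<beta> + \<gamma>) x vs = (ext_deriv U \<beta> + ext_deriv U \<gamma>) x vs"
    by (simp add: ext_deriv_alt_sum flip: alt_sum_add)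
qed

lemma ext_deriv_scale:
  assumes "\<beta> \<in> diff_forms U k"
  shows "ext_deriv U (r *\<^sub>R \<beta>) = r *\<^sub>R ext_deriv U \<beta>"
proof (intro ext)
  fix x vs
  have "frechet_derivative (\<lambda>y. (r *\<^sub>R \<beta>) y ws) (at x) v = r * frechet_derivative (\<lambda>y. \<beta> y ws) (at x) v"
    if "x \<in> U" for ws v
    using frechet_derivativeI[OF has_derivative_scaleR_right[OF diff_forms_has_derivative[OF assms(1) that]]] by simp
  then show "ext_deriv U (r *\<^sub>R \<beta>) x vs = (r *\<^sub>R ext_deriv U \<beta>) x vs"
    by (simp add: ext_deriv_alt_sum flip: alt_sum_scale)
qed

text \<open>The second derivatives of the coefficients are symmetric, so the alternating double sum cancels.\<close>

lemma ext_deriv_ext_deriv: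
  assumes "open U" "\<beta> \<in> diff_forms U k"
  shows "ext_deriv U (ext_deriv U \<beta>) = 0"
proof (intro ext)
  fix x vs
  let ?D = "\<lambda>y v ws. frechet_derivative (\<lambda>y. \<beta> y ws) (at y) v"
  let ?H = "\<lambda>u v ws. frechet_derivative (\<lambda>y. ?D y v ws) (at x) u"
  show "ext_deriv U (ext_deriv U \<beta>) x vs = 0 x vs"
  proof (cases "x \<in> U")
    case True
    have "frechet_derivative (\<lambda>y. ext_deriv U \<beta> y ws) (at x) u = alt_sum (?H u) ws" for u ws
    proof -
      have "((\<lambda>y. \<Sum>i<length ws. (-1) ^ i * ?D y (ws ! i) (omit i ws)) has_derivative
          (\<lambda>u. \<Sum>i<length ws. (-1) ^ i * ?H u (ws ! i) (omit i ws))) (at x)"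
        by (intro has_derivative_sum has_derivative_mult_right smooth_on_has_derivative[OF _ True]
            smooth_on_derivative diff_forms_smooth[OF assms(2)])
      moreover have "frechet_derivative (\<lambda>y. ext_deriv U \<beta> y ws) (at x)
          = frechet_derivative (\<lambda>y. \<Sum>i<length ws. (-1) ^ i * ?D y (ws ! i) (omit i ws)) (at x)"
        by (rule frechet_derivative_cong_open(1)[OF assms(1) True]) (simp add: ext_deriv_def)
      ultimately have "frechet_derivative (\<lambda>y. ext_deriv U \<beta> y ws) (at x) u
          = (\<Sum>i<length ws. (-1) ^ i * ?H u (ws ! i) (omit i ws))"
        by (simp add: frechet_derivativeI)
      then show ?thesis using alt_sum_eq[of "?H u" ws] by (rule trans)
    qed
    then have "ext_deriv U (ext_deriv U \<beta>) x vs = alt_sum (\<lambda>u. alt_sum (?H u)) vs"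
      using True by (subst ext_deriv_alt_sum) simp
    also have "\<dots> = 0"
      by (rule alt_sum_alt_sum_symmetric)
         (rule second_derivative_symmetric[OF assms(1) diff_forms_smooth[OF assms(2)] True])
    finally show ?thesis by simp
  qed (simp add: ext_deriv_def)
qed

lemma ext_deriv_fun_form:
  assumes "open U" "x \<in> U"
  shows "ext_deriv U (fun_form U f) x [v] = frechet_derivative f (at x) v"
proof -
  have "frechet_derivative (\<lambda>y. fun_form U f y []) (at x) = frechet_derivative f (at x)"
    by (rule frechet_derivative_cong_open(1)[OF assms]) (simp add: fun_form_def)
  then show ?thesis using assms by (simp add: ext_deriv_alt_sum)
qed

lemma ext_deriv_fun_mult:
  assumes "open U" "smooth_on U f" "\<beta> \<in> diff_forms U k"
  shows "ext_deriv U (fun_mult f \<beta>) = wedge1 (ext_deriv U (fun_form U f)) \<beta> + fun_mult f (ext_deriv U \<beta>)"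
proof (intro ext)
  fix x vs
  show "ext_deriv U (fun_mult f \<beta>) x vs
      = (wedge1 (ext_deriv U (fun_form U f)) \<beta> + fun_mult f (ext_deriv U \<beta>)) x vs"
  proof (cases "x \<in> U")
    case True
    have "frechet_derivative (\<lambda>y. fun_mult f \<beta> y ws) (at x) v
        = frechet_derivative f (at x) v * \<beta> x ws + f x * frechet_derivative (\<lambda>y. \<beta> y ws) (at x) v" for ws v
      using frechet_derivativeI[OF has_derivative_mult[OF smooth_on_has_derivative[OF assms(2) True]
          diff_forms_has_derivative[OF assms(3) True]]] by simp
    moreover have "frechet_derivative (\<lambda>y. fun_form U f y []) (at x) = frechet_derivative f (at x)"
      by (rule frechet_derivative_cong_open(1)[OF assms(1) True]) (simp add: fun_form_def)
    ultimately show ?thesis using True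
      by (simp add: ext_deriv_alt_sum wedge1_alt_sum flip: alt_sum_scale alt_sum_add)
  qed (simp add: ext_deriv_def wedge1_alt_sum diff_forms_zero[OF assms(3)] alt_sum_zero)
qed

lemma wedge1_in_diff_forms:
  assumes U: "open U" and \<eta>: "\<eta> \<in> diff_forms U (Suc 0)" and \<beta>: "\<beta> \<in> diff_forms U k"
  shows "wedge1 \<eta> \<beta> \<in> diff_forms U (Suc k)"
proof (rule diff_formsI)
  fix x and vs :: "'a list" assume "x \<notin> U \<or> length vs \<noteq> Suc k"
  then have "alt_sum (\<lambda>v ws. \<eta> x [v] * \<beta> x ws) vs = alt_sum (\<lambda>v ws. 0) vs"
    using diff_forms_zero[OF \<beta>] by (intro alt_sum_cong) auto
  then show "wedge1 \<eta> \<beta> x vs = 0" by (simp add: wedge1_alt_sum alt_sum_zero)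
next
  fix x assume x: "x \<in> U"
  have "linear (\<lambda>v. \<eta> x [v])"
    using alternating_multilinear_linear[OF diff_forms_alternating[OF \<eta> x], of "[]" "[]"] by simp
  then have "linear (\<lambda>v. \<eta> x [v] * \<beta> x ws)" for ws
    using linear_compose_scale_right[of "\<lambda>v. \<eta> x [v]" "\<beta> x ws"] by (simp add: mult.commute)
  then have "alternating_multilinear (Suc k) (alt_sum (\<lambda>v ws. \<eta> x [v] * \<beta> x ws))"
    by (intro alternating_alt_sum alternating_multilinear_scale diff_forms_alternating[OF \<beta> x])
  then show "alternating_multilinear (Suc k) (wedge1 \<eta> \<beta> x)"
    by (simp add: wedge1_alt_sum[abs_def])
next
  fix vs
  show "smooth_on U (\<lambda>x. wedge1 \<eta> \<beta> x vs)" unfolding wedge1_def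
    by (intro smooth_on_sum smooth_on_mult smooth_on_const diff_forms_smooth[OF \<eta>] diff_forms_smooth[OF \<beta>] U)
qed

lemma wedge1_add_left: "wedge1 (\<eta> + \<eta>') \<beta> = wedge1 \<eta> \<beta> + wedge1 \<eta>' \<beta>"
  by (simp add: fun_eq_iff wedge1_alt_sum algebra_simps flip: alt_sum_add)

lemma wedge1_scale_left: "wedge1 (r *\<^sub>R \<eta>) \<beta> = r *\<^sub>R wedge1 \<eta> \<beta>"
  by (simp add: fun_eq_iff wedge1_alt_sum algebra_simps flip: alt_sum_scale)

lemma wedge1_add_right: "wedge1 \<eta> (\<beta> + \<beta>') = wedge1 \<eta> \<beta> + wedge1 \<eta> \<beta>'"
  by (simp add: fun_eq_iff wedge1_alt_sum algebra_simps flip: alt_sum_add)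

lemma wedge1_scale_right: "wedge1 \<eta> (r *\<^sub>R \<beta>) = r *\<^sub>R wedge1 \<eta> \<beta>"
  by (simp add: fun_eq_iff wedge1_alt_sum algebra_simps flip: alt_sum_scale)

lemma wedge1_fun_mult_left: "wedge1 (fun_mult f \<eta>) \<beta> = fun_mult f (wedge1 \<eta> \<beta>)"
  by (simp add: fun_eq_iff wedge1_alt_sum algebra_simps flip: alt_sum_scale)

lemma wedge1_fun_mult_right: "wedge1 \<eta> (fun_mult f \<beta>) = fun_mult f (wedge1 \<eta> \<beta>)"
  by (simp add: fun_eq_iff wedge1_alt_sum algebra_simps flip: alt_sum_scale)

lemma wedge1_wedge1_self: "wedge1 \<eta> (wedge1 \<eta> \<beta>) = 0"
proof (intro ext)
  fix x vs
  have "alt_sum (\<lambda>u. alt_sum (\<lambda>v ws. \<eta> x [u] * (\<eta> x [v] * \<beta> x ws))) vs = 0"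
    by (rule alt_sum_alt_sum_symmetric) simp
  then show "wedge1 \<eta> (wedge1 \<eta> \<beta>) x vs = 0 x vs"
    by (simp add: wedge1_alt_sum flip: alt_sum_scale)
qed

text \<open>Polarisation of \<open>\<eta> \<and> \<eta> \<and> \<beta> = 0\<close>.\<close>

lemma wedge1_wedge1_swap: "wedge1 \<eta> (wedge1 \<eta>' \<beta>) = - wedge1 \<eta>' (wedge1 \<eta> \<beta>)"
  using wedge1_wedge1_self[of "\<eta> + \<eta>'" \<beta>]
  by (simp add: wedge1_add_left wedge1_add_right wedge1_wedge1_self eq_neg_iff_add_eq_0 add.commute)

section \<open>Pullback along affine maps\<close>

definition affine_map :: "('a::real_vector \<Rightarrow> 'a) \<Rightarrow> bool" where
  "affine_map g \<longleftrightarrow> linear (\<lambda>v. g v - g 0)"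

text \<open>All deck transformations of the Inoue surface are affine. The derivative of an affine map is
  its linear part \<open>g v - g 0\<close> at every point, so pulling back is a mere substitution and commutes
  with \<open>d\<close> by the chain rule.\<close>

definition pull :: "('a::real_vector \<Rightarrow> 'a) \<Rightarrow> 'a form \<Rightarrow> 'a form" where
  "pull g \<beta> = (\<lambda>x vs. \<beta> (g x) (map (\<lambda>v. g v - g 0) vs))"

lemma affine_map_has_derivative:
  fixes g :: "'a::euclidean_space \<Rightarrow> 'a"
  assumes "affine_map g"
  shows "(g has_derivative (\<lambda>v. g v - g 0)) (at x)"
proof -
  have "bounded_linear (\<lambda>v. g v - g 0)"
    using assms by (simp add: affine_map_def linear_conv_bounded_linear)
  then have "((\<lambda>v. (g v - g 0) + g 0) has_derivative (\<lambda>v. g v - g 0)) (at x)"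
    by (intro has_derivative_add_const bounded_linear_imp_has_derivative)
  then show ?thesis by simp
qed

lemma affine_map_compose:
  assumes "affine_map g" "affine_map h" shows "affine_map (g \<circ> h)"
proof -
  have "g (h v) - g (h 0) = g (h v - h 0) - g 0" for v
    using linear_diff[OF assms(1)[unfolded affine_map_def], of "h v" "h 0"] by simp
  then show ?thesis
    using linear_compose[OF assms(2,1)[unfolded affine_map_def]] by (simp add: affine_map_def o_def)
qed

lemma pull_compose:
  assumes "affine_map g"
  shows "pull h (pull g \<beta>) = pull (g \<circ> h) \<beta>"
proof -
  have "g (h v) - g (h 0) = g (h v - h 0) - g 0" for v
    using linear_diff[OF assms(1)[unfolded affine_map_def], of "h v" "h 0"] by simp
  then show ?thesis by (simp add: pull_def o_def)
qed

lemma pull_id [simp]: "pull id \<beta> = \<beta>" "pull (\<lambda>x. x) \<beta> = \<beta>"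
  by (simp_all add: pull_def)

lemma pull_add: "pull g (\<beta> + \<gamma>) = pull g \<beta> + pull g \<gamma>"
  by (simp add: pull_def fun_eq_iff)

lemma pull_scale: "pull g (r *\<^sub>R \<beta>) = r *\<^sub>R pull g \<beta>"
  by (simp add: pull_def fun_eq_iff)

lemma linear_pull: "linear (pull g)"
  by (intro linearI pull_add pull_scale)

lemma pull_fun_mult: "pull g (fun_mult f \<beta>) = fun_mult (f \<circ> g) (pull g \<beta>)"
  by (simp add: pull_def fun_eq_iff)

lemma pull_fun_form: "(\<And>x. g x \<in> U \<longleftrightarrow> x \<in> U) \<Longrightarrow> pull g (fun_form U f) = fun_form U (f \<circ> g)"
  by (simp add: pull_def fun_form_def fun_eq_iff)

lemma pull_wedge1: "pull g (wedge1 \<eta> \<beta>) = wedge1 (pull g \<eta>) (pull g \<beta>)"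
  by (simp add: pull_def wedge1_alt_sum alt_sum_map fun_eq_iff)

lemma pull_in_diff_forms:
  assumes U: "open U" and g: "affine_map g" "\<And>x. g x \<in> U \<longleftrightarrow> x \<in> U" and \<beta>: "\<beta> \<in> diff_forms U k"
  shows "pull g \<beta> \<in> diff_forms U k"
proof (rule diff_formsI)
  show "pull g \<beta> x vs = 0" if "x \<notin> U \<or> length vs \<noteq> k" for x vs
    using that diff_forms_zero[OF \<beta>] by (simp add: pull_def g(2))
  show "alternating_multilinear k (pull g \<beta> x)" if "x \<in> U" for x
    using alternating_multilinear_map[OF diff_forms_alternating[OF \<beta>] g(1)[unfolded affine_map_def], of "g x"] that
    by (simp add: pull_def g(2))
  show "smooth_on U (\<lambda>x. pull g \<beta> x vs)" for vs
    unfolding pull_def using g(2)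
    by (intro smooth_on_compose_affine[OF U U diff_forms_smooth[OF \<beta>] _ affine_map_has_derivative[OF g(1)]]) auto
qed

lemma ext_deriv_pull:
  assumes U: "open U" and g: "affine_map g" "\<And>x. g x \<in> U \<longleftrightarrow> x \<in> U" and \<beta>: "\<beta> \<in> diff_forms U k"
  shows "ext_deriv U (pull g \<beta>) = pull g (ext_deriv U \<beta>)"
proof (intro ext)
  fix x vs
  have "frechet_derivative (\<lambda>y. pull g \<beta> y ws) (at x) v
      = frechet_derivative (\<lambda>y. \<beta> y (map (\<lambda>v. g v - g 0) ws)) (at (g x)) (g v - g 0)" if "x \<in> U" for ws v
  proof -
    have "g x \<in> U" using that g(2) by simp
    from has_derivative_compose[OF affine_map_has_derivative[OF g(1)] diff_forms_has_derivative[OF \<beta> this]]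
    have "((\<lambda>y. pull g \<beta> y ws) has_derivative
        (\<lambda>v. frechet_derivative (\<lambda>y. \<beta> y (map (\<lambda>v. g v - g 0) ws)) (at (g x)) (g v - g 0))) (at x)"
      by (simp add: pull_def)
    from frechet_derivativeI[OF this] show ?thesis by simp
  qed
  then show "ext_deriv U (pull g \<beta>) x vs = pull g (ext_deriv U \<beta>) x vs"
    by (simp add: ext_deriv_alt_sum pull_def[of _ "ext_deriv U \<beta>"] alt_sum_map g(2))
qed

section \<open>The Poincare lemma\<close>

lemma alternating_multilinear_swap:
  assumes m: "alternating_multilinear k m" and k: "Suc (Suc (length ys)) = k"
  shows "m (a # b # ys) = - m (b # a # ys)"
proof -
  have 1: "m ((a + b) # c # ys) = m (a # c # ys) + m (b # c # ys)" for c
    using linear_add[OF alternating_multilinear_linear[OF m, of "[]" "c # ys"], of a b] k by simp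
  have 2: "m (c # (a + b) # ys) = m (c # a # ys) + m (c # b # ys)" for c
    using linear_add[OF alternating_multilinear_linear[OF m, of "[c]" "ys"], of a b] k by simp
  have z: "m (v # v # ys) = 0" for v
    using alternating_multilinear_zero[OF m, of "[]" ys v] k by simp
  show ?thesis using z[of "a + b"] z[of a] z[of b] by (simp add: 1 2)
qed

text \<open>In every summand one argument has been moved to the front, and the sign of the summand is
  that of this permutation, so that all summands agree. In the homotopy formula this produces the
  factor \<open>k\<close> in the derivative of \<open>\<tau> ^ k\<close>.\<close>

lemma alt_sum_alternating:
  assumes "alternating_multilinear (length vs) m"
  shows "alt_sum (\<lambda>v ws. m (v # ws)) vs = real (length vs) * m vs"
  using assms
proof (induction vs arbitrary: m)
  case (Cons v vs)
  have "alt_sum (\<lambda>u ws. m (u # v # ws)) vs = alt_sum (\<lambda>u ws. (-1) * m (v # u # ws)) vs"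
  proof (rule alt_sum_cong)
    fix u and ws :: "'a list" assume "Suc (length ws) = length vs"
    then show "m (u # v # ws) = (-1) * m (v # u # ws)"
      using alternating_multilinear_swap[OF Cons.prems, of ws u v] by simp
  qed
  also have "\<dots> = - alt_sum (\<lambda>u ws. m (v # u # ws)) vs" by (subst alt_sum_scale) simp
  also have "alt_sum (\<lambda>u ws. m (v # u # ws)) vs = real (length vs) * m (v # vs)"
    using Cons.prems by (intro Cons.IH alternating_multilinear_Cons) simp
  finally show ?case by (simp add: algebra_simps)
qed simp

lemma linear_eq_sum_Basis:
  fixes L :: "'a::euclidean_space \<Rightarrow> real"
  assumes "linear L" shows "L v = (\<Sum>b\<in>Basis. (v \<bullet> b) * L b)"
proof -
  have "L v = L (\<Sum>b\<in>Basis. (v \<bullet> b) *\<^sub>R b)" by (simp add: euclidean_representation)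
  also have "\<dots> = (\<Sum>b\<in>Basis. (v \<bullet> b) * L b)"
    by (simp add: linear_sum[OF assms] linear_cmul[OF assms])
  finally show ?thesis .
qed

locale convex_open =
  fixes U :: "'a::euclidean_space set" and p :: 'a
  assumes U: "open U" and conv: "convex U" and p: "p \<in> U"
begin

text \<open>Differentiating under the integral raises the exponent by one and replaces \<open>g\<close> by a
  directional derivative. The exponent is a parameter so that the class of these integrals
  is closed under differentiation, which gives their smoothness.\<close>

definition ray_int :: "nat \<Rightarrow> ('a \<Rightarrow> real) \<Rightarrow> 'a \<Rightarrow> real" where
  "ray_int m g x = integral {0..1} (\<lambda>\<tau>. \<tau> ^ m * g (p + \<tau> *\<^sub>R (x - p)))"

lemma ray_in: "x \<in> U \<Longrightarrow> 0 \<le> \<tau> \<Longrightarrow> \<tau> \<le> 1 \<Longrightarrow> p + \<tau> *\<^sub>R (x - p) \<in> U"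
  using convexD_alt[OF conv p, of x \<tau>] by (simp add: algebra_simps)

lemma ray_integrable:
  assumes "continuous_on U g" "x \<in> U"
  shows "(\<lambda>\<tau>. \<tau> ^ m * g (p + \<tau> *\<^sub>R (x - p))) integrable_on {0..1}"
  by (intro integrable_continuous_interval continuous_intros continuous_on_compose2[OF assms(1)])
     (use ray_in[OF assms(2)] in auto)

lemma ray_int_add:
  assumes "continuous_on U f" "continuous_on U g" "x \<in> U"
  shows "ray_int m (\<lambda>y. f y + g y) x = ray_int m f x + ray_int m g x"
  using integral_add[OF ray_integrable[OF assms(1,3)] ray_integrable[OF assms(2,3)]]
  by (simp add: ray_int_def algebra_simps)

lemma ray_int_scale: "ray_int m (\<lambda>y. r * g y) x = r * ray_int m g x"
  using integral_mult_right[of "{0..1}" r "\<lambda>\<tau>. \<tau> ^ m * g (p + \<tau> *\<^sub>R (x - p))"]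
  by (simp add: ray_int_def algebra_simps)

lemma ray_int_diff:
  assumes "continuous_on U f" "continuous_on U g" "x \<in> U"
  shows "ray_int m (\<lambda>y. f y - g y) x = ray_int m f x - ray_int m g x"
  using integral_diff[OF ray_integrable[OF assms(1,3)] ray_integrable[OF assms(2,3)]]
  by (simp add: ray_int_def algebra_simps)

lemma ray_int_cong:
  assumes "\<And>y. y \<in> U \<Longrightarrow> f y = g y" "x \<in> U"
  shows "ray_int m f x = ray_int m g x"
  unfolding ray_int_def by (intro integral_cong) (use assms ray_in in auto)

lemma ray_int_sum:
  assumes "\<And>i. i \<in> I \<Longrightarrow> continuous_on U (f i)" "x \<in> U"
  shows "ray_int m (\<lambda>y. \<Sum>i\<in>I. f i y) x = (\<Sum>i\<in>I. ray_int m (f i) x)"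
  using assms(1)
proof (induction I rule: infinite_finite_induct)
  case (insert i I)
  then show ?case by (simp add: ray_int_add assms(2) continuous_on_sum)
qed (simp_all add: ray_int_def)

lemma ray_int_alt_sum:
  assumes "\<And>v ws. continuous_on U (\<lambda>y. A y v ws)" "x \<in> U"
  shows "ray_int m (\<lambda>y. alt_sum (A y) vs) x = alt_sum (\<lambda>v ws. ray_int m (\<lambda>y. A y v ws) x) vs"
  unfolding alt_sum_eq[symmetric]
  by (subst ray_int_sum) (auto intro!: continuous_intros assms simp: ray_int_scale)

lemma ray_int_has_derivative:
  assumes g: "smooth_on U g" and x: "x \<in> U"
  shows "(ray_int m g has_derivative (\<lambda>v. ray_int (Suc m) (\<lambda>y. frechet_derivative g (at y) v) x)) (at x)"
proof -
  let ?r = "\<lambda>x \<tau>. p + \<tau> *\<^sub>R (x - p)"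
  define D where "D = (\<lambda>x \<tau>. \<Sum>b\<in>Basis. (\<tau> ^ Suc m * frechet_derivative g (at (?r x \<tau>)) b) *\<^sub>R blinfun_inner_left b)"
  have D: "blinfun_apply (D x \<tau>) v = \<tau> ^ Suc m * frechet_derivative g (at (?r x \<tau>)) v"
    if "x \<in> U" "0 \<le> \<tau>" "\<tau> \<le> 1" for x \<tau> v
  proof -
    have "linear (frechet_derivative g (at (?r x \<tau>)))"
      by (rule has_derivative_linear[OF smooth_on_has_derivative[OF g ray_in[OF that]]])
    then show ?thesis
      by (subst linear_eq_sum_Basis[of _ v])
         (auto simp: D_def blinfun.sum_left blinfun.scaleR_left sum_distrib_left algebra_simps)
  qed
  have "((\<lambda>x. integral (cbox 0 1) (\<lambda>\<tau>. \<tau> ^ m * g (?r x \<tau>))) has_derivative integral (cbox 0 1) (D x)) (at x within U)"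
  proof (rule leibniz_rule[OF _ _ _ x conv])
    fix x and \<tau> :: real assume x: "x \<in> U" and "\<tau> \<in> cbox 0 1"
    then have \<tau>: "0 \<le> \<tau>" "\<tau> \<le> 1" by auto
    have "((\<lambda>x. ?r x \<tau>) has_derivative (\<lambda>v. \<tau> *\<^sub>R v)) (at x within U)"
      by (auto intro!: derivative_eq_intros)
    from has_derivative_compose[OF this smooth_on_has_derivative[OF g ray_in[OF x \<tau>]]]
    have "((\<lambda>x. \<tau> ^ m * g (?r x \<tau>)) has_derivative
        (\<lambda>v. \<tau> ^ m * frechet_derivative g (at (?r x \<tau>)) (\<tau> *\<^sub>R v))) (at x within U)"
      by (rule has_derivative_mult_right)
    then show "((\<lambda>x. \<tau> ^ m * g (?r x \<tau>)) has_derivative blinfun_apply (D x \<tau>)) (at x within U)"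
      by (rule has_derivative_eq_rhs)
         (simp add: D[OF x \<tau>] fun_eq_iff
            linear_cmul[OF has_derivative_linear[OF smooth_on_has_derivative[OF g ray_in[OF x \<tau>]]]])
  next
    fix x assume "x \<in> U"
    then show "(\<lambda>\<tau>. \<tau> ^ m * g (?r x \<tau>)) integrable_on cbox 0 1"
      using ray_integrable[OF smooth_on_imp_continuous_on[OF g]] by simp
  next
    show "continuous_on (U \<times> cbox 0 1) (\<lambda>(x, \<tau>). D x \<tau>)"
      unfolding D_def split_beta
      by (intro continuous_intros continuous_on_compose2[OF smooth_on_imp_continuous_on[OF smooth_on_derivative[OF g]]])
         (use ray_in in auto)
  qed
  moreover have "integral {0..1} (D x) v = ray_int (Suc m) (\<lambda>y. frechet_derivative g (at y) v) x" for v
  proof -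
    have "continuous_on {0..1} (D x)"
      unfolding D_def
      by (intro continuous_intros continuous_on_compose2[OF smooth_on_imp_continuous_on[OF smooth_on_derivative[OF g]]])
         (use ray_in x in auto)
    then have "integral {0..1} (D x) v = integral {0..1} (\<lambda>\<tau>. blinfun_apply (D x \<tau>) v)"
      by (intro blinfun_apply_integral integrable_continuous_interval)
    also have "\<dots> = ray_int (Suc m) (\<lambda>y. frechet_derivative g (at y) v) x"
      unfolding ray_int_def by (intro integral_cong) (use D x in auto)
    finally show ?thesis .
  qed
  then have "blinfun_apply (integral {0..1} (D x)) = (\<lambda>v. ray_int (Suc m) (\<lambda>y. frechet_derivative g (at y) v) x)"
    by (rule ext)
  moreover have "(\<lambda>x. integral (cbox 0 1) (\<lambda>\<tau>. \<tau> ^ m * g (?r x \<tau>))) = ray_int m g"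
    by (simp add: ray_int_def fun_eq_iff)
  ultimately show ?thesis by (simp only: at_within_open[OF x U] cbox_interval)
qed

lemma ray_int_smooth:
  assumes "smooth_on U g" shows "smooth_on U (ray_int m g)"
proof (rule smooth_on_coinduct[where P="\<lambda>h. \<exists>m g. smooth_on U g \<and> h = ray_int m g"])
  fix h assume "\<exists>m g. smooth_on U g \<and> h = ray_int m g"
  then obtain m g where g: "smooth_on U g" and h: "h = ray_int m g" by blast
  note D = ray_int_has_derivative[OF g, of _ m]
  have "\<exists>k. (\<exists>m g. smooth_on U g \<and> k = ray_int m g) \<and> (\<forall>x\<in>U. frechet_derivative h (at x) v = k x)" for v
    by (rule exI[of _ "ray_int (Suc m) (\<lambda>y. frechet_derivative g (at y) v)"])
       (use smooth_on_derivative[OF g, of v] in \<open>auto simp: h frechet_derivativeI[OF D]\<close>)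
  then show "(\<forall>x\<in>U. h differentiable (at x)) \<and>
      (\<forall>v. \<exists>k. (\<exists>m g. smooth_on U g \<and> k = ray_int m g) \<and> (\<forall>x\<in>U. frechet_derivative h (at x) v = k x))"
    using D by (auto simp: h differentiable_def)
qed (use U assms in auto)

text \<open>The classical operator \<open>\<beta> \<mapsto> \<integral>\<^sub>0\<^sup>1 \<tau>\<^sup>j \<beta> (p + \<tau> (x - p)) (x - p, \<dots>) d\<tau>\<close>. The vector \<open>x - p\<close>
  is expanded in the standard basis, which separates the dependence on \<open>x\<close> through the inserted
  vector from the dependence through the ray.\<close>

definition homotopy :: "nat \<Rightarrow> 'a form \<Rightarrow> 'a form" where
  "homotopy j \<beta> = (\<lambda>x vs. if x \<in> U
     then \<Sum>b\<in>Basis. ((x - p) \<bullet> b) * ray_int j (\<lambda>y. \<beta> y (b # vs)) x else 0)"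

lemma ray_int_linear_combination:
  assumes \<beta>: "\<beta> \<in> diff_forms U (Suc j)" and "x \<in> U" "length ws = j"
  shows "(\<Sum>b\<in>Basis. (v \<bullet> b) * ray_int m (\<lambda>y. \<beta> y (b # ws)) x) = ray_int m (\<lambda>y. \<beta> y (v # ws)) x"
proof -
  have c: "continuous_on U (\<lambda>y. \<beta> y vs)" for vs
    by (rule smooth_on_imp_continuous_on[OF diff_forms_smooth[OF \<beta>]])
  have "ray_int m (\<lambda>y. \<beta> y (v # ws)) x = ray_int m (\<lambda>y. \<Sum>b\<in>Basis. (v \<bullet> b) * \<beta> y (b # ws)) x"
    using alternating_multilinear_linear[OF diff_forms_alternating[OF \<beta>], of _ "[]" ws] assms(3)
    by (intro ray_int_cong assms(2) linear_eq_sum_Basis) simp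
  also have "\<dots> = (\<Sum>b\<in>Basis. (v \<bullet> b) * ray_int m (\<lambda>y. \<beta> y (b # ws)) x)"
    by (subst ray_int_sum) (auto intro!: continuous_intros c assms(2) simp: ray_int_scale)
  finally show ?thesis by simp
qed

lemma homotopy_in_diff_forms:
  assumes \<beta>: "\<beta> \<in> diff_forms U (Suc j)"
  shows "homotopy j \<beta> \<in> diff_forms U j"
proof (rule diff_formsI)
  have c: "continuous_on U (\<lambda>y. \<beta> y vs)" for vs
    by (rule smooth_on_imp_continuous_on[OF diff_forms_smooth[OF \<beta>]])
  fix x
  show "homotopy j \<beta> x vs = 0" if "x \<notin> U \<or> length vs \<noteq> j" for vs
  proof (cases "x \<in> U")
    case True
    have "\<beta> y (b # vs) = 0" for y b using that True by (intro diff_forms_zero[OF \<beta>]) auto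
    then show ?thesis by (simp add: homotopy_def ray_int_def)
  qed (simp add: homotopy_def)
  assume x: "x \<in> U"
  note alt = alternating_multilinear_Cons[OF diff_forms_alternating[OF \<beta>]]
  have eq: "homotopy j \<beta> x vs = ray_int j (\<lambda>y. \<beta> y ((x - p) # vs)) x" if "length vs = j" for vs
    using x ray_int_linear_combination[OF \<beta> x that] by (simp add: homotopy_def)
  show "alternating_multilinear j (homotopy j \<beta> x)"
    unfolding alternating_multilinear_iff
  proof (intro conjI allI impI)
    fix xs ys :: "'a list" assume len: "Suc (length xs + length ys) = j"
    note lin = alternating_multilinear_linear[OF alt len]
    show "linear (\<lambda>v. homotopy j \<beta> x (xs @ v # ys))"
    proof (rule linearI)
      fix a b
      have "ray_int j (\<lambda>y. \<beta> y ((x - p) # xs @ (a + b) # ys)) x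
          = ray_int j (\<lambda>y. \<beta> y ((x - p) # xs @ a # ys) + \<beta> y ((x - p) # xs @ b # ys)) x"
        by (intro ray_int_cong x linear_add[OF lin])
      then show "homotopy j \<beta> x (xs @ (a + b) # ys) = homotopy j \<beta> x (xs @ a # ys) + homotopy j \<beta> x (xs @ b # ys)"
        using len by (simp add: eq ray_int_add[OF c c x])
    next
      fix r a
      have "ray_int j (\<lambda>y. \<beta> y ((x - p) # xs @ (r *\<^sub>R a) # ys)) x = ray_int j (\<lambda>y. r * \<beta> y ((x - p) # xs @ a # ys)) x"
        using linear_cmul[OF lin] by (intro ray_int_cong x) simp
      then show "homotopy j \<beta> x (xs @ (r *\<^sub>R a) # ys) = r *\<^sub>R homotopy j \<beta> x (xs @ a # ys)"
        using len by (simp add: eq ray_int_scale)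
    qed
  next
    fix xs ys :: "'a list" and v assume len: "Suc (Suc (length xs + length ys)) = j"
    have "ray_int j (\<lambda>y. \<beta> y ((x - p) # xs @ v # v # ys)) x = ray_int j (\<lambda>y. 0) x"
      by (intro ray_int_cong x alternating_multilinear_zero[OF alt len])
    then show "homotopy j \<beta> x (xs @ v # v # ys) = 0"
      using len by (simp add: eq ray_int_def)
  qed
next
  fix vs
  have "smooth_on U (\<lambda>x. (x - p) \<bullet> b)" for b
    using smooth_on_diff[OF U smooth_on_bounded_linear[OF U bounded_linear_inner_left[of b]] smooth_on_const[OF U, of "p \<bullet> b"]]
    by (simp add: inner_diff_left)
  then have "smooth_on U (\<lambda>x. \<Sum>b\<in>Basis. ((x - p) \<bullet> b) * ray_int j (\<lambda>y. \<beta> y (b # vs)) x)"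
    by (intro smooth_on_sum smooth_on_mult ray_int_smooth diff_forms_smooth[OF \<beta>] U)
  then show "smooth_on U (\<lambda>x. homotopy j \<beta> x vs)"
    by (subst smooth_on_cong[OF U]) (auto simp: homotopy_def)
qed

text \<open>At \<open>x\<close>, with \<open>w = x - p\<close>, both terms are integrals along the ray from \<open>p\<close> to \<open>x\<close>. The parts
  containing derivatives of \<open>\<beta>\<close> in the directions of the arguments cancel, and what remains is the
  integral of \<open>d/d\<tau> (\<tau> ^ (j + 1) \<beta> (p + \<tau> w) vs)\<close>.\<close>

lemma homotopy_formula:
  assumes \<beta>: "\<beta> \<in> diff_forms U (Suc j)"
  shows "ext_deriv U (homotopy j \<beta>) + homotopy (Suc j) (ext_deriv U \<beta>) = \<beta>"
proof (intro ext)
  fix x and vs :: "'a list"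
  have d\<beta>: "ext_deriv U \<beta> \<in> diff_forms U (Suc (Suc j))" by (rule ext_deriv_in_diff_forms[OF U \<beta>])
  have hom: "ext_deriv U (homotopy j \<beta>) \<in> diff_forms U (Suc j)" "homotopy (Suc j) (ext_deriv U \<beta>) \<in> diff_forms U (Suc j)"
    by (intro ext_deriv_in_diff_forms homotopy_in_diff_forms U \<beta> d\<beta>)+
  show "(ext_deriv U (homotopy j \<beta>) + homotopy (Suc j) (ext_deriv U \<beta>)) x vs = \<beta> x vs"
  proof (cases "x \<in> U \<and> length vs = Suc j")
    case False
    then show ?thesis
      using diff_forms_zero[OF \<beta>] diff_forms_zero[OF hom(1)] diff_forms_zero[OF hom(2)] by simp
  next
    case True
    then have x: "x \<in> U" and len: "length vs = Suc j" by auto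
    let ?w = "x - p"
    let ?D = "\<lambda>y v ws. frechet_derivative (\<lambda>y. \<beta> y ws) (at y) v"
    have s: "smooth_on U (\<lambda>y. \<beta> y ws)" for ws by (rule diff_forms_smooth[OF \<beta>])
    have c: "continuous_on U (\<lambda>y. \<beta> y ws)" "continuous_on U (\<lambda>y. ?D y v ws)" for v ws
      by (intro smooth_on_imp_continuous_on smooth_on_derivative s)+
    have D: "frechet_derivative (\<lambda>y. homotopy j \<beta> y ws) (at x) v
        = ray_int j (\<lambda>y. \<beta> y (v # ws)) x + ray_int (Suc j) (\<lambda>y. ?D y v (?w # ws)) x"
      if ws: "length ws = j" for v ws
    proof -
      have "((\<lambda>x. \<Sum>b\<in>Basis. ((x - p) \<bullet> b) * ray_int j (\<lambda>y. \<beta> y (b # ws)) x) has_derivative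
          (\<lambda>v. \<Sum>b\<in>Basis. (?w \<bullet> b) * ray_int (Suc j) (\<lambda>y. ?D y v (b # ws)) x + (v \<bullet> b) * ray_int j (\<lambda>y. \<beta> y (b # ws)) x)) (at x)"
        by (intro has_derivative_sum has_derivative_mult ray_int_has_derivative[OF s x])
           (auto intro!: derivative_eq_intros)
      moreover have "frechet_derivative (\<lambda>y. homotopy j \<beta> y ws) (at x)
          = frechet_derivative (\<lambda>x. \<Sum>b\<in>Basis. ((x - p) \<bullet> b) * ray_int j (\<lambda>y. \<beta> y (b # ws)) x) (at x)"
        by (rule frechet_derivative_cong_open(1)[OF U x]) (simp add: homotopy_def)
      ultimately have "frechet_derivative (\<lambda>y. homotopy j \<beta> y ws) (at x) v
          = (\<Sum>b\<in>Basis. (?w \<bullet> b) * ray_int (Suc j) (\<lambda>y. ?D y v (b # ws)) x)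
            + (\<Sum>b\<in>Basis. (v \<bullet> b) * ray_int j (\<lambda>y. \<beta> y (b # ws)) x)"
        by (simp add: frechet_derivativeI sum.distrib)
      moreover have "(\<Sum>b\<in>Basis. (?w \<bullet> b) * ray_int (Suc j) (\<lambda>y. ?D y v (b # ws)) x)
          = ray_int (Suc j) (\<lambda>y. ?D y v (?w # ws)) x"
      proof -
        have "?D y v (?w # ws) = (\<Sum>b\<in>Basis. (?w \<bullet> b) * ?D y v (b # ws))" if y: "y \<in> U" for y
        proof -
          have "((\<lambda>y. \<Sum>b\<in>Basis. (?w \<bullet> b) * \<beta> y (b # ws)) has_derivative (\<lambda>v. \<Sum>b\<in>Basis. (?w \<bullet> b) * ?D y v (b # ws))) (at y)"
            by (intro has_derivative_sum has_derivative_mult_right diff_forms_has_derivative[OF \<beta> y])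
          moreover have "frechet_derivative (\<lambda>y. \<beta> y (?w # ws)) (at y) = frechet_derivative (\<lambda>y. \<Sum>b\<in>Basis. (?w \<bullet> b) * \<beta> y (b # ws)) (at y)"
            by (rule frechet_derivative_cong_open(1)[OF U y])
               (use alternating_multilinear_linear[OF diff_forms_alternating[OF \<beta>], of _ "[]" ws] ws in
                \<open>auto intro: linear_eq_sum_Basis\<close>)
          ultimately show ?thesis by (simp add: frechet_derivativeI)
        qed
        then have "ray_int (Suc j) (\<lambda>y. ?D y v (?w # ws)) x = ray_int (Suc j) (\<lambda>y. \<Sum>b\<in>Basis. (?w \<bullet> b) * ?D y v (b # ws)) x"
          by (intro ray_int_cong x)
        also have "\<dots> = (\<Sum>b\<in>Basis. (?w \<bullet> b) * ray_int (Suc j) (\<lambda>y. ?D y v (b # ws)) x)"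
          by (subst ray_int_sum) (auto intro!: continuous_intros c x simp: ray_int_scale)
        finally show ?thesis by simp
      qed
      ultimately show ?thesis using ray_int_linear_combination[OF \<beta> x ws] by simp
    qed
    have "ext_deriv U (homotopy j \<beta>) x vs
        = alt_sum (\<lambda>v ws. ray_int j (\<lambda>y. \<beta> y (v # ws)) x + ray_int (Suc j) (\<lambda>y. ?D y v (?w # ws)) x) vs"
      using x len D by (auto simp: ext_deriv_alt_sum intro!: alt_sum_cong)
    also have "\<dots> = ray_int j (\<lambda>y. alt_sum (\<lambda>v ws. \<beta> y (v # ws)) vs) x
        + ray_int (Suc j) (\<lambda>y. alt_sum (\<lambda>v ws. ?D y v (?w # ws)) vs) x"
      by (simp add: alt_sum_add ray_int_alt_sum c x)
    also have "ray_int j (\<lambda>y. alt_sum (\<lambda>v ws. \<beta> y (v # ws)) vs) x = ray_int j (\<lambda>y. real (Suc j) * \<beta> y vs) x"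
      using alt_sum_alternating[of vs] diff_forms_alternating[OF \<beta>] len
      by (intro ray_int_cong x) metis
    finally have 1: "ext_deriv U (homotopy j \<beta>) x vs
        = ray_int j (\<lambda>y. real (Suc j) * \<beta> y vs) x + ray_int (Suc j) (\<lambda>y. alt_sum (\<lambda>v ws. ?D y v (?w # ws)) vs) x" .
    have "homotopy (Suc j) (ext_deriv U \<beta>) x vs = ray_int (Suc j) (\<lambda>y. ext_deriv U \<beta> y (?w # vs)) x"
      using x ray_int_linear_combination[OF d\<beta> x len] by (simp add: homotopy_def)
    also have "\<dots> = ray_int (Suc j) (\<lambda>y. ?D y ?w vs - alt_sum (\<lambda>v ws. ?D y v (?w # ws)) vs) x"
      by (intro ray_int_cong x) (simp add: ext_deriv_alt_sum)
    also have "\<dots> = ray_int (Suc j) (\<lambda>y. ?D y ?w vs) x - ray_int (Suc j) (\<lambda>y. alt_sum (\<lambda>v ws. ?D y v (?w # ws)) vs) x"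
      by (intro ray_int_diff x c) (auto intro!: continuous_intros c simp flip: alt_sum_eq)
    finally have 2: "(ext_deriv U (homotopy j \<beta>) + homotopy (Suc j) (ext_deriv U \<beta>)) x vs
        = ray_int j (\<lambda>y. real (Suc j) * \<beta> y vs) x + ray_int (Suc j) (\<lambda>y. ?D y ?w vs) x"
      by (simp add: 1)
    have "((\<lambda>\<tau>. \<tau> ^ Suc j * \<beta> (p + \<tau> *\<^sub>R ?w) vs) has_real_derivative
        (\<tau> ^ j * (real (Suc j) * \<beta> (p + \<tau> *\<^sub>R ?w) vs) + \<tau> ^ Suc j * ?D (p + \<tau> *\<^sub>R ?w) ?w vs)) (at \<tau>)"
      if "\<tau> \<in> {0..1}" for \<tau>
      using DERIV_mult[OF DERIV_power[OF DERIV_ident, of "Suc j"] DERIV_along_line[OF s[of vs], of p \<tau> ?w]]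
        ray_in[OF x, of \<tau>] that by (simp add: algebra_simps)
    then have "((\<lambda>\<tau>. \<tau> ^ j * (real (Suc j) * \<beta> (p + \<tau> *\<^sub>R ?w) vs) + \<tau> ^ Suc j * ?D (p + \<tau> *\<^sub>R ?w) ?w vs)
        has_integral (1 ^ Suc j * \<beta> (p + 1 *\<^sub>R ?w) vs - 0 ^ Suc j * \<beta> (p + 0 *\<^sub>R ?w) vs)) {0..1}"
      by (intro fundamental_theorem_of_calculus)
         (auto simp: has_real_derivative_iff_has_vector_derivative[symmetric] intro: DERIV_subset)
    then have "integral {0..1} (\<lambda>\<tau>. \<tau> ^ j * (real (Suc j) * \<beta> (p + \<tau> *\<^sub>R ?w) vs) + \<tau> ^ Suc j * ?D (p + \<tau> *\<^sub>R ?w) ?w vs) = \<beta> x vs"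
      by (simp add: integral_unique)
    moreover have "integral {0..1} (\<lambda>\<tau>. \<tau> ^ j * (real (Suc j) * \<beta> (p + \<tau> *\<^sub>R ?w) vs) + \<tau> ^ Suc j * ?D (p + \<tau> *\<^sub>R ?w) ?w vs)
        = ray_int j (\<lambda>y. real (Suc j) * \<beta> y vs) x + ray_int (Suc j) (\<lambda>y. ?D y ?w vs) x"
      unfolding ray_int_def
      by (intro integral_add ray_integrable[where g="\<lambda>y. real (Suc j) * \<beta> y vs"] ray_integrable[where g="\<lambda>y. ?D y ?w vs"] x)
         (auto intro!: continuous_intros c)
    ultimately show ?thesis using 2 by simp
  qed
qed

theorem poincare_lemma:
  assumes "\<beta> \<in> diff_forms U (Suc j)" "ext_deriv U \<beta> = 0"
  shows "\<exists>\<gamma>\<in>diff_forms U j. ext_deriv U \<gamma> = \<beta>"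
proof
  have "homotopy (Suc j) 0 = 0" by (auto simp: homotopy_def ray_int_def fun_eq_iff)
  then show "ext_deriv U (homotopy j \<beta>) = \<beta>" using homotopy_formula[OF assms(1)] assms(2) by simp
qed (rule homotopy_in_diff_forms[OF assms(1)])

lemma closed_0_form_const:
  assumes "\<beta> \<in> diff_forms U 0" "ext_deriv U \<beta> = 0"
  shows "\<exists>r. \<beta> = r *\<^sub>R fun_form U (\<lambda>x. 1)"
proof -
  have "((\<lambda>y. \<beta> y []) has_derivative (\<lambda>h. 0)) (at x within U)" if x: "x \<in> U" for x
  proof -
    have "frechet_derivative (\<lambda>y. \<beta> y []) (at x) v = ext_deriv U \<beta> x [v]" for v
      using x by (simp add: ext_deriv_alt_sum)
    then have "frechet_derivative (\<lambda>y. \<beta> y []) (at x) = (\<lambda>h. 0)" using assms(2) by (simp add: fun_eq_iff)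
    then show ?thesis using diff_forms_has_derivative[OF assms(1) x, of "[]"] by (simp add: has_derivative_at_withinI)
  qed
  from has_derivative_zero_constant[OF conv this] obtain c where "\<forall>x\<in>U. \<beta> x [] = c" by blast
  then have "\<beta> = c *\<^sub>R fun_form U (\<lambda>x. 1)"
    by (subst diff_forms_0_eq_fun_form[OF assms(1)]) (auto simp: fun_form_def fun_eq_iff)
  then show ?thesis by blast
qed

end

section \<open>Solving \<open>T \<gamma> - \<gamma> = \<beta>\<close> for invariant forms\<close>

definition invariant_forms :: "'a::euclidean_space set \<Rightarrow> ('a \<Rightarrow> 'a) set \<Rightarrow> nat \<Rightarrow> 'a form set" where
  "invariant_forms U K k = {\<omega> \<in> diff_forms U k. \<forall>g\<in>K. pull g \<omega> = \<omega>}"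

lemma invariant_forms_diff_forms: "\<omega> \<in> invariant_forms U K k \<Longrightarrow> \<omega> \<in> diff_forms U k"
  by (simp add: invariant_forms_def)

lemma invariant_forms_pull: "\<omega> \<in> invariant_forms U K k \<Longrightarrow> g \<in> K \<Longrightarrow> pull g \<omega> = \<omega>"
  by (simp add: invariant_forms_def)

lemma subspace_invariant_forms:
  assumes "open U" shows "subspace (invariant_forms U K k)"
  using subspace_diff_forms[OF assms]
  by (auto simp: subspace_def invariant_forms_def pull_add pull_scale linear_0[OF linear_pull])

lemma fun_mult_in_invariant_forms:
  assumes U: "open U" and f: "smooth_on U f" "\<And>g x. g \<in> K \<Longrightarrow> x \<in> U \<Longrightarrow> f (g x) = f x"
    and \<beta>: "\<beta> \<in> invariant_forms U K k"
  shows "fun_mult f \<beta> \<in> invariant_forms U K k"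
proof -
  note \<beta>' = invariant_forms_diff_forms[OF \<beta>]
  have "pull g (fun_mult f \<beta>) = fun_mult f \<beta>" if "g \<in> K" for g
  proof -
    have "(f \<circ> g) x * \<beta> x vs = f x * \<beta> x vs" for x vs
      using f(2)[OF that] diff_forms_zero[OF \<beta>', of x vs] by (cases "x \<in> U") auto
    then show ?thesis
      by (simp add: pull_fun_mult invariant_forms_pull[OF \<beta> that] fun_eq_iff)
  qed
  then show ?thesis
    using fun_mult_in_diff_forms[OF U f(1) \<beta>'] by (simp add: invariant_forms_def)
qed

lemma diff_telescope: "x - s = b - t \<Longrightarrow> (x - u) - (s - t) = b - u" for x :: "'a::ab_group_add"
  by (simp add: algebra_simps)

text \<open>If \<open>\<beta>\<close> vanishes where \<open>l \<ge> 1\<close>, then \<open>- (\<beta> + T \<beta> + T\<^sup>2 \<beta> + \<dots>)\<close> is a finite sum near every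
  point, because \<open>h\<close> increases \<open>l\<close>.\<close>

lemma transfer_equation_half:
  fixes U :: "'a::euclidean_space set" and h :: "'a \<Rightarrow> 'a" and l :: "'a \<Rightarrow> real" and \<mu> :: real
  defines "T \<equiv> \<lambda>\<omega>. \<mu> *\<^sub>R pull h \<omega>"
  assumes U: "open U" and h: "\<And>x. h x \<in> U \<longleftrightarrow> x \<in> U"
    and K: "\<And>g x. g \<in> K \<Longrightarrow> g x \<in> U \<longleftrightarrow> x \<in> U"
    and T: "\<And>\<omega>. \<omega> \<in> invariant_forms U K k \<Longrightarrow> T \<omega> \<in> invariant_forms U K k"
    and l: "continuous_on U l" "\<And>x. x \<in> U \<Longrightarrow> l (h x) = l x + 1" "\<And>g x. g \<in> K \<Longrightarrow> x \<in> U \<Longrightarrow> l (g x) = l x"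
    and \<beta>: "\<beta> \<in> invariant_forms U K k" "\<And>x vs. x \<in> U \<Longrightarrow> l x \<ge> 1 \<Longrightarrow> \<beta> x vs = 0"
  shows "\<exists>\<gamma>\<in>invariant_forms U K k. T \<gamma> - \<gamma> = \<beta>"
proof -
  define S where "S M = - (\<Sum>n<M. (T ^^ n) \<beta>)" for M
  define \<gamma> where "\<gamma> x vs = S (nat \<lceil>1 - l x\<rceil>) x vs" for x vs
  have T_add: "T (\<omega> + \<omega>') = T \<omega> + T \<omega>'" and T_minus: "T (- \<omega>) = - T \<omega>" for \<omega> \<omega>'
    by (simp_all add: T_def pull_add scaleR_add_right linear_neg[OF linear_pull])
  have T_apply: "T \<omega> x vs = \<mu> * \<omega> (h x) (map (\<lambda>v. h v - h 0) vs)" for \<omega> x vs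
    by (simp add: T_def pull_def)
  have T0: "T 0 = 0" by (simp add: T_def linear_0[OF linear_pull])
  have iter_in: "(T ^^ n) \<beta> \<in> invariant_forms U K k" for n by (induction n) (simp_all add: \<beta> T)
  have S_in: "S M \<in> invariant_forms U K k" for M
    unfolding S_def
    by (intro subspace_neg subspace_sum subspace_invariant_forms U iter_in)
  have S_Suc: "S (Suc M) = S M - (T ^^ M) \<beta>" for M by (simp add: S_def)
  have TS: "T (S M) - S M = \<beta> - (T ^^ M) \<beta>" for M
  proof (induction M)
    case (Suc M)
    have T_S: "T (S (Suc M)) = T (S M) - (T ^^ Suc M) \<beta>"
      using T_add[of "S M" "- (T ^^ M) \<beta>"] by (simp add: S_Suc T_minus)
    show ?case unfolding T_S unfolding S_Suc by (rule diff_telescope[OF Suc])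
  next
    case 0
    have "S 0 = 0" unfolding S_def by (simp only: lessThan_0 sum.empty minus_zero)
    then show ?case by (simp only: T0 funpow_0 diff_self)
  qed
  have vanish: "(T ^^ n) \<beta> x vs = 0" if "x \<in> U" "l x + real n \<ge> 1" for n x vs
    using that
  proof (induction n arbitrary: x vs)
    case (Suc n)
    have "(T ^^ n) \<beta> (h x) ws = 0" for ws
      by (rule Suc.IH) (use Suc.prems h l(2) in auto)
    then have "T ((T ^^ n) \<beta>) x vs = 0" unfolding T_apply by simp
    then show ?case unfolding funpow.simps o_apply .
  qed (simp add: \<beta>)
  have S_stable: "S M x vs = \<gamma> x vs" if "x \<in> U" "l x + real M \<ge> 1" for M x vs
  proof -
    let ?N = "nat \<lceil>1 - l x\<rceil>"
    have N: "?N \<le> M" using that(2) by linarith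
    have "S (?N + j) x vs = S ?N x vs" for j
    proof (induction j)
      case (Suc j)
      have "l x + real (?N + j) \<ge> 1" by linarith
      then show ?case using Suc vanish[OF that(1), of "?N + j"] by (simp add: S_Suc)
    qed simp
    from this[of "M - ?N"] N show ?thesis by (simp add: \<gamma>_def)
  qed
  have large: "\<exists>M. l x + real M \<ge> 1" for x
    using real_arch_simple[of "1 - l x"] by (auto simp: algebra_simps)
  have \<gamma>_outside: "\<gamma> x vs = 0" if "x \<notin> U \<or> length vs \<noteq> k" for x vs
    unfolding \<gamma>_def using diff_forms_zero[OF invariant_forms_diff_forms[OF S_in] that] .
  have "\<gamma> \<in> diff_forms U k"
  proof (rule diff_formsI[OF \<gamma>_outside])
    fix x assume x: "x \<in> U"
    obtain M where "l x + real M \<ge> 1" using large by blast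
    with S_stable[OF x this] have "\<gamma> x = S M x" by auto
    then show "alternating_multilinear k (\<gamma> x)"
      using diff_forms_alternating[OF invariant_forms_diff_forms[OF S_in] x] by simp
  next
    fix vs
    show "smooth_on U (\<lambda>x. \<gamma> x vs)"
    proof (rule smooth_on_local)
      fix x0 assume x0: "x0 \<in> U"
      obtain M where M: "(l x0 - 1) + real M \<ge> 1"
        using real_arch_simple[of "2 - l x0"] by (auto simp: algebra_simps)
      define V where "V = {x\<in>U. l x0 - 1 < l x}"
      have V: "open V" "x0 \<in> V" "V \<subseteq> U"
        unfolding V_def using continuous_open_preimage[OF l(1) U, of "{l x0 - 1<..}"] x0
        by (auto simp: vimage_def Int_def)
      have "smooth_on V (\<lambda>x. S M x vs)"
        by (rule smooth_on_subset[OF diff_forms_smooth[OF invariant_forms_diff_forms[OF S_in]] V(3)])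
      moreover have "S M x vs = \<gamma> x vs" if "x \<in> V" for x
        using that M by (intro S_stable) (auto simp: V_def)
      ultimately have "smooth_on V (\<lambda>x. \<gamma> x vs)" using smooth_on_cong[OF V(1)] by metis
      then show "\<exists>V. open V \<and> x0 \<in> V \<and> smooth_on V (\<lambda>x. \<gamma> x vs)" using V by blast
    qed
  qed
  moreover have "pull g \<gamma> = \<gamma>" if g: "g \<in> K" for g
  proof (intro ext)
    fix x vs
    show "pull g \<gamma> x vs = \<gamma> x vs"
    proof (cases "x \<in> U")
      case True
      obtain M where M: "l x + real M \<ge> 1" using large by blast
      have "pull g \<gamma> x vs = pull g (S M) x vs"
        using S_stable[of "g x" M] True K[OF g] l(3)[OF g True] M by (simp add: pull_def)
      also have "\<dots> = \<gamma> x vs" using invariant_forms_pull[OF S_in g] S_stable[OF True M] by simp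
      finally show ?thesis .
    qed (simp add: \<gamma>_outside pull_def K[OF g])
  qed
  ultimately have \<gamma>_in: "\<gamma> \<in> invariant_forms U K k" by (simp add: invariant_forms_def)
  have "(T \<gamma> - \<gamma>) x vs = \<beta> x vs" for x vs
  proof (cases "x \<in> U")
    case True
    obtain M where M: "l x + real M \<ge> 1" using large by blast
    have "T \<gamma> x vs = T (S M) x vs"
      using S_stable[of "h x" M] True h l(2)[OF True] M by (simp add: T_apply)
    then have "(T \<gamma> - \<gamma>) x vs = (T (S M) - S M) x vs" using S_stable[OF True M] by simp
    also have "\<dots> = \<beta> x vs" unfolding TS using vanish[OF True M] by simp
    finally show ?thesis .
  next
    case False
    then show ?thesis
      using \<gamma>_outside diff_forms_zero[OF invariant_forms_diff_forms[OF T[OF \<gamma>_in]]]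
        diff_forms_zero[OF invariant_forms_diff_forms[OF \<beta>(1)]] by simp
  qed
  then show ?thesis using \<gamma>_in by blast
qed

text \<open>Surjectivity of \<open>\<mu> h\<^sup>* - 1\<close> on the \<open>K\<close>-invariant forms. The function \<open>l\<close> is a
  coordinate that \<open>h\<close> translates; a smooth step in \<open>l\<close> cuts \<open>\<beta>\<close> into two halves, and for one half the
  geometric series in \<open>h\<close>, for the other the one in the inverse of \<open>h\<close> is locally finite.\<close>

lemma transfer_equation:
  fixes U :: "'a::euclidean_space set" and h h' :: "'a \<Rightarrow> 'a" and l :: "'a \<Rightarrow> real" and \<mu> :: real
  assumes U: "open U" and aff: "affine_map h" "affine_map h'" and inv: "h \<circ> h' = id" "h' \<circ> h = id"
    and h: "\<And>x. h x \<in> U \<longleftrightarrow> x \<in> U" and \<mu>: "\<mu> \<noteq> 0"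
    and K: "\<And>g x. g \<in> K \<Longrightarrow> g x \<in> U \<longleftrightarrow> x \<in> U"
    and T: "\<And>\<omega>. \<omega> \<in> invariant_forms U K k \<Longrightarrow> pull h \<omega> \<in> invariant_forms U K k"
    and T': "\<And>\<omega>. \<omega> \<in> invariant_forms U K k \<Longrightarrow> pull h' \<omega> \<in> invariant_forms U K k"
    and l: "smooth_on U l" "\<And>x. x \<in> U \<Longrightarrow> l (h x) = l x + 1" "\<And>g x. g \<in> K \<Longrightarrow> x \<in> U \<Longrightarrow> l (g x) = l x"
    and \<beta>: "\<beta> \<in> invariant_forms U K k"
  shows "\<exists>\<gamma>\<in>invariant_forms U K k. \<mu> *\<^sub>R pull h \<gamma> - \<gamma> = \<beta>"
proof -
  note sub = subspace_invariant_forms[OF U]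
  define \<sigma> where "\<sigma> x = smooth_step (l x)" for x
  have \<sigma>: "smooth_on U \<sigma>" unfolding \<sigma>_def
    by (rule smooth_on_compose_real[OF U _ smooth_on_smooth_step l(1)]) simp
  have \<sigma>': "smooth_on U (\<lambda>x. 1 - \<sigma> x)" by (intro smooth_on_diff smooth_on_const U \<sigma>)
  have h': "h' x \<in> U \<longleftrightarrow> x \<in> U" for x using h[of "h' x"] fun_cong[OF inv(1), of x] by simp
  have l': "l (h' x) = l x - 1" if "x \<in> U" for x
    using l(2)[of "h' x"] that h'[of x] fun_cong[OF inv(1), of x] by simp
  let ?\<beta>1 = "fun_mult (\<lambda>x. 1 - \<sigma> x) \<beta>" and ?\<beta>2 = "fun_mult \<sigma> \<beta>"
  have \<beta>1: "?\<beta>1 \<in> invariant_forms U K k" and \<beta>2: "?\<beta>2 \<in> invariant_forms U K k"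
    by (intro fun_mult_in_invariant_forms U \<sigma> \<sigma>' \<beta>; simp add: \<sigma>_def l(3))+
  have T_in: "\<mu> *\<^sub>R pull h \<omega> \<in> invariant_forms U K k" if "\<omega> \<in> invariant_forms U K k" for \<omega>
    using that by (intro subspace_scale[OF sub] T)
  have "\<exists>\<gamma>\<in>invariant_forms U K k. \<mu> *\<^sub>R pull h \<gamma> - \<gamma> = ?\<beta>1"
    by (rule transfer_equation_half[where U=U and K=K and h=h and l=l and k=k and \<mu>=\<mu> and \<beta>="?\<beta>1"],
        rule U, rule h, erule K, erule T_in, rule smooth_on_imp_continuous_on[OF l(1)], erule l(2), erule (1) l(3), rule \<beta>1)
       (simp add: \<sigma>_def smooth_step_1)
  then obtain \<gamma>1 where \<gamma>1: "\<gamma>1 \<in> invariant_forms U K k" "\<mu> *\<^sub>R pull h \<gamma>1 - \<gamma>1 = ?\<beta>1" by blast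
  \<comment> \<open>The remaining part vanishes where \<open>l \<le> 0\<close>; for it \<open>h\<close> and \<open>l\<close> are replaced by \<open>h'\<close> and \<open>- l\<close>.\<close>
  have T'_in: "inverse \<mu> *\<^sub>R pull h' \<omega> \<in> invariant_forms U K k" if "\<omega> \<in> invariant_forms U K k" for \<omega>
    using that by (intro subspace_scale[OF sub] T')
  have "\<exists>\<gamma>\<in>invariant_forms U K k. inverse \<mu> *\<^sub>R pull h' \<gamma> - \<gamma> = inverse \<mu> *\<^sub>R pull h' ?\<beta>2"
  proof (rule transfer_equation_half[where U=U and K=K and h=h' and l="\<lambda>x. - l x" and k=k
        and \<mu>="inverse \<mu>" and \<beta>="inverse \<mu> *\<^sub>R pull h' ?\<beta>2"],
      rule U, rule h', erule K, erule T'_in)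
    show "continuous_on U (\<lambda>x. - l x)"
      by (intro continuous_on_minus smooth_on_imp_continuous_on l)
    show "(inverse \<mu> *\<^sub>R pull h' ?\<beta>2) x vs = 0" if "x \<in> U" "1 \<le> - l x" for x vs
      using l'[OF that(1)] that(2) by (simp add: pull_def \<sigma>_def smooth_step_0)
    show "inverse \<mu> *\<^sub>R pull h' ?\<beta>2 \<in> invariant_forms U K k" by (rule T'_in[OF \<beta>2])
  qed (simp_all add: l' l(3))
  then obtain \<gamma>2 where \<gamma>2: "\<gamma>2 \<in> invariant_forms U K k"
    "inverse \<mu> *\<^sub>R pull h' \<gamma>2 - \<gamma>2 = inverse \<mu> *\<^sub>R pull h' ?\<beta>2" by blast
  have "pull h (pull h' \<omega>) = \<omega>" for \<omega> by (simp add: pull_compose[OF aff(2)] inv(2))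
  then have "\<mu> *\<^sub>R pull h (inverse \<mu> *\<^sub>R pull h' \<omega>) = \<omega>" for \<omega> using \<mu> by (simp add: pull_scale)
  moreover have "\<mu> *\<^sub>R pull h (inverse \<mu> *\<^sub>R pull h' \<gamma>2 - \<gamma>2) = \<mu> *\<^sub>R pull h (inverse \<mu> *\<^sub>R pull h' ?\<beta>2)"
    by (simp only: \<gamma>2(2))
  ultimately have "\<gamma>2 - \<mu> *\<^sub>R pull h \<gamma>2 = ?\<beta>2"
    by (simp add: linear_diff[OF linear_pull] scaleR_diff_right)
  moreover have "?\<beta>1 + ?\<beta>2 = \<beta>" by (simp add: fun_eq_iff algebra_simps)
  moreover have "\<mu> *\<^sub>R pull h (\<gamma>1 - \<gamma>2) - (\<gamma>1 - \<gamma>2)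
      = (\<mu> *\<^sub>R pull h \<gamma>1 - \<gamma>1) + (\<gamma>2 - \<mu> *\<^sub>R pull h \<gamma>2)"
    by (simp add: linear_diff[OF linear_pull] scaleR_diff_right)
  ultimately have "\<mu> *\<^sub>R pull h (\<gamma>1 - \<gamma>2) - (\<gamma>1 - \<gamma>2) = \<beta>"
    using \<gamma>1(2) by simp
  then show ?thesis using subspace_diff[OF sub \<gamma>1(1) \<gamma>2(1)] by blast
qed

section \<open>The Wang sequence\<close>

text \<open>Complexes are families of subspaces of one vector space with a common differential.
  Negative degrees are zero.\<close>

definition closed_part :: "(nat \<Rightarrow> 'v::real_vector set) \<Rightarrow> ('v \<Rightarrow> 'v) \<Rightarrow> nat \<Rightarrow> 'v set" where
  "closed_part C d k = {x \<in> C k. d x = 0}"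

definition exact_part :: "(nat \<Rightarrow> 'v::real_vector set) \<Rightarrow> ('v \<Rightarrow> 'v) \<Rightarrow> nat \<Rightarrow> 'v set" where
  "exact_part C d k = (case k of 0 \<Rightarrow> {0} | Suc j \<Rightarrow> d ` C j)"

text \<open>\<open>P\<close> is a complement of the exact elements in the closed elements, that is, a subspace of closed
  elements that maps isomorphically onto cohomology.\<close>

definition represents_cohomology :: "(nat \<Rightarrow> 'v::real_vector set) \<Rightarrow> ('v \<Rightarrow> 'v) \<Rightarrow> nat \<Rightarrow> 'v set \<Rightarrow> bool" where
  "represents_cohomology C d k P \<longleftrightarrow> subspace P \<and> P \<subseteq> closed_part C d k \<and>
     P \<inter> exact_part C d k \<subseteq> {0} \<and> (\<forall>z\<in>closed_part C d k. \<exists>p\<in>P. z - p \<in> exact_part C d k)"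

lemma represents_cohomologyD:
  assumes "represents_cohomology C d k P"
  shows "subspace P" "p \<in> P \<Longrightarrow> p \<in> C k" "p \<in> P \<Longrightarrow> d p = 0"
    "p \<in> P \<Longrightarrow> p \<in> exact_part C d k \<Longrightarrow> p = 0"
    "z \<in> C k \<Longrightarrow> d z = 0 \<Longrightarrow> \<exists>p\<in>P. z - p \<in> exact_part C d k"
  using assms unfolding represents_cohomology_def closed_part_def by auto

locale cochain_complex =
  fixes C :: "nat \<Rightarrow> 'v::real_vector set" and d :: "'v \<Rightarrow> 'v"
  assumes sub: "subspace (C k)"
    and d_add: "x \<in> C k \<Longrightarrow> y \<in> C k \<Longrightarrow> d (x + y) = d x + d y"
    and d_scale: "x \<in> C k \<Longrightarrow> d (r *\<^sub>R x) = r *\<^sub>R d x"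
    and d_in: "x \<in> C k \<Longrightarrow> d x \<in> C (Suc k)"
    and d_d: "x \<in> C k \<Longrightarrow> d (d x) = 0"
begin

lemma d_minus: "x \<in> C k \<Longrightarrow> d (- x) = - d x"
  using d_scale[of x k "-1"] by simp

lemma d_diff: "x \<in> C k \<Longrightarrow> y \<in> C k \<Longrightarrow> d (x - y) = d x - d y"
  using d_add[of x k "- y"] d_minus[of y k] subspace_neg[OF sub, of y k] by simp

lemma d_zero: "d 0 = 0"
  using d_scale[OF subspace_0[OF sub], of 0] by simp

lemma subspace_closed_part: "subspace (closed_part C d k)"
  using sub[of k] by (auto simp: subspace_def closed_part_def d_zero d_add d_scale)

lemma subspace_exact_part: "subspace (exact_part C d k)"
proof (cases k)
  case (Suc j)
  have "d x + d y \<in> d ` C j" "r *\<^sub>R d x \<in> d ` C j" if "x \<in> C j" "y \<in> C j" for x y r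
    using that d_add[OF that] d_scale[of x j r] subspace_add[OF sub that] subspace_scale[OF sub that(1)]
    by (metis image_eqI)+
  then show ?thesis using Suc d_zero subspace_0[OF sub[of j]]
    by (auto simp: subspace_def exact_part_def image_iff intro!: bexI[of _ 0])
qed (simp add: exact_part_def)

lemma exact_part_subset: "exact_part C d k \<subseteq> closed_part C d k"
  using subspace_0[OF sub] d_zero d_in d_d by (cases k) (auto simp: exact_part_def closed_part_def)

end

text \<open>If \<open>T - 1\<close> is surjective on the complex \<open>C\<close>, then \<open>0 \<rightarrow> fixed \<rightarrow> C \<rightarrow> C \<rightarrow> 0\<close> is exact, and the long
  exact sequence gives
  \<open>0 \<rightarrow> coker (T - 1 | H\<^sup>k C) \<rightarrow> H\<^sup>k\<^sup>+\<^sup>1 fixed \<rightarrow> ker (T - 1 | H\<^sup>k\<^sup>+\<^sup>1 C) \<rightarrow> 0\<close>.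
  For the forms invariant under a group and a further deck transformation this is the Wang
  sequence of a fibration over the circle.\<close>

locale wang = cochain_complex C d
  for C :: "nat \<Rightarrow> 'v::real_vector set" and d :: "'v \<Rightarrow> 'v" +
  fixes T :: "'v \<Rightarrow> 'v"
  assumes T_linear: "linear T"
    and T_in: "x \<in> C k \<Longrightarrow> T x \<in> C k"
    and T_d: "x \<in> C k \<Longrightarrow> T (d x) = d (T x)"
    and T_surj: "y \<in> C k \<Longrightarrow> \<exists>x\<in>C k. T x - x = y"
begin

definition fixed :: "nat \<Rightarrow> 'v set" where
  "fixed k = {x \<in> C k. T x = x}"

lemmas T_simps = linear_add[OF T_linear] linear_diff[OF T_linear] linear_cmul[OF T_linear] linear_0[OF T_linear]

lemma cochain_complex_fixed: "cochain_complex fixed d"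
proof
  show "subspace (fixed k)" for k
    using sub[of k] by (auto simp: subspace_def fixed_def T_simps)
qed (auto simp: fixed_def d_add d_scale d_in d_d T_d)

lemma T_minus_id_d: "x \<in> C k \<Longrightarrow> T (d x) - d x = d (T x - x)"
  by (simp add: T_d d_diff[OF T_in])

lemma T_minus_id_in: "x \<in> C k \<Longrightarrow> T x - x \<in> C k"
  by (rule subspace_diff[OF sub T_in])

text \<open>A preimage of an exact element under \<open>T - 1\<close> can be chosen exact, because \<open>T - 1\<close> is surjective
  one degree lower and commutes with \<open>d\<close>.\<close>

lemma exact_lift:
  assumes "e \<in> exact_part C d k"
  shows "\<exists>x\<in>C k. d x = 0 \<and> T x - x = e"
proof (cases k)
  case 0
  then show ?thesis using assms subspace_0[OF sub] d_zero by (auto simp: exact_part_def T_simps)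
next
  case (Suc j)
  then obtain g where g: "g \<in> C j" "e = d g" using assms by (auto simp: exact_part_def)
  obtain g' where g': "g' \<in> C j" "T g' - g' = g" using T_surj[OF g(1)] by blast
  have "d g' \<in> C k" "d (d g') = 0" "T (d g') - d g' = e"
    using g' g d_in[OF g'(1)] d_d[OF g'(1)] T_minus_id_d[OF g'(1)] Suc by auto
  then show ?thesis by blast
qed

lemma T_minus_id_exact:
  assumes "e \<in> exact_part C d k" shows "T e - e \<in> exact_part C d k"
proof (cases k)
  case (Suc j)
  then show ?thesis using assms T_minus_id_d T_minus_id_in by (auto simp: exact_part_def)
qed (use assms in \<open>simp add: exact_part_def T_simps\<close>)

text \<open>The short exact sequence in terms of representatives. \<open>P\<close> consists of fixed representatives of the
  kernel of \<open>T - 1\<close>, and \<open>(T - 1) Q\<close> represents the cokernel one degree lower; the connecting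
  homomorphism sends the class of \<open>T q - q\<close> to that of \<open>d q\<close>.\<close>

theorem represents_cohomology_fixed_Suc:
  assumes P: "subspace P" "P \<subseteq> closed_part fixed d (Suc k)" "P \<inter> exact_part C d (Suc k) \<subseteq> {0}"
    and P_span: "\<And>z. z \<in> C (Suc k) \<Longrightarrow> d z = 0 \<Longrightarrow> T z - z \<in> exact_part C d (Suc k)
                  \<Longrightarrow> \<exists>p\<in>P. z - p \<in> exact_part C d (Suc k)"
    and Q: "subspace Q" "Q \<subseteq> C k" "\<And>q. q \<in> Q \<Longrightarrow> d (T q - q) = 0"
    and Q_span: "\<And>z. z \<in> C k \<Longrightarrow> d z = 0 \<Longrightarrow>
                  \<exists>q\<in>Q. \<exists>y\<in>C k. d y = 0 \<and> z - (T q - q) - (T y - y) \<in> exact_part C d k"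
    and Q_inj: "\<And>q y. q \<in> Q \<Longrightarrow> y \<in> C k \<Longrightarrow> d y = 0 \<Longrightarrow>
                  (T q - q) - (T y - y) \<in> exact_part C d k \<Longrightarrow> q = 0"
  shows "represents_cohomology fixed d (Suc k) {p + d q | p q. p \<in> P \<and> q \<in> Q}"
proof -
  let ?R = "{p + d q | p q. p \<in> P \<and> q \<in> Q}"
  have "subspace ?R"
  proof (rule subspaceI)
    show "0 \<in> ?R" using subspace_0[OF P(1)] subspace_0[OF Q(1)] d_zero by force
  next
    fix x y assume "x \<in> ?R" "y \<in> ?R"
    then obtain p q p' q' where "p \<in> P" "q \<in> Q" "p' \<in> P" "q' \<in> Q" "x = p + d q" "y = p' + d q'" by blast
    then have "x + y = (p + p') + d (q + q')" "p + p' \<in> P" "q + q' \<in> Q"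
      using subspace_add[OF P(1)] subspace_add[OF Q(1)] subsetD[OF Q(2)] d_add[of q k q']
      by (auto simp: algebra_simps)
    then show "x + y \<in> ?R" by blast
  next
    fix r x assume "x \<in> ?R"
    then obtain p q where "p \<in> P" "q \<in> Q" "x = p + d q" by blast
    then have "r *\<^sub>R x = r *\<^sub>R p + d (r *\<^sub>R q)" "r *\<^sub>R p \<in> P" "r *\<^sub>R q \<in> Q"
      using subspace_scale[OF P(1)] subspace_scale[OF Q(1)] Q(2) d_scale[of q k r]
      by (auto simp: scaleR_add_right)
    then show "r *\<^sub>R x \<in> ?R" by blast
  qed
  moreover have "?R \<subseteq> closed_part fixed d (Suc k)"
  proof clarify
    fix p q assume pq: "p \<in> P" "q \<in> Q"
    then have q: "q \<in> C k" using Q(2) by blast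
    have "T (d q) = d q" using T_minus_id_d[OF q] Q(3)[OF pq(2)] by simp
    then have "d q \<in> closed_part fixed d (Suc k)"
      using d_in[OF q] d_d[OF q] by (simp add: closed_part_def fixed_def)
    then show "p + d q \<in> closed_part fixed d (Suc k)"
      using pq(1) P(2) subspace_add[OF cochain_complex.subspace_closed_part[OF cochain_complex_fixed]] by blast
  qed
  moreover have "?R \<inter> exact_part fixed d (Suc k) \<subseteq> {0}"
  proof clarify
    fix p q assume pq: "p \<in> P" "q \<in> Q" and "p + d q \<in> exact_part fixed d (Suc k)"
    then obtain b where b: "b \<in> C k" "T b = b" "p + d q = d b" by (auto simp: exact_part_def fixed_def)
    have q: "q \<in> C k" using pq Q(2) by blast
    have "p = d (b - q)" using b(3) d_diff[OF b(1) q] by (metis add_diff_cancel_right')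
    then have "p \<in> exact_part C d (Suc k)" using subspace_diff[OF sub b(1) q] by (auto simp: exact_part_def)
    then have p0: "p = 0" using P(3) pq(1) by blast
    have "q = 0"
    proof (rule Q_inj[OF pq(2) subspace_diff[OF sub q b(1)]])
      show "d (q - b) = 0" using b(3) p0 d_diff[OF q b(1)] by simp
      show "T q - q - (T (q - b) - (q - b)) \<in> exact_part C d k"
        using subspace_0[OF subspace_exact_part] by (simp add: T_simps b(2))
    qed
    then show "p + d q = 0" using p0 d_zero by simp
  qed
  moreover have "\<exists>r\<in>?R. w - r \<in> exact_part fixed d (Suc k)" if "w \<in> closed_part fixed d (Suc k)" for w
  proof -
    have w: "w \<in> C (Suc k)" "d w = 0" "T w = w" using that by (auto simp: closed_part_def fixed_def)
    then obtain p where p: "p \<in> P" "w - p \<in> exact_part C d (Suc k)"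
      using P_span[of w] subspace_0[OF subspace_exact_part] by auto
    then obtain g where g: "g \<in> C k" "w - p = d g" by (auto simp: exact_part_def)
    have "T p = p" using p(1) P(2) by (auto simp: closed_part_def fixed_def)
    then have "T (d g) - d g = 0" using g(2)[symmetric] w(3) by (simp add: T_simps)
    then have "d (T g - g) = 0" using T_minus_id_d[OF g(1)] by simp
    then obtain q y where q: "q \<in> Q" and y: "y \<in> C k" "d y = 0"
      and e: "T g - g - (T q - q) - (T y - y) \<in> exact_part C d k"
      using Q_span[OF T_minus_id_in[OF g(1)]] by blast
    obtain x where x: "x \<in> C k" "d x = 0" "T x - x = T g - g - (T q - q) - (T y - y)"
      using exact_lift[OF e] by blast
    have qC: "q \<in> C k" using q Q(2) by blast
    let ?g = "g - q - y - x"
    have gC: "?g \<in> C k" using g(1) qC y(1) x(1) by (intro subspace_diff[OF sub])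
    have "T ?g = ?g" using x(3) by (simp add: T_simps algebra_simps)
    moreover have "d ?g = d g - d q"
      using g(1) qC y x by (simp add: d_diff[of _ k] subspace_diff[OF sub])
    ultimately have "w - (p + d q) \<in> exact_part fixed d (Suc k)"
      using gC g(2) by (auto simp: exact_part_def fixed_def image_iff algebra_simps intro!: bexI[of _ ?g])
    then show ?thesis using p(1) q by blast
  qed
  ultimately show ?thesis by (auto simp: represents_cohomology_def)
qed

text \<open>
  The case in which \<open>T\<close> acts on the representatives with the eigenvalues \<open>1\<close> (on \<open>A\<close>) and
  \<open>\<beta> \<noteq> 1\<close> (on \<open>B\<close>): only \<open>A\<close> contributes to kernel and cokernel of \<open>T - 1\<close>.
\<close>

text \<open>The two uses of the eigenspace decomposition at once: for \<open>z\<close> with \<open>T z - z\<close> exact (\<open>a = 0\<close>) the class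
  of \<open>z\<close> comes from \<open>A\<close>, and no nonzero class of \<open>A\<close> is of the form \<open>T z - z\<close>.\<close>

lemma eigen_split:
  assumes rep: "represents_cohomology C d k P" and P: "P = {a + b | a b. a \<in> A \<and> b \<in> B}"
    and AB: "subspace A" "subspace B"
    and TA: "\<And>a. a \<in> A \<Longrightarrow> T a = a" and TB: "\<And>b. b \<in> B \<Longrightarrow> T b = \<beta> *\<^sub>R b" and \<beta>: "\<beta> \<noteq> 1"
    and z: "z \<in> C k" "d z = 0" and a: "a \<in> A" and e: "a - (T z - z) \<in> exact_part C d k"
  shows "a = 0 \<and> (\<exists>a'\<in>A. z - a' \<in> exact_part C d k)"
proof -
  note ex = subspace_exact_part[of k]
  obtain p where p: "p \<in> P" "z - p \<in> exact_part C d k" using represents_cohomologyD(5)[OF rep z] by blast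
  then obtain a1 b1 where ab: "a1 \<in> A" "b1 \<in> B" "p = a1 + b1" using P by blast
  have Tp: "T p - p = (\<beta> - 1) *\<^sub>R b1" using ab by (simp add: T_simps TA TB algebra_simps)
  have "T (z - p) - (z - p) \<in> exact_part C d k" by (rule T_minus_id_exact[OF p(2)])
  from subspace_add[OF ex e this] have "a - (T p - p) \<in> exact_part C d k"
    by (simp add: T_simps add_diff_eq diff_diff_eq2)
  then have "a - (\<beta> - 1) *\<^sub>R b1 \<in> exact_part C d k" by (simp only: Tp)
  moreover have "a - (\<beta> - 1) *\<^sub>R b1 \<in> P"
  proof -
    have "a - (\<beta> - 1) *\<^sub>R b1 = a + (- (\<beta> - 1)) *\<^sub>R b1" by (simp only: scaleR_minus_left diff_conv_add_uminus)
    then show ?thesis using a subspace_scale[OF AB(2) ab(2)] unfolding P by blast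
  qed
  ultimately have eq: "a = (\<beta> - 1) *\<^sub>R b1" using represents_cohomologyD(4)[OF rep] by force
  then have "T a = \<beta> *\<^sub>R a" using TB subspace_scale[OF AB(2) ab(2), of "\<beta> - 1"] by simp
  then have "(\<beta> - 1) *\<^sub>R a = 0" using TA[OF a] by (simp add: algebra_simps)
  then have a0: "a = 0" using \<beta> by simp
  then have "b1 = 0" using eq \<beta> by simp
  then show ?thesis using a0 ab p by auto
qed

lemma represents_cohomology_fixed_0_eigen:
  assumes rep: "represents_cohomology C d 0 {a + b | a b. a \<in> A \<and> b \<in> B}"
    and AB: "subspace A" "subspace B"
    and TA: "\<And>a. a \<in> A \<Longrightarrow> T a = a" and TB: "\<And>b. b \<in> B \<Longrightarrow> T b = \<beta> *\<^sub>R b" and \<beta>: "\<beta> \<noteq> 1"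
  shows "represents_cohomology fixed d 0 A"
proof -
  have A: "a \<in> C 0 \<and> d a = 0" if "a \<in> A" for a
    using represents_cohomologyD(2,3)[OF rep, of a] that subspace_0[OF AB(2)] by force
  have "\<exists>a\<in>A. z - a = 0" if "z \<in> C 0" "d z = 0" "T z = z" for z
    using eigen_split[OF rep refl AB TA TB \<beta> that(1,2) subspace_0[OF AB(1)]] that(3)
    by (auto simp: exact_part_def)
  then show ?thesis
    using AB(1) A TA by (auto simp: represents_cohomology_def closed_part_def exact_part_def fixed_def)
qed

theorem represents_cohomology_fixed_Suc_eigen:
  assumes rep: "represents_cohomology C d k {a + b | a b. a \<in> A \<and> b \<in> B}"
    and AB: "subspace A" "subspace B"
    and TA: "\<And>a. a \<in> A \<Longrightarrow> T a = a" and TB: "\<And>b. b \<in> B \<Longrightarrow> T b = \<beta> *\<^sub>R b" and \<beta>: "\<beta> \<noteq> 1"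
    and rep': "represents_cohomology C d (Suc k) {a + b | a b. a \<in> A' \<and> b \<in> B'}"
    and AB': "subspace A'" "subspace B'"
    and TA': "\<And>a. a \<in> A' \<Longrightarrow> T a = a" and TB': "\<And>b. b \<in> B' \<Longrightarrow> T b = \<beta>' *\<^sub>R b" and \<beta>': "\<beta>' \<noteq> 1"
    and m: "linear m" "\<And>a. a \<in> A \<Longrightarrow> m a \<in> C k" "\<And>a. a \<in> A \<Longrightarrow> T (m a) - m a = a"
  shows "represents_cohomology fixed d (Suc k) {a' + d (m a) | a' a. a' \<in> A' \<and> a \<in> A}"
proof -
  have A: "a \<in> C k \<and> d a = 0" if "a \<in> A" for a
    using represents_cohomologyD(2,3)[OF rep, of a] that subspace_0[OF AB(2)] by force
  have A': "a \<in> C (Suc k) \<and> d a = 0 \<and> (a \<in> exact_part C d (Suc k) \<longrightarrow> a = 0)" if "a \<in> A'" for a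
    using represents_cohomologyD(2,3,4)[OF rep', of a] that subspace_0[OF AB'(2)] by force
  have "represents_cohomology fixed d (Suc k) {p + d q | p q. p \<in> A' \<and> q \<in> m ` A}"
  proof (rule represents_cohomology_fixed_Suc)
    show "subspace A'" "subspace (m ` A)" by (rule AB' linear_subspace_image[OF m(1) AB(1)])+
    show "A' \<subseteq> closed_part fixed d (Suc k)" "A' \<inter> exact_part C d (Suc k) \<subseteq> {0}"
      using A' TA' by (auto simp: closed_part_def fixed_def)
    show "m ` A \<subseteq> C k" using m(2) by auto
    show "d (T q - q) = 0" if "q \<in> m ` A" for q using that m(3) A by auto
  next
    fix z assume z: "z \<in> C (Suc k)" "d z = 0" and e: "T z - z \<in> exact_part C d (Suc k)"
    show "\<exists>p\<in>A'. z - p \<in> exact_part C d (Suc k)"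
      using eigen_split[OF rep' refl AB' TA' TB' \<beta>' z subspace_0[OF AB'(1)]]
        subspace_neg[OF subspace_exact_part e] by simp
  next
    fix z assume "z \<in> C k" "d z = 0"
    then obtain a b where ab: "a \<in> A" "b \<in> B" "z - (a + b) \<in> exact_part C d k"
      using represents_cohomologyD(5)[OF rep] by blast
    let ?y = "inverse (\<beta> - 1) *\<^sub>R b"
    have bP: "0 + b \<in> {a + b | a b. a \<in> A \<and> b \<in> B}" using ab(2) subspace_0[OF AB(1)] by blast
    have y: "?y \<in> C k" "d ?y = 0"
      using represents_cohomologyD(2,3)[OF rep bP] subspace_scale[OF sub] d_scale[of b k] by auto
    have "T ?y - ?y = inverse (\<beta> - 1) *\<^sub>R ((\<beta> - 1) *\<^sub>R b)"
      using TB[OF ab(2)] by (simp add: T_simps algebra_simps)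
    also have "\<dots> = b" using \<beta> by simp
    finally have "z - (T (m a) - m a) - (T ?y - ?y) = z - (a + b)"
      by (simp only: m(3)[OF ab(1)] diff_diff_add)
    with ab(3) have "z - (T (m a) - m a) - (T ?y - ?y) \<in> exact_part C d k" by (simp only:)
    then show "\<exists>q\<in>m ` A. \<exists>y\<in>C k. d y = 0 \<and> z - (T q - q) - (T y - y) \<in> exact_part C d k"
      using ab(1) y by blast
  next
    fix q y assume "q \<in> m ` A" and y: "y \<in> C k" "d y = 0" and e: "T q - q - (T y - y) \<in> exact_part C d k"
    then obtain a where a: "a \<in> A" "q = m a" by blast
    have "a - (T y - y) \<in> exact_part C d k" using e m(3)[OF a(1)] a(2) by simp
    then have "a = 0" using eigen_split[OF rep refl AB TA TB \<beta> y a(1)] by blast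
    then show "q = 0" using a(2) linear_0[OF m(1)] by simp
  qed
  moreover have "{p + d q | p q. p \<in> A' \<and> q \<in> m ` A} = {a' + d (m a) | a' a. a' \<in> A' \<and> a \<in> A}" by blast
  ultimately show ?thesis by simp
qed

end

section \<open>The Wang sequence for invariant forms\<close>

text \<open>One storey of a tower of coverings: \<open>K\<close> is a set of generators of a group, \<open>h\<close> normalises that group
  and \<open>l\<close> is an invariant function that \<open>h\<close> shifts by \<open>1\<close>. The factor \<open>\<mu>\<close> allows for a local
  system of rank one. For \<open>T\<close>-invariant \<open>s\<close> one has \<open>(T - 1) (l s) = s\<close>, so the connecting homomorphism
  is the product with \<open>dl\<close>.\<close>

locale deck_step =
  fixes U :: "'a::euclidean_space set" and K :: "('a \<Rightarrow> 'a) set" and h h' :: "'a \<Rightarrow> 'a"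
    and \<mu> :: real and l :: "'a \<Rightarrow> real"
  assumes U: "open U"
    and K_affine: "g \<in> K \<Longrightarrow> affine_map g" and K_dom: "g \<in> K \<Longrightarrow> g x \<in> U \<longleftrightarrow> x \<in> U"
    and h_affine: "affine_map h" "affine_map h'" and h_inverse: "h \<circ> h' = id" "h' \<circ> h = id"
    and h_dom: "h x \<in> U \<longleftrightarrow> x \<in> U" and \<mu>: "\<mu> \<noteq> 0"
    and h_in: "\<omega> \<in> invariant_forms U K k \<Longrightarrow> pull h \<omega> \<in> invariant_forms U K k"
    and h'_in: "\<omega> \<in> invariant_forms U K k \<Longrightarrow> pull h' \<omega> \<in> invariant_forms U K k"
    and l_smooth: "smooth_on U l" and l_h: "x \<in> U \<Longrightarrow> l (h x) = l x + 1"
    and l_K: "g \<in> K \<Longrightarrow> x \<in> U \<Longrightarrow> l (g x) = l x"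
begin

abbreviation T :: "'a form \<Rightarrow> 'a form" where
  "T \<omega> \<equiv> \<mu> *\<^sub>R pull h \<omega>"

lemma linear_T: "linear T"
  by (rule linear_compose_scale_right[OF linear_pull])

sublocale wang "invariant_forms U K" "ext_deriv U" "\<lambda>\<omega>. \<mu> *\<^sub>R pull h \<omega>"
proof (intro wang.intro cochain_complex.intro wang_axioms.intro)
  show "subspace (invariant_forms U K k)" for k by (rule subspace_invariant_forms[OF U])
  show "linear (\<lambda>\<omega>. \<mu> *\<^sub>R pull h \<omega>)" by (rule linear_T)
  fix k x
  assume x: "x \<in> invariant_forms U K k"
  note x' = invariant_forms_diff_forms[OF x]
  show "ext_deriv U (x + y) = ext_deriv U x + ext_deriv U y" if "y \<in> invariant_forms U K k" for y
    by (rule ext_deriv_add[OF x' invariant_forms_diff_forms[OF that]])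
  show "ext_deriv U (r *\<^sub>R x) = r *\<^sub>R ext_deriv U x" for r by (rule ext_deriv_scale[OF x'])
  show "ext_deriv U x \<in> invariant_forms U K (Suc k)"
  proof -
    have "pull g (ext_deriv U x) = ext_deriv U x" if "g \<in> K" for g
      using ext_deriv_pull[OF U K_affine[OF that] K_dom[OF that] x'] invariant_forms_pull[OF x that] by simp
    then show ?thesis using ext_deriv_in_diff_forms[OF U x'] by (simp add: invariant_forms_def)
  qed
  show "ext_deriv U (ext_deriv U x) = 0" by (rule ext_deriv_ext_deriv[OF U x'])
  show "\<mu> *\<^sub>R pull h x \<in> invariant_forms U K k"
    by (rule subspace_scale[OF subspace_invariant_forms[OF U] h_in[OF x]])
  show "\<mu> *\<^sub>R pull h (ext_deriv U x) = ext_deriv U (\<mu> *\<^sub>R pull h x)"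
    using ext_deriv_pull[OF U h_affine(1) h_dom x']
      ext_deriv_scale[OF invariant_forms_diff_forms[OF h_in[OF x]], of \<mu>] by simp
  show "\<exists>\<gamma>\<in>invariant_forms U K k. \<mu> *\<^sub>R pull h \<gamma> - \<gamma> = x"
    by (rule transfer_equation[where U=U and K=K and h=h and h'=h' and l=l],
        rule U, rule h_affine, rule h_affine, rule h_inverse, rule h_inverse, rule h_dom, rule \<mu>,
        erule K_dom, erule h_in, erule h'_in, rule l_smooth, erule l_h, erule (1) l_K, rule x)
qed

lemma fixed_eq_invariant_forms: "\<mu> = 1 \<Longrightarrow> fixed = invariant_forms U (insert h K)"
  unfolding fixed_def[abs_def] by (auto simp: invariant_forms_def)

lemma mult_in: "s \<in> invariant_forms U K k \<Longrightarrow> fun_mult l s \<in> invariant_forms U K k"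
  by (rule fun_mult_in_invariant_forms[where K=K, OF U l_smooth]) (rule l_K)

lemma T_fun_mult:
  assumes s: "s \<in> invariant_forms U K k" and "T s = s"
  shows "T (fun_mult l s) - fun_mult l s = s"
proof -
  have "T (fun_mult l s) x vs = (l x + 1) * s x vs" for x vs
  proof (cases "x \<in> U")
    case True
    have "T (fun_mult l s) x vs = l (h x) * T s x vs" by (simp add: pull_fun_mult)
    then show ?thesis using True assms(2) l_h by metis
  next
    case False
    have "T s x vs = 0" using False diff_forms_zero[OF invariant_forms_diff_forms[OF s]] assms(2) by metis
    then show ?thesis
      using False diff_forms_zero[OF invariant_forms_diff_forms[OF s]] \<mu> by (simp add: pull_fun_mult)
  qed
  then show ?thesis by (simp add: fun_eq_iff algebra_simps)
qed

lemma T_eigen_span: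
  assumes "\<And>b. b \<in> B \<Longrightarrow> T b = \<beta> *\<^sub>R b" "b \<in> span B"
  shows "T b = \<beta> *\<^sub>R b"
  using linear_eq_on_span[OF linear_T linear_scale_self, of B \<beta> b] assms by simp

text \<open>Every degree is treated with a single \<open>T\<close>-invariant class \<open>s\<close> in the degree below;
  \<open>s = 0\<close> is allowed.\<close>

theorem represents_step:
  assumes rep: "represents_cohomology (invariant_forms U K) (ext_deriv U) k (span (insert s B))"
    and s: "T s = s" and B: "\<And>b. b \<in> B \<Longrightarrow> T b = \<beta> *\<^sub>R b" "\<beta> \<noteq> 1"
    and rep': "represents_cohomology (invariant_forms U K) (ext_deriv U) (Suc k) (span (A' \<union> B'))"
    and A': "\<And>a. a \<in> A' \<Longrightarrow> T a = a" and B': "\<And>b. b \<in> B' \<Longrightarrow> T b = \<beta>' *\<^sub>R b" "\<beta>' \<noteq> 1"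
  shows "represents_cohomology fixed (ext_deriv U) (Suc k) (span (insert (ext_deriv U (fun_mult l s)) A'))"
proof -
  have sum_eq: "span (A \<union> B) = {a + b | a b. a \<in> span A \<and> b \<in> span B}" for A B :: "'a form set"
    by (auto simp: span_Un)
  have ins: "insert s B = {s} \<union> B" by simp
  have sC: "s \<in> invariant_forms U K k"
    by (rule represents_cohomologyD(2)[OF rep]) (simp add: span_base)
  have fix1: "T a = a" if "a \<in> span {s}" for a
    using T_eigen_span[of "{s}" 1 a] s that by simp
  have fix2: "T a = a" if "a \<in> span A'" for a
    using T_eigen_span[of A' 1 a] A' that by simp
  have spanC: "a \<in> invariant_forms U K k" if "a \<in> span {s}" for a
    using that sC subspace_scale[OF sub] by (auto simp: span_singleton)
  have lin: "linear (fun_mult l)" by (intro linearI) (auto simp: fun_eq_iff algebra_simps)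
  let ?y = "ext_deriv U (fun_mult l s)"
  have "represents_cohomology fixed (ext_deriv U) (Suc k)
      {a' + ext_deriv U (fun_mult l a) | a' a. a' \<in> span A' \<and> a \<in> span {s}}"
  proof (rule represents_cohomology_fixed_Suc_eigen[where m="fun_mult l" and B="span B" and B'="span B'" and \<beta>=\<beta> and \<beta>'=\<beta>'])
    show "represents_cohomology (invariant_forms U K) (ext_deriv U) k {a + b |a b. a \<in> span {s} \<and> b \<in> span B}"
      using rep unfolding ins sum_eq .
    show "represents_cohomology (invariant_forms U K) (ext_deriv U) (Suc k) {a + b |a b. a \<in> span A' \<and> b \<in> span B'}"
      using rep' unfolding sum_eq .
    show "T b = \<beta> *\<^sub>R b" if "b \<in> span B" for b by (rule T_eigen_span[OF B(1) that])
    show "T b = \<beta>' *\<^sub>R b" if "b \<in> span B'" for b by (rule T_eigen_span[OF B'(1) that])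
    show "fun_mult l a \<in> invariant_forms U K k" if "a \<in> span {s}" for a by (rule mult_in[OF spanC[OF that]])
    show "T (fun_mult l a) - fun_mult l a = a" if "a \<in> span {s}" for a
      by (rule T_fun_mult[OF spanC[OF that] fix1[OF that]])
  qed (use B(2) B'(2) fix1 fix2 lin in auto)
  note result = this
  have "ext_deriv U (fun_mult l (r *\<^sub>R s)) = r *\<^sub>R ?y" for r
    using d_scale[OF mult_in[OF sC], of r] linear_cmul[OF lin, of r s] by simp
  then have "{a' + ext_deriv U (fun_mult l a) | a' a. a' \<in> span A' \<and> a \<in> span {s}}
      = {a' + r *\<^sub>R ?y | a' r. a' \<in> span A'}"
    unfolding span_singleton by (intro Collect_cong) (metis (no_types, lifting) image_iff UNIV_I)
  also have "\<dots> = span (insert ?y A')"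
    by (auto simp: span_insert) (metis add_diff_cancel_right' diff_add_cancel)+
  finally show ?thesis using result by simp
qed

theorem represents_step_0:
  assumes rep: "represents_cohomology (invariant_forms U K) (ext_deriv U) 0 (span (A \<union> B))"
    and A: "\<And>a. a \<in> A \<Longrightarrow> T a = a" and B: "\<And>b. b \<in> B \<Longrightarrow> T b = \<beta> *\<^sub>R b" "\<beta> \<noteq> 1"
  shows "represents_cohomology fixed (ext_deriv U) 0 (span A)"
proof (rule represents_cohomology_fixed_0_eigen[where B="span B" and \<beta>=\<beta>])
  have "span (A \<union> B) = {a + b | a b. a \<in> span A \<and> b \<in> span B}" by (auto simp: span_Un)
  then show "represents_cohomology (invariant_forms U K) (ext_deriv U) 0 {a + b |a b. a \<in> span A \<and> b \<in> span B}"
    using rep by simp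
  show "T a = a" if "a \<in> span A" for a using T_eigen_span[of A 1 a] A that by simp
  show "T b = \<beta> *\<^sub>R b" if "b \<in> span B" for b by (rule T_eigen_span[OF B(1) that])
qed (use B(2) in auto)

end

section \<open>The deck transformations\<close>

definition heis :: "real \<Rightarrow> real \<Rightarrow> real \<Rightarrow> R4 \<Rightarrow> R4" where
  "heis A B C = (\<lambda>(x, y, w, t). (x + B * w + C, y + B * t, w + A, t))"

definition dil :: "real \<Rightarrow> R4 \<Rightarrow> R4" where
  "dil s = (\<lambda>(x, y, w, t). (x, y, s * w, s * t))"

lemma heis_compose: "heis A B C \<circ> heis A' B' C' = heis (A + A') (B + B') (C + C' + B * A')"
  by (auto simp: heis_def fun_eq_iff algebra_simps)

lemma heis_0: "heis 0 0 0 = id"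
  by (auto simp: heis_def fun_eq_iff)

lemma dil_compose: "dil s \<circ> dil s' = dil (s * s')" "dil 1 = id"
  by (auto simp: dil_def fun_eq_iff)

lemma dil_heis: "s \<noteq> 0 \<Longrightarrow> dil s \<circ> heis A B C = heis (s * A) (B / s) C \<circ> dil s"
  by (auto simp: dil_def heis_def fun_eq_iff algebra_simps)

lemma affine_heis: "affine_map (heis A B C)"
  unfolding affine_map_def heis_def
  by (rule linearI) (auto simp: algebra_simps zero_prod_def split: prod.splits)

lemma affine_dil: "affine_map (dil s)"
  unfolding affine_map_def dil_def
  by (rule linearI) (auto simp: algebra_simps zero_prod_def split: prod.splits)

lemma heis_in_cover: "heis A B C p \<in> inoue_cover \<longleftrightarrow> p \<in> inoue_cover"
  by (auto simp: heis_def inoue_cover_def split: prod.splits)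

lemma dil_in_cover: "s > 0 \<Longrightarrow> dil s p \<in> inoue_cover \<longleftrightarrow> p \<in> inoue_cover"
  by (auto simp: dil_def inoue_cover_def zero_less_mult_iff split: prod.splits)

abbreviation "x_of p \<equiv> fst (p :: R4)"
abbreviation "y_of p \<equiv> fst (snd (p :: R4))"
abbreviation "w_of p \<equiv> fst (snd (snd (p :: R4)))"
abbreviation "t_of p \<equiv> snd (snd (snd (p :: R4)))"

lemma inoue_cover_eq: "inoue_cover = {p. t_of p > 0}"
  by (auto simp: inoue_cover_def)

lemma bounded_linear_coordinates:
  "bounded_linear (\<lambda>p. x_of p)" "bounded_linear (\<lambda>p. y_of p)"
  "bounded_linear (\<lambda>p. w_of p)" "bounded_linear (\<lambda>p. t_of p)"
  by (intro bounded_linear_fst bounded_linear_snd bounded_linear_compose[OF bounded_linear_fst]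
      bounded_linear_compose[OF bounded_linear_snd])+

lemma open_inoue_cover: "open inoue_cover"
  unfolding inoue_cover_eq by (intro open_Collect_less continuous_intros)

lemma convex_inoue_cover: "convex inoue_cover"
proof -
  have "convex ((\<lambda>p. t_of p) -` {0<..})"
    by (rule convex_linear_vimage[OF bounded_linear.linear[OF bounded_linear_coordinates(4)]])
       (rule convex_real_interval)
  moreover have "(\<lambda>p. t_of p) -` {0<..} = inoue_cover" by (auto simp: inoue_cover_eq)
  ultimately show ?thesis by simp
qed

interpretation cover: convex_open inoue_cover "(0, 0, 0, 1)"
  by standard (rule open_inoue_cover, rule convex_inoue_cover, simp add: inoue_cover_def)

abbreviation dR :: "R4 form \<Rightarrow> R4 form" where "dR \<equiv> ext_deriv inoue_cover"

definition df :: "(R4 \<Rightarrow> real) \<Rightarrow> R4 form" where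
  "df f = dR (fun_form inoue_cover f)"

abbreviation one_form0 :: "R4 form" where "one_form0 \<equiv> fun_form inoue_cover (\<lambda>_. 1)"

lemma fun_form_cong: "(\<And>x. x \<in> U \<Longrightarrow> f x = g x) \<Longrightarrow> fun_form U f = fun_form U g"
  by (auto simp: fun_form_def fun_eq_iff)

lemma df_cong: "(\<And>x. x \<in> inoue_cover \<Longrightarrow> f x = g x) \<Longrightarrow> df f = df g"
  unfolding df_def using fun_form_cong by metis

lemma df_in: "smooth_on inoue_cover f \<Longrightarrow> df f \<in> diff_forms inoue_cover (Suc 0)"
  unfolding df_def by (intro ext_deriv_in_diff_forms fun_form_in_diff_forms open_inoue_cover)

lemma dR_df: "smooth_on inoue_cover f \<Longrightarrow> dR (df f) = 0"
  unfolding df_def by (rule ext_deriv_ext_deriv[OF open_inoue_cover fun_form_in_diff_forms[OF open_inoue_cover]])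

lemma df_apply: "p \<in> inoue_cover \<Longrightarrow> df f p [v] = frechet_derivative f (at p) v"
  unfolding df_def by (rule ext_deriv_fun_form[OF open_inoue_cover])

lemma df_eval: "(f has_derivative D) (at p) \<Longrightarrow> p \<in> inoue_cover \<Longrightarrow> df f p [v] = D v"
  by (simp add: df_apply frechet_derivativeI)

lemma df_has_derivative:
  assumes "smooth_on inoue_cover f" "p \<in> inoue_cover"
  shows "(f has_derivative (\<lambda>v. df f p [v])) (at p)"
  using smooth_on_has_derivative[OF assms] assms(2) by (simp add: df_apply)

lemma one_form_eqI:
  assumes "\<eta> \<in> diff_forms U (Suc 0)" "\<eta>' \<in> diff_forms U (Suc 0)"
    and "\<And>x v. x \<in> U \<Longrightarrow> \<eta> x [v] = \<eta>' x [v]"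
  shows "\<eta> = \<eta>'"
proof (intro ext)
  fix x vs
  show "\<eta> x vs = \<eta>' x vs"
  proof (cases "x \<in> U \<and> length vs = Suc 0")
    case True
    then obtain v where "vs = [v]" by (auto simp: length_Suc_conv)
    then show ?thesis using assms(3) True by simp
  next
    case False
    then show ?thesis using diff_forms_zero[OF assms(1)] diff_forms_zero[OF assms(2)] by simp
  qed
qed

lemma pull_df:
  assumes "affine_map g" "\<And>x. g x \<in> inoue_cover \<longleftrightarrow> x \<in> inoue_cover" "smooth_on inoue_cover f"
  shows "pull g (df f) = df (f \<circ> g)"
  unfolding df_def
  by (simp add: pull_fun_form[OF assms(2)]
      flip: ext_deriv_pull[OF open_inoue_cover assms(1,2) fun_form_in_diff_forms[OF open_inoue_cover assms(3)]])

lemma df_fun_mult: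
  assumes "smooth_on inoue_cover f" "\<beta> \<in> diff_forms inoue_cover k"
  shows "dR (fun_mult f \<beta>) = wedge1 (df f) \<beta> + fun_mult f (dR \<beta>)"
  unfolding df_def by (rule ext_deriv_fun_mult[OF open_inoue_cover assms])

text \<open>For \<open>h\<close> normalising the group generated by \<open>K\<close>; \<open>g'\<close> is the conjugate of \<open>g\<close>.\<close>

lemma pull_invariant_forms:
  assumes \<omega>: "\<omega> \<in> invariant_forms U K k" and U: "open U"
    and h: "affine_map h" "\<And>x. h x \<in> U \<longleftrightarrow> x \<in> U"
    and conj: "\<And>g. g \<in> K \<Longrightarrow> \<exists>g'. affine_map g' \<and> pull g' \<omega> = \<omega> \<and> h \<circ> g = g' \<circ> h"
  shows "pull h \<omega> \<in> invariant_forms U K k"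
proof -
  have "pull g (pull h \<omega>) = pull h \<omega>" if g: "g \<in> K" for g
  proof -
    obtain g' where "affine_map g'" "pull g' \<omega> = \<omega>" "h \<circ> g = g' \<circ> h" using conj[OF g] by blast
    then show ?thesis by (metis pull_compose h(1))
  qed
  then show ?thesis
    using pull_in_diff_forms[OF U h invariant_forms_diff_forms[OF \<omega>]] by (simp add: invariant_forms_def)
qed

text \<open>The data of an Inoue surface in scalar form, with the translation length \<open>\<kappa>\<close> of \<open>g\<^sub>3\<close> and the
  quadratic part \<open>Q\<close> of the \<open>x\<close>-component of a word in \<open>g\<^sub>1, g\<^sub>2\<close>; \<open>Q n\<^sub>i\<^sub>1 n\<^sub>i\<^sub>2\<close> is the number \<open>e\<^sub>i\<close>.\<close>

locale inoue_data =
  fixes \<alpha> a1 a2 b1 b2 c1 c2 \<kappa> :: real and n11 n12 n21 n22 p q r :: int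
    and Q :: "int \<Rightarrow> int \<Rightarrow> real"
  defines "\<kappa> \<equiv> (b1 * a2 - b2 * a1) / of_int r"
    and "Q \<equiv> \<lambda>m n. 1/2 * of_int m * (of_int m - 1) * a1 * b1
                + 1/2 * of_int n * (of_int n - 1) * a2 * b2 + of_int m * of_int n * b1 * a2"
  assumes alpha: "\<alpha> > 1" and det: "n11 * n22 - n12 * n21 = 1"
    and a: "of_int n11 * a1 + of_int n12 * a2 = \<alpha> * a1" "of_int n21 * a1 + of_int n22 * a2 = \<alpha> * a2"
    and b: "of_int n11 * b1 + of_int n12 * b2 = b1 / \<alpha>" "of_int n21 * b1 + of_int n22 * b2 = b2 / \<alpha>"
    and delta: "b1 * a2 - b2 * a1 \<noteq> 0" and r: "r \<noteq> 0"
    and c: "c1 = of_int n11 * c1 + of_int n12 * c2 + Q n11 n12 + \<kappa> * of_int p"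
           "c2 = of_int n21 * c1 + of_int n22 * c2 + Q n21 n22 + \<kappa> * of_int q"
begin

lemma kappa: "\<kappa> \<noteq> 0" "\<kappa> * of_int r = b1 * a2 - b2 * a1"
  using delta r by (auto simp: \<kappa>_def)

text \<open>The word \<open>g\<^sub>1 ^ m1 \<circ> g\<^sub>2 ^ m2 \<circ> g\<^sub>3 ^ m3\<close>. These maps form a lattice in the Heisenberg
  group of all \<open>heis A B C\<close>.\<close>

definition lat :: "int \<Rightarrow> int \<Rightarrow> int \<Rightarrow> R4 \<Rightarrow> R4" where
  "lat m1 m2 m3 = heis (of_int m1 * a1 + of_int m2 * a2) (of_int m1 * b1 + of_int m2 * b2)
     (of_int m1 * c1 + of_int m2 * c2 + Q m1 m2 + \<kappa> * of_int m3)"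

lemma heis_cong: "A = A' \<Longrightarrow> B = B' \<Longrightarrow> C = C' \<Longrightarrow> heis A B C = heis A' B' C'"
  by simp

text \<open>The commutator of \<open>g\<^sub>1\<close> and \<open>g\<^sub>2\<close> is the translation of \<open>x\<close> by \<open>b\<^sub>1 a\<^sub>2 - b\<^sub>2 a\<^sub>1 = \<kappa> r\<close>, hence the
  correction by \<open>r\<close> in the exponent of \<open>g\<^sub>3\<close>.\<close>

lemma lat_compose: "lat m1 m2 m3 \<circ> lat m1' m2' m3' = lat (m1 + m1') (m2 + m2') (m3 + m3' - r * m2 * m1')"
  unfolding lat_def heis_compose
proof (rule heis_cong)
  have "\<kappa> * of_int (m3 + m3' - r * m2 * m1') = \<kappa> * of_int m3 + \<kappa> * of_int m3' - (\<kappa> * of_int r) * of_int m2 * of_int m1'"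
    by (simp add: algebra_simps)
  then have eq: "\<kappa> * of_int (m3 + m3' - r * m2 * m1') = \<kappa> * of_int m3 + \<kappa> * of_int m3' - (b1 * a2 - b2 * a1) * of_int m2 * of_int m1'"
    by (simp only: kappa(2))
  show "of_int m1 * c1 + of_int m2 * c2 + Q m1 m2 + \<kappa> * of_int m3
      + (of_int m1' * c1 + of_int m2' * c2 + Q m1' m2' + \<kappa> * of_int m3')
      + (of_int m1 * b1 + of_int m2 * b2) * (of_int m1' * a1 + of_int m2' * a2)
     = of_int (m1 + m1') * c1 + of_int (m2 + m2') * c2 + Q (m1 + m1') (m2 + m2')
      + \<kappa> * of_int (m3 + m3' - r * m2 * m1')"
    unfolding eq Q_def by (simp add: field_simps)
qed (simp_all add: algebra_simps)

lemma lat_0: "lat 0 0 0 = id"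
  by (simp add: lat_def Q_def heis_0)

lemma lat_inverse: "lat m1 m2 m3 \<circ> lat (- m1) (- m2) (- m3 - r * m2 * m1) = id"
  "lat (- m1) (- m2) (- m3 - r * m2 * m1) \<circ> lat m1 m2 m3 = id"
  by (simp_all add: lat_compose lat_0)

lemma affine_lat: "affine_map (lat m1 m2 m3)"
  by (simp add: lat_def affine_heis)

lemma lat_in_cover: "lat m1 m2 m3 x \<in> inoue_cover \<longleftrightarrow> x \<in> inoue_cover"
  by (simp add: lat_def heis_in_cover)

lemma int_step_induct:
  assumes "P (0::int)" "\<And>m. P m \<longleftrightarrow> P (m + 1)" shows "P m"
  by (induction m rule: int_induct[where k=0]) (use assms(1) assms(2) assms(2)[of "_ - 1"] in auto)

lemma pull_powers:
  fixes f :: "int \<Rightarrow> R4 \<Rightarrow> R4"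
  assumes "affine_map (f 1)" "f 0 = id" "\<And>m. f 1 \<circ> f m = f (m + 1)" "pull (f 1) \<omega> = \<omega>"
  shows "pull (f m) \<omega> = \<omega>"
proof (induction m rule: int_step_induct)
  case (2 m)
  have "pull (f (m + 1)) \<omega> = pull (f m) \<omega>" using pull_compose[OF assms(1), of "f m" \<omega>] assms(3,4) by simp
  then show ?case by (simp only:)
qed (simp add: assms(2))

lemma pull_lat_power:
  shows "pull (lat 1 0 0) \<omega> = \<omega> \<Longrightarrow> pull (lat m 0 0) \<omega> = \<omega>"
    and "pull (lat 0 1 0) \<omega> = \<omega> \<Longrightarrow> pull (lat 0 m 0) \<omega> = \<omega>"
    and "pull (lat 0 0 1) \<omega> = \<omega> \<Longrightarrow> pull (lat 0 0 m) \<omega> = \<omega>"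
  using pull_powers[of "\<lambda>m. lat m 0 0" \<omega> m] pull_powers[of "\<lambda>m. lat 0 m 0" \<omega> m]
    pull_powers[of "\<lambda>m. lat 0 0 m" \<omega> m]
  by (simp_all add: affine_lat lat_0 lat_compose add.commute)

lemma pull_lat_13:
  assumes "pull (lat 1 0 0) \<omega> = \<omega>" "pull (lat 0 0 1) \<omega> = \<omega>"
  shows "pull (lat m1 0 m3) \<omega> = \<omega>"
proof -
  have "lat m1 0 m3 = lat m1 0 0 \<circ> lat 0 0 m3" by (simp add: lat_compose)
  then show ?thesis using pull_lat_power[of \<omega>] assms pull_compose[OF affine_lat] by metis
qed

lemma pull_lat:
  assumes "pull (lat 1 0 0) \<omega> = \<omega>" "pull (lat 0 1 0) \<omega> = \<omega>" "pull (lat 0 0 1) \<omega> = \<omega>"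
  shows "pull (lat m1 m2 m3) \<omega> = \<omega>"
proof -
  have "lat m1 m2 m3 = lat m1 0 m3 \<circ> lat 0 m2 0" by (simp add: lat_compose)
  then show ?thesis using pull_lat_power[of \<omega>] pull_lat_13[OF assms(1,3)] assms pull_compose[OF affine_lat] by metis
qed

definition lattice :: "(R4 \<Rightarrow> R4) set" where
  "lattice = {lat m1 m2 m3 | m1 m2 m3. True}"

lemma lat_in_lattice: "lat m1 m2 m3 \<in> lattice"
  unfolding lattice_def by blast

lemma lattice_compose: "g \<in> lattice \<Longrightarrow> g' \<in> lattice \<Longrightarrow> g \<circ> g' \<in> lattice"
  using lat_compose unfolding lattice_def by blast

lemma lattice_inverse: "g \<in> lattice \<Longrightarrow> \<exists>g'\<in>lattice. g \<circ> g' = id \<and> g' \<circ> g = id"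
  using lat_inverse unfolding lattice_def by blast

text \<open>Moving \<open>s\<close> past an element is compatible with compositions and inverses, so that the generators
  suffice.\<close>

lemma conj_closed:
  assumes g: "\<exists>g'\<in>lattice. s \<circ> lat 1 0 0 = g' \<circ> s" "\<exists>g'\<in>lattice. s \<circ> lat 0 1 0 = g' \<circ> s"
    "\<exists>g'\<in>lattice. s \<circ> lat 0 0 1 = g' \<circ> s" and "h \<in> lattice"
  shows "\<exists>g'\<in>lattice. s \<circ> h = g' \<circ> s"
proof -
  let ?P = "\<lambda>h. \<exists>g'\<in>lattice. s \<circ> h = g' \<circ> s"
  have comp: "?P (h \<circ> h')" if P: "?P h" "?P h'" for h h'
  proof -
    obtain g g' where g: "g \<in> lattice" "g' \<in> lattice" "s \<circ> h = g \<circ> s" "s \<circ> h' = g' \<circ> s" using P by blast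
    then have "s \<circ> (h \<circ> h') = (g \<circ> g') \<circ> s" by (metis comp_assoc)
    then show ?thesis using lattice_compose[OF g(1,2)] by blast
  qed
  have inv: "?P h'" if P: "?P h" and hh: "h \<circ> h' = id" for h h'
  proof -
    obtain g where g: "g \<in> lattice" "s \<circ> h = g \<circ> s" using P by blast
    obtain g' where g': "g' \<in> lattice" "g' \<circ> g = id" using lattice_inverse[OF g(1)] by blast
    have "s \<circ> h' = g' \<circ> (g \<circ> s) \<circ> h'" using g'(2) by (simp add: comp_assoc[symmetric])
    also have "\<dots> = g' \<circ> s" using hh by (simp add: g(2)[symmetric] comp_assoc)
    finally show ?thesis using g'(1) by blast
  qed
  have pow: "?P (f m)" if f: "?P (f 1)" "f 0 = id" "\<And>m n. f m \<circ> f n = f (m + n)" for f and m :: int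
  proof (induction m rule: int_induct[where k=0])
    case base
    have "s \<circ> id = lat 0 0 0 \<circ> s" by (simp add: lat_0)
    then show ?case unfolding f(2) using lat_in_lattice by blast
  next
    case (step1 i)
    show ?case using comp[OF step1(2) f(1)] unfolding f(3) .
  next
    case (step2 i)
    have "?P (f (- 1))" by (rule inv[OF f(1)]) (use f(3)[of 1 "-1"] f(2) in simp)
    from comp[OF step2(2) this] show ?case by (simp only: f(3) add_uminus_conv_diff)
  qed
  obtain m1 m2 m3 where h: "h = lat m1 m2 m3" using assms(4) unfolding lattice_def by blast
  have "h = lat m1 0 0 \<circ> (lat 0 m2 0 \<circ> lat 0 0 m3)" by (simp add: h lat_compose)
  moreover have "?P (lat m1 0 0)"
    by (rule pow[of "\<lambda>m. lat m 0 0"]) (use g in \<open>simp_all add: lat_0 lat_compose\<close>)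
  moreover have "?P (lat 0 m2 0)"
    by (rule pow[of "\<lambda>m. lat 0 m 0"]) (use g in \<open>simp_all add: lat_0 lat_compose\<close>)
  moreover have "?P (lat 0 0 m3)"
    by (rule pow[of "\<lambda>m. lat 0 0 m"]) (use g in \<open>simp_all add: lat_0 lat_compose\<close>)
  ultimately show ?thesis using comp by simp
qed

lemma dil_comm_center: "s \<noteq> 0 \<Longrightarrow> dil s \<circ> lat 0 0 m = lat 0 0 m \<circ> dil s"
  by (simp add: lat_def dil_heis)

text \<open>Since \<open>N\<close> has the eigenvectors \<open>a\<close> and \<open>b\<close>, conjugation by \<open>g\<^sub>0\<close> sends \<open>g\<^sub>i\<close> to
  \<open>g\<^sub>1 ^ n\<^sub>i\<^sub>1 \<circ> g\<^sub>2 ^ n\<^sub>i\<^sub>2\<close> up to a translation of \<open>x\<close>; the defining equation of \<open>c\<close> says that this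
  translation is a power of \<open>g\<^sub>3\<close>.\<close>

lemma dil_conj_lattice:
  assumes "g \<in> lattice" shows "\<exists>g'\<in>lattice. dil \<alpha> \<circ> g = g' \<circ> dil \<alpha>"
proof (rule conj_closed[OF _ _ _ assms])
  have \<alpha>: "\<alpha> \<noteq> 0" using alpha by simp
  have "dil \<alpha> \<circ> lat 1 0 0 = lat n11 n12 p \<circ> dil \<alpha>"
    using a(1) b(1) c(1) by (simp add: lat_def dil_heis[OF \<alpha>] Q_def mult.commute)
  then show "\<exists>g'\<in>lattice. dil \<alpha> \<circ> lat 1 0 0 = g' \<circ> dil \<alpha>" using lat_in_lattice by blast
  have "dil \<alpha> \<circ> lat 0 1 0 = lat n21 n22 q \<circ> dil \<alpha>"
    using a(2) b(2) c(2) by (simp add: lat_def dil_heis[OF \<alpha>] Q_def mult.commute)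
  then show "\<exists>g'\<in>lattice. dil \<alpha> \<circ> lat 0 1 0 = g' \<circ> dil \<alpha>" using lat_in_lattice by blast
  show "\<exists>g'\<in>lattice. dil \<alpha> \<circ> lat 0 0 1 = g' \<circ> dil \<alpha>"
    using dil_comm_center[OF \<alpha>] lat_in_lattice by blast
qed

lemma heis_inject: "heis A B C = heis A' B' C' \<longleftrightarrow> A = A' \<and> B = B' \<and> C = C'"
proof
  assume "heis A B C = heis A' B' C'"
  then have "heis A B C (0, 0, 0, 1) = heis A' B' C' (0, 0, 0, 1)" by simp
  then show "A = A' \<and> B = B' \<and> C = C'" by (simp add: heis_def)
qed simp

lemma lattice_coordinates:
  assumes "u1 * a1 + u2 * a2 = v1 * a1 + v2 * a2" "u1 * b1 + u2 * b2 = v1 * b1 + v2 * b2"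
  shows "u1 = v1" "u2 = v2"
proof -
  have "(b1 * a2 - b2 * a1) * (u1 - v1) = a2 * (u1 * b1 + u2 * b2 - (v1 * b1 + v2 * b2)) - b2 * (u1 * a1 + u2 * a2 - (v1 * a1 + v2 * a2))"
    by (simp add: algebra_simps)
  then show "u1 = v1" using assms delta by simp
  have "(b1 * a2 - b2 * a1) * (u2 - v2) = b1 * (u1 * a1 + u2 * a2 - (v1 * a1 + v2 * a2)) - a1 * (u1 * b1 + u2 * b2 - (v1 * b1 + v2 * b2))"
    by (simp add: algebra_simps)
  then show "u2 = v2" using assms delta by simp
qed

text \<open>Conjugation by the inverse of \<open>g\<^sub>0\<close>: a word that \<open>g\<^sub>0\<close> conjugates to \<open>lat k1 k2 j3\<close> is found from the
  \<open>w\<close>- and \<open>y\<close>-components alone, and the exponent \<open>j3\<close>, which is not controlled, is removed by a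
  power of the central element \<open>g\<^sub>3\<close>.\<close>

lemma dil_inverse_conj_generator:
  assumes "of_int m1 * (\<alpha> * a1) + of_int m2 * (\<alpha> * a2) = of_int k1 * a1 + of_int k2 * a2"
    "of_int m1 * (b1 / \<alpha>) + of_int m2 * (b2 / \<alpha>) = of_int k1 * b1 + of_int k2 * b2"
  shows "\<exists>g'\<in>lattice. dil (1 / \<alpha>) \<circ> lat k1 k2 0 = g' \<circ> dil (1 / \<alpha>)"
proof -
  have \<alpha>: "\<alpha> \<noteq> 0" using alpha by simp
  obtain j1 j2 j3 where j: "dil \<alpha> \<circ> lat m1 m2 0 = lat j1 j2 j3 \<circ> dil \<alpha>"
    using dil_conj_lattice[OF lat_in_lattice] unfolding lattice_def by blast
  have cancel: "dil \<alpha> \<circ> dil (1 / \<alpha>) = id" "dil (1 / \<alpha>) \<circ> dil \<alpha> = id" using \<alpha> by (simp_all add: dil_compose)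
  let ?g = "heis (\<alpha> * (of_int m1 * a1 + of_int m2 * a2)) ((of_int m1 * b1 + of_int m2 * b2) / \<alpha>)
     (of_int m1 * c1 + of_int m2 * c2 + Q m1 m2 + \<kappa> * of_int 0)"
  have "?g \<circ> dil \<alpha> = lat j1 j2 j3 \<circ> dil \<alpha>" using j by (simp add: lat_def[of m1] dil_heis[OF \<alpha>])
  then have "(?g \<circ> dil \<alpha>) \<circ> dil (1 / \<alpha>) = (lat j1 j2 j3 \<circ> dil \<alpha>) \<circ> dil (1 / \<alpha>)" by simp
  then have "?g = lat j1 j2 j3" by (simp only: comp_assoc cancel comp_id)
  then have "\<alpha> * (of_int m1 * a1 + of_int m2 * a2) = of_int j1 * a1 + of_int j2 * a2"
    "(of_int m1 * b1 + of_int m2 * b2) / \<alpha> = of_int j1 * b1 + of_int j2 * b2"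
    by (simp_all only: lat_def heis_inject)
  then have "of_int k1 * a1 + of_int k2 * a2 = of_int j1 * a1 + of_int j2 * a2"
    "of_int k1 * b1 + of_int k2 * b2 = of_int j1 * b1 + of_int j2 * b2"
    using assms by (simp_all add: algebra_simps add_divide_distrib)
  from lattice_coordinates[OF this] have jk: "j1 = k1" "j2 = k2" by simp_all
  have "lat k1 k2 0 = lat k1 k2 j3 \<circ> lat 0 0 (- j3)" by (simp add: lat_compose)
  then have "dil (1 / \<alpha>) \<circ> lat k1 k2 0 = dil (1 / \<alpha>) \<circ> lat k1 k2 j3 \<circ> (dil \<alpha> \<circ> dil (1 / \<alpha>)) \<circ> lat 0 0 (- j3)"
    by (simp add: cancel comp_assoc)
  also have "\<dots> = dil (1 / \<alpha>) \<circ> (lat k1 k2 j3 \<circ> dil \<alpha>) \<circ> (dil (1 / \<alpha>) \<circ> lat 0 0 (- j3))"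
    by (simp add: comp_assoc)
  also have "\<dots> = (dil (1 / \<alpha>) \<circ> dil \<alpha>) \<circ> lat m1 m2 0 \<circ> (lat 0 0 (- j3) \<circ> dil (1 / \<alpha>))"
    using dil_comm_center[of "1 / \<alpha>" "- j3"] \<alpha> by (simp add: j[unfolded jk, symmetric] comp_assoc)
  also have "\<dots> = (lat m1 m2 0 \<circ> lat 0 0 (- j3)) \<circ> dil (1 / \<alpha>)" by (simp add: cancel comp_assoc)
  finally show ?thesis using lattice_compose[OF lat_in_lattice lat_in_lattice] by blast
qed

text \<open>The words for \<open>g\<^sub>1\<close> and \<open>g\<^sub>2\<close> are the rows of the inverse of \<open>N\<close>, which is integral as \<open>det N = 1\<close>.\<close>

lemma dil_inverse_conj_lattice:
  assumes "g \<in> lattice" shows "\<exists>g'\<in>lattice. dil (1 / \<alpha>) \<circ> g = g' \<circ> dil (1 / \<alpha>)"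
proof (rule conj_closed[OF _ _ _ assms])
  have \<alpha>: "\<alpha> \<noteq> 0" using alpha by simp
  have det': "of_int n11 * of_int n22 - of_int n12 * of_int n21 = (1::real)"
    using det by (metis of_int_1 of_int_diff of_int_mult)
  have inv1: "of_int n22 * (of_int n11 * x + of_int n12 * y) + of_int (- n12) * (of_int n21 * x + of_int n22 * y) = x"
    and inv2: "of_int (- n21) * (of_int n11 * x + of_int n12 * y) + of_int n11 * (of_int n21 * x + of_int n22 * y) = y" for x y :: real
  proof -
    have "of_int n22 * (of_int n11 * x + of_int n12 * y) + of_int (- n12) * (of_int n21 * x + of_int n22 * y)
        = (of_int n11 * of_int n22 - of_int n12 * of_int n21) * x" by (simp add: algebra_simps)
    then show "of_int n22 * (of_int n11 * x + of_int n12 * y) + of_int (- n12) * (of_int n21 * x + of_int n22 * y) = x"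
      by (simp add: det')
    have "of_int (- n21) * (of_int n11 * x + of_int n12 * y) + of_int n11 * (of_int n21 * x + of_int n22 * y)
        = (of_int n11 * of_int n22 - of_int n12 * of_int n21) * y" by (simp add: algebra_simps)
    then show "of_int (- n21) * (of_int n11 * x + of_int n12 * y) + of_int n11 * (of_int n21 * x + of_int n22 * y) = y"
      by (simp add: det')
  qed
  show "\<exists>g'\<in>lattice. dil (1 / \<alpha>) \<circ> lat 1 0 0 = g' \<circ> dil (1 / \<alpha>)"
    by (rule dil_inverse_conj_generator[of n22 "- n12"])
       (use inv1[of a1 a2] inv1[of b1 b2] in \<open>simp_all add: a b\<close>)
  show "\<exists>g'\<in>lattice. dil (1 / \<alpha>) \<circ> lat 0 1 0 = g' \<circ> dil (1 / \<alpha>)"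
    by (rule dil_inverse_conj_generator[of "- n21" n11])
       (use inv2[of a1 a2] inv2[of b1 b2] in \<open>simp_all add: a b\<close>)
  show "\<exists>g'\<in>lattice. dil (1 / \<alpha>) \<circ> lat 0 0 1 = g' \<circ> dil (1 / \<alpha>)"
    using dil_comm_center[of "1 / \<alpha>" 1] \<alpha> lat_in_lattice by auto
qed

end

section \<open>Coordinates adapted to the group\<close>

lemma smooth_coordinates [simp]:
  "smooth_on inoue_cover (\<lambda>p. x_of p)" "smooth_on inoue_cover (\<lambda>p. y_of p)"
  "smooth_on inoue_cover (\<lambda>p. w_of p)" "smooth_on inoue_cover (\<lambda>p. t_of p)"
  by (intro smooth_on_bounded_linear open_inoue_cover bounded_linear_coordinates)+

lemma df_add:
  assumes "smooth_on inoue_cover f" "smooth_on inoue_cover g"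
  shows "df (\<lambda>p. f p + g p) = df f + df g"
proof (rule one_form_eqI)
  show "df f + df g \<in> diff_forms inoue_cover (Suc 0)"
    by (intro subspace_add[OF subspace_diff_forms[OF open_inoue_cover]] df_in assms)
  show "df (\<lambda>p. f p + g p) p [v] = (df f + df g) p [v]" if "p \<in> inoue_cover" for p v
    using df_eval[OF has_derivative_add[OF df_has_derivative[OF assms(1) that] df_has_derivative[OF assms(2) that]] that]
    by simp
qed (intro df_in smooth_on_add assms open_inoue_cover)

lemma df_mult:
  assumes "smooth_on inoue_cover f" "smooth_on inoue_cover g"
  shows "df (\<lambda>p. f p * g p) = fun_mult f (df g) + fun_mult g (df f)"
proof (rule one_form_eqI)
  show "fun_mult f (df g) + fun_mult g (df f) \<in> diff_forms inoue_cover (Suc 0)"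
    by (intro subspace_add[OF subspace_diff_forms[OF open_inoue_cover]] fun_mult_in_diff_forms open_inoue_cover df_in assms)
  show "df (\<lambda>p. f p * g p) p [v] = (fun_mult f (df g) + fun_mult g (df f)) p [v]" if "p \<in> inoue_cover" for p v
    using df_eval[OF has_derivative_mult[OF df_has_derivative[OF assms(1) that] df_has_derivative[OF assms(2) that]] that]
    by (simp add: mult.commute)
qed (intro df_in smooth_on_mult assms open_inoue_cover)

lemma df_const: "df (\<lambda>p. r) = 0"
proof (rule one_form_eqI)
  show "df (\<lambda>p. r) p [v] = 0 p [v]" if "p \<in> inoue_cover" for p v
    using df_eval[OF has_derivative_const that] by simp
qed (auto intro: df_in subspace_0[OF subspace_diff_forms] simp: open_inoue_cover)

lemma df_scale: "smooth_on inoue_cover f \<Longrightarrow> df (\<lambda>p. r * f p) = r *\<^sub>R df f"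
  by (subst df_mult) (auto simp: open_inoue_cover df_const fun_eq_iff)

lemma df_add_const: "smooth_on inoue_cover f \<Longrightarrow> df (\<lambda>p. f p + r) = df f"
  by (subst df_add) (auto simp: open_inoue_cover df_const)

lemma wedge1_one_form0: "\<eta> \<in> diff_forms inoue_cover (Suc 0) \<Longrightarrow> wedge1 \<eta> one_form0 = \<eta>"
proof (rule one_form_eqI)
  assume \<eta>: "\<eta> \<in> diff_forms inoue_cover (Suc 0)"
  then show "wedge1 \<eta> one_form0 \<in> diff_forms inoue_cover (Suc 0)"
    by (intro wedge1_in_diff_forms open_inoue_cover fun_form_in_diff_forms smooth_on_const)
qed (auto simp: wedge1_alt_sum fun_form_def)

lemma wedge1_self: "\<eta> \<in> diff_forms inoue_cover (Suc 0) \<Longrightarrow> wedge1 \<eta> \<eta> = 0"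
  using wedge1_wedge1_self[of \<eta> one_form0] by (simp add: wedge1_one_form0)

lemma dR_fun_mult_df:
  assumes "smooth_on inoue_cover f" "smooth_on inoue_cover g"
  shows "dR (fun_mult f (df g)) = wedge1 (df f) (df g)"
  using df_fun_mult[OF assms(1) df_in[OF assms(2)]] dR_df[OF assms(2)] by (simp add: fun_eq_iff)

text \<open>With \<open>u = y / t\<close>, the group generated by \<open>g\<^sub>1, g\<^sub>2, g\<^sub>3\<close> acts on the pair \<open>(u, w)\<close> by translations and
  preserves \<open>\<zeta> = dx - u dw\<close>, the left-invariant contact form of the Heisenberg group.\<close>

definition u_of :: "R4 \<Rightarrow> real" where "u_of p = y_of p / t_of p"

definition zeta :: "R4 form" where
  "zeta = df (\<lambda>p. x_of p) - fun_mult u_of (df (\<lambda>p. w_of p))"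

lemma smooth_u_of [simp]: "smooth_on inoue_cover u_of"
  unfolding u_of_def[abs_def]
  by (intro smooth_on_divide open_inoue_cover smooth_coordinates) (simp add: inoue_cover_eq)

lemma zeta_in: "zeta \<in> diff_forms inoue_cover (Suc 0)"
  unfolding zeta_def
  by (intro subspace_diff[OF subspace_diff_forms[OF open_inoue_cover]] fun_mult_in_diff_forms
      open_inoue_cover df_in smooth_coordinates smooth_u_of)

lemma u_of_heis: "p \<in> inoue_cover \<Longrightarrow> u_of (heis A B C p) = u_of p + B"
  by (cases p) (auto simp: u_of_def heis_def inoue_cover_def field_simps)

lemma w_of_heis: "w_of (heis A B C p) = w_of p + A"
  by (cases p) (auto simp: heis_def)

lemma x_of_heis: "x_of (heis A B C p) = x_of p + B * w_of p + C"
  by (cases p) (auto simp: heis_def)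

lemma pull_dil_df:
  assumes "s > 0"
  shows "pull (dil s) (df u_of) = (1 / s) *\<^sub>R df u_of" "pull (dil s) (df (\<lambda>p. w_of p)) = s *\<^sub>R df (\<lambda>p. w_of p)"
    "pull (dil s) zeta = zeta"
proof -
  note pull = pull_df[OF affine_dil dil_in_cover[OF assms]]
  have "pull (dil s) (df u_of) = df (\<lambda>p. (1 / s) * u_of p)"
    unfolding pull[OF smooth_u_of] using assms by (intro df_cong) (auto simp: u_of_def dil_def split: prod.splits)
  then show u: "pull (dil s) (df u_of) = (1 / s) *\<^sub>R df u_of" by (simp only: df_scale[OF smooth_u_of])
  have "pull (dil s) (df (\<lambda>p. w_of p)) = df (\<lambda>p. s * w_of p)"
    unfolding pull[OF smooth_coordinates(3)] by (intro df_cong) (auto simp: dil_def split: prod.splits)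
  then show w: "pull (dil s) (df (\<lambda>p. w_of p)) = s *\<^sub>R df (\<lambda>p. w_of p)" by (simp only: df_scale[OF smooth_coordinates(3)])
  have x: "pull (dil s) (df (\<lambda>p. x_of p)) = df (\<lambda>p. x_of p)"
    unfolding pull[OF smooth_coordinates(1)] by (intro df_cong) (auto simp: dil_def split: prod.splits)
  have "fun_mult (u_of \<circ> dil s) (s *\<^sub>R \<beta>) = fun_mult u_of \<beta>" for \<beta>
    using assms by (auto simp: fun_eq_iff u_of_def dil_def split: prod.splits)
  then show "pull (dil s) zeta = zeta"
    unfolding zeta_def linear_diff[OF linear_pull] pull_fun_mult x w by simp
qed

context inoue_data
begin

abbreviation \<delta> :: real where "\<delta> \<equiv> b1 * a2 - b2 * a1"

text \<open>Linear coordinates on the \<open>(u, w)\<close>-plane in which \<open>g\<^sub>1\<close> and \<open>g\<^sub>2\<close> are the unit translations.\<close>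

definition l1 :: "R4 \<Rightarrow> real" where "l1 z = (a2 * u_of z - b2 * w_of z) / \<delta>"
definition l2 :: "R4 \<Rightarrow> real" where "l2 z = (b1 * w_of z - a1 * u_of z) / \<delta>"

text \<open>The form \<open>\<zeta>\<close> is not closed, but \<open>\<zeta> - \<delta> l\<^sub>2 dl\<^sub>1\<close> is. This function is a primitive of it, divided by
  \<open>\<kappa>\<close> so that \<open>g\<^sub>3\<close> shifts it by \<open>1\<close>. Its differential is invariant under \<open>g\<^sub>1\<close> and \<open>g\<^sub>3\<close>, but
  \<open>g\<^sub>2\<close> adds \<open>- r dl\<^sub>1\<close> to it.\<close>

definition F :: "R4 \<Rightarrow> real" where
  "F z = (x_of z - 1/2 * a1 * b1 * (l1 z)\<^sup>2 - 1/2 * a2 * b2 * (l2 z)\<^sup>2 - b1 * a2 * l1 z * l2 z) / \<kappa>"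

lemma w_u_eq: "w_of z = a1 * l1 z + a2 * l2 z" "u_of z = b1 * l1 z + b2 * l2 z"
proof -
  have "a1 * l1 z + a2 * l2 z = (\<delta> * w_of z) / \<delta>"
    unfolding l1_def l2_def by (simp add: add_divide_distrib[symmetric] algebra_simps)
  then show "w_of z = a1 * l1 z + a2 * l2 z" using delta by simp
  have "b1 * l1 z + b2 * l2 z = (\<delta> * u_of z) / \<delta>"
    unfolding l1_def l2_def by (simp add: add_divide_distrib[symmetric] algebra_simps)
  then show "u_of z = b1 * l1 z + b2 * l2 z" using delta by simp
qed

lemma smooth_l [simp]: "smooth_on inoue_cover l1" "smooth_on inoue_cover l2"
  unfolding l1_def[abs_def] l2_def[abs_def] divide_inverse
  by (intro smooth_on_mult smooth_on_diff smooth_on_const open_inoue_cover smooth_coordinates smooth_u_of)+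

lemma smooth_F [simp]: "smooth_on inoue_cover F"
  unfolding F_def[abs_def] divide_inverse power2_eq_square
  by (intro smooth_on_mult smooth_on_diff smooth_on_const open_inoue_cover smooth_coordinates smooth_l)

lemma l_lat:
  assumes "x \<in> inoue_cover"
  shows "l1 (lat m1 m2 m3 x) = l1 x + of_int m1" "l2 (lat m1 m2 m3 x) = l2 x + of_int m2"
proof -
  have "u_of (lat m1 m2 m3 x) = u_of x + (of_int m1 * b1 + of_int m2 * b2)"
    "w_of (lat m1 m2 m3 x) = w_of x + (of_int m1 * a1 + of_int m2 * a2)"
    by (simp_all add: lat_def u_of_heis[OF assms] w_of_heis)
  then have "b1 * l1 (lat m1 m2 m3 x) + b2 * l2 (lat m1 m2 m3 x) = b1 * (l1 x + of_int m1) + b2 * (l2 x + of_int m2)"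
    "a1 * l1 (lat m1 m2 m3 x) + a2 * l2 (lat m1 m2 m3 x) = a1 * (l1 x + of_int m1) + a2 * (l2 x + of_int m2)"
    by (simp_all add: w_u_eq algebra_simps)
  then show "l1 (lat m1 m2 m3 x) = l1 x + of_int m1" "l2 (lat m1 m2 m3 x) = l2 x + of_int m2"
    using lattice_coordinates[of "l1 (lat m1 m2 m3 x)" "l2 (lat m1 m2 m3 x)" "l1 x + of_int m1" "l2 x + of_int m2"]
    by (simp_all add: mult.commute)
qed

lemma F_lat:
  assumes "x \<in> inoue_cover"
  shows "F (lat 0 0 m x) = F x + of_int m"
    "F (lat 1 0 0 x) = F x + (c1 - 1/2 * a1 * b1) / \<kappa>"
    "F (lat 0 1 0 x) = F x - of_int r * l1 x + (c2 - 1/2 * a2 * b2) / \<kappa>"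
proof -
  have x: "x_of (lat 0 0 m x) = x_of x + \<kappa> * of_int m"
    "x_of (lat 1 0 0 x) = x_of x + b1 * (a1 * l1 x + a2 * l2 x) + c1"
    "x_of (lat 0 1 0 x) = x_of x + b2 * (a1 * l1 x + a2 * l2 x) + c2"
    by (simp_all add: lat_def x_of_heis Q_def flip: w_u_eq)
  have \<kappa>F: "\<kappa> * F y = x_of y - 1/2 * a1 * b1 * (l1 y)\<^sup>2 - 1/2 * a2 * b2 * (l2 y)\<^sup>2 - b1 * a2 * l1 y * l2 y" for y
    using kappa(1) by (simp add: F_def)
  have cancel: "y = z" if "\<kappa> * y = \<kappa> * z" for y z using that kappa(1) by simp
  have div: "\<kappa> * (y / \<kappa>) = y" for y using kappa(1) by simp
  show "F (lat 0 0 m x) = F x + of_int m"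
    by (rule cancel) (simp only: \<kappa>F x distrib_left l_lat[OF assms] of_int_0 add_0_right, simp?)
  show "F (lat 1 0 0 x) = F x + (c1 - 1/2 * a1 * b1) / \<kappa>"
    by (rule cancel) (simp only: \<kappa>F x distrib_left l_lat[OF assms] of_int_0 add_0_right of_int_1 div,
        simp add: power2_eq_square algebra_simps)
  have rhs: "\<kappa> * (F x - of_int r * l1 x + (c2 - 1/2 * a2 * b2) / \<kappa>) = \<kappa> * F x - \<delta> * l1 x + (c2 - 1/2 * a2 * b2)"
    by (simp only: distrib_left right_diff_distrib div mult.assoc[symmetric] kappa(2))
  show "F (lat 0 1 0 x) = F x - of_int r * l1 x + (c2 - 1/2 * a2 * b2) / \<kappa>"
    by (rule cancel, unfold rhs) (simp only: \<kappa>F x l_lat[OF assms] of_int_0 add_0_right of_int_1,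
        simp add: power2_eq_square algebra_simps)
qed

lemmas pull_lat_df = pull_df[OF affine_lat lat_in_cover]

lemma pull_lat_dl:
  "pull (lat m1 m2 m3) (df l1) = df l1" "pull (lat m1 m2 m3) (df l2) = df l2"
proof -
  have "df (l1 \<circ> lat m1 m2 m3) = df (\<lambda>z. l1 z + of_int m1)" "df (l2 \<circ> lat m1 m2 m3) = df (\<lambda>z. l2 z + of_int m2)"
    by (rule df_cong; simp add: l_lat)+
  then show "pull (lat m1 m2 m3) (df l1) = df l1" "pull (lat m1 m2 m3) (df l2) = df l2"
    by (simp_all add: pull_lat_df df_add_const)
qed

lemma pull_lat_dF:
  "pull (lat 0 0 m) (df F) = df F" "pull (lat 1 0 0) (df F) = df F"
  "pull (lat 0 1 0) (df F) = df F - of_int r *\<^sub>R df l1"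
proof -
  have "df (F \<circ> lat 0 0 m) = df (\<lambda>z. F z + of_int m)" by (rule df_cong) (simp add: F_lat)
  then show "pull (lat 0 0 m) (df F) = df F" by (simp add: pull_lat_df df_add_const)
  have "df (F \<circ> lat 1 0 0) = df (\<lambda>z. F z + (c1 - 1/2 * a1 * b1) / \<kappa>)" by (rule df_cong) (simp add: F_lat)
  then show "pull (lat 1 0 0) (df F) = df F" by (simp add: pull_lat_df df_add_const)
  let ?c = "(c2 - 1/2 * a2 * b2) / \<kappa>"
  have "df (F \<circ> lat 0 1 0) = df (\<lambda>z. (F z + (- of_int r) * l1 z) + ?c)"
    by (rule df_cong) (simp add: F_lat)
  also have "\<dots> = df F + (- of_int r) *\<^sub>R df l1"
  proof -
    have s: "smooth_on inoue_cover (\<lambda>z. (- of_int r) * l1 z)"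
      by (intro smooth_on_mult smooth_on_const open_inoue_cover smooth_l)
    show ?thesis
      by (simp only: df_add_const[OF smooth_on_add[OF open_inoue_cover smooth_F s]] df_add[OF smooth_F s] df_scale[OF smooth_l(1)])
  qed
  finally show "pull (lat 0 1 0) (df F) = df F - of_int r *\<^sub>R df l1" by (simp add: pull_lat_df)
qed

lemma dw_du_eq:
  "df (\<lambda>z. w_of z) = a1 *\<^sub>R df l1 + a2 *\<^sub>R df l2" "df u_of = b1 *\<^sub>R df l1 + b2 *\<^sub>R df l2"
proof -
  have "df (\<lambda>z. a * l1 z + b * l2 z) = a *\<^sub>R df l1 + b *\<^sub>R df l2" for a b
  proof -
    have "smooth_on inoue_cover (\<lambda>z. a * l1 z)" "smooth_on inoue_cover (\<lambda>z. b * l2 z)"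
      by (intro smooth_on_mult smooth_on_const open_inoue_cover smooth_l)+
    then show ?thesis by (simp add: df_add df_scale)
  qed
  moreover have "(\<lambda>z. w_of z) = (\<lambda>z. a1 * l1 z + a2 * l2 z)" "u_of = (\<lambda>z. b1 * l1 z + b2 * l2 z)"
    using w_u_eq by (auto simp: fun_eq_iff)
  ultimately show "df (\<lambda>z. w_of z) = a1 *\<^sub>R df l1 + a2 *\<^sub>R df l2" "df u_of = b1 *\<^sub>R df l1 + b2 *\<^sub>R df l2"
    by metis+
qed

lemma zeta_eq: "zeta = \<kappa> *\<^sub>R (df F + of_int r *\<^sub>R fun_mult l2 (df l1))"
proof (rule one_form_eqI[OF zeta_in])
  show "\<kappa> *\<^sub>R (df F + of_int r *\<^sub>R fun_mult l2 (df l1)) \<in> diff_forms inoue_cover (Suc 0)"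
    by (intro subspace_scale subspace_add subspace_diff_forms open_inoue_cover df_in fun_mult_in_diff_forms smooth_F smooth_l)
  fix z v assume z: "z \<in> inoue_cover"
  let ?x = "df (\<lambda>z. x_of z) z [v]" and ?d1 = "df l1 z [v]" and ?d2 = "df l2 z [v]"
  note hd = df_has_derivative[OF smooth_coordinates(1) z] df_has_derivative[OF smooth_l(1) z] df_has_derivative[OF smooth_l(2) z]
  let ?D = "\<lambda>v. df (\<lambda>z. x_of z) z [v] - a1 * b1 * l1 z * df l1 z [v] - a2 * b2 * l2 z * df l2 z [v]
        - b1 * a2 * (l1 z * df l2 z [v] + l2 z * df l1 z [v])"
  have "(F has_derivative (\<lambda>v. ?D v / \<kappa>)) (at z)"
  proof -
    have "((\<lambda>z. x_of z - 1/2 * a1 * b1 * (l1 z * l1 z) - 1/2 * a2 * b2 * (l2 z * l2 z) - b1 * a2 * (l1 z * l2 z))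
        has_derivative ?D) (at z)"
      by (rule has_derivative_eq_rhs[OF has_derivative_diff[OF has_derivative_diff[OF has_derivative_diff[OF hd(1)
          has_derivative_mult_right[OF has_derivative_mult[OF hd(2) hd(2)]]] has_derivative_mult_right[OF has_derivative_mult[OF hd(3) hd(3)]]]
          has_derivative_mult_right[OF has_derivative_mult[OF hd(2) hd(3)]]]])
         (simp add: fun_eq_iff algebra_simps)
    from has_derivative_mult_left[OF this, of "inverse \<kappa>"] show ?thesis
      unfolding F_def[abs_def] divide_inverse power2_eq_square by (simp only: mult.assoc)
  qed
  from df_eval[OF this z, of v] have "\<kappa> * df F z [v] = ?D v" using kappa(1) by simp
  moreover have "\<kappa> * (of_int r * (l2 z * ?d1)) = \<delta> * (l2 z * ?d1)" by (simp only: mult.assoc[symmetric] kappa(2))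
  moreover have "zeta z [v] = ?x - (b1 * l1 z + b2 * l2 z) * (a1 * ?d1 + a2 * ?d2)"
    by (simp add: zeta_def dw_du_eq(1) w_u_eq(2)[of z])
  ultimately show "zeta z [v] = (\<kappa> *\<^sub>R (df F + of_int r *\<^sub>R fun_mult l2 (df l1))) z [v]"
    by (simp add: algebra_simps)
qed

end

section \<open>The cohomology of the tower of covers\<close>

abbreviation represents :: "(R4 \<Rightarrow> R4) set \<Rightarrow> nat \<Rightarrow> R4 form set \<Rightarrow> bool" where
  "represents K \<equiv> represents_cohomology (invariant_forms inoue_cover K) dR"

lemma one_form0_in: "one_form0 \<in> diff_forms inoue_cover 0"
  by (intro fun_form_in_diff_forms open_inoue_cover smooth_on_const)

lemma pull_one_form0: "(\<And>x. g x \<in> inoue_cover \<longleftrightarrow> x \<in> inoue_cover) \<Longrightarrow> pull g one_form0 = one_form0"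
  by (simp add: pull_fun_form o_def)

lemma dR_one_form0: "dR one_form0 = 0"
  using df_const[of 1] by (simp add: df_def)

lemma dR_0: "dR 0 = 0"
  using ext_deriv_scale[OF one_form0_in, of 0] by simp

lemma fun_mult_0 [simp]: "fun_mult f 0 = 0"
  by (simp add: fun_eq_iff)

lemma fun_mult_one_form0: "fun_mult f one_form0 = fun_form inoue_cover f"
  by (auto simp: fun_form_def fun_eq_iff)

lemma represents_cover:
  "represents {} 0 (span {one_form0})" "represents {} (Suc k) (span {})"
proof -
  have inv: "invariant_forms inoue_cover {} k = diff_forms inoue_cover k" for k
    by (simp add: invariant_forms_def)
  have span1: "span {one_form0} = {r *\<^sub>R one_form0 | r. True}" by (auto simp: span_singleton)
  have closed1: "r *\<^sub>R one_form0 \<in> diff_forms inoue_cover 0 \<and> dR (r *\<^sub>R one_form0) = 0" for r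
    using subspace_scale[OF subspace_diff_forms[OF open_inoue_cover] one_form0_in, of r]
      ext_deriv_scale[OF one_form0_in, of r] by (simp add: dR_one_form0)
  have const: "\<exists>p\<in>span {one_form0}. z - p \<in> {0}" if z: "z \<in> diff_forms inoue_cover 0" "dR z = 0" for z
  proof -
    obtain r where "z = r *\<^sub>R one_form0" using cover.closed_0_form_const[OF z] by blast
    then have "z \<in> span {one_form0}" "z - z \<in> {0}" unfolding span1 by auto
    then show ?thesis by blast
  qed
  have "span {one_form0} \<subseteq> {x \<in> diff_forms inoue_cover 0. dR x = 0}" unfolding span1 using closed1 by blast
  then show "represents {} 0 (span {one_form0})"
    unfolding represents_cohomology_def closed_part_def exact_part_def inv nat.case
    using const by (intro conjI subspace_span ballI) auto
  have "z - 0 \<in> dR ` diff_forms inoue_cover k" if z: "z \<in> diff_forms inoue_cover (Suc k)" "dR z = 0" for z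
  proof -
    obtain y where "y \<in> diff_forms inoue_cover k" "dR y = z" using cover.poincare_lemma[OF z] by blast
    then show ?thesis unfolding diff_zero by blast
  qed
  moreover have "0 \<in> {x \<in> diff_forms inoue_cover (Suc k). dR x = 0}"
    using subspace_0[OF subspace_diff_forms[OF open_inoue_cover]] dR_0 by blast
  ultimately show "represents {} (Suc k) (span {})"
    unfolding represents_cohomology_def closed_part_def exact_part_def inv nat.case span_empty
    by (intro conjI subspace_single_0 ballI) auto
qed

context inoue_data
begin

abbreviation "g1 \<equiv> lat 1 0 0"
abbreviation "g2 \<equiv> lat 0 1 0"
abbreviation "g3 \<equiv> lat 0 0 1"

lemma lat_commute_closed:
  assumes "\<omega> \<in> invariant_forms inoue_cover K k"
    and "\<And>g. g \<in> K \<Longrightarrow> \<exists>g'. affine_map g' \<and> pull g' \<omega> = \<omega> \<and> lat m1 m2 m3 \<circ> g = g' \<circ> lat m1 m2 m3"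
  shows "pull (lat m1 m2 m3) \<omega> \<in> invariant_forms inoue_cover K k"
  using pull_invariant_forms[OF assms(1) open_inoue_cover affine_lat lat_in_cover] assms(2) by blast

text \<open>Powers of \<open>g\<^sub>2\<close> commute with \<open>g\<^sub>1\<close> up to powers of \<open>g\<^sub>3\<close>.\<close>

lemma g2_closed:
  assumes \<omega>: "\<omega> \<in> invariant_forms inoue_cover {g1, g3} k"
  shows "pull (lat 0 m 0) \<omega> \<in> invariant_forms inoue_cover {g1, g3} k"
proof (rule lat_commute_closed[OF \<omega>])
  have inv: "pull (lat m1 0 m3) \<omega> = \<omega>" for m1 m3
    by (rule pull_lat_13) (use \<omega> in \<open>auto simp: invariant_forms_def\<close>)
  have "lat 0 m 0 \<circ> g1 = lat 1 0 (- r * m) \<circ> lat 0 m 0" "lat 0 m 0 \<circ> g3 = lat 0 0 1 \<circ> lat 0 m 0"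
    by (simp_all add: lat_compose)
  then show "\<exists>g'. affine_map g' \<and> pull g' \<omega> = \<omega> \<and> lat 0 m 0 \<circ> g = g' \<circ> lat 0 m 0" if "g \<in> {g1, g3}" for g
    using that inv affine_lat by blast
qed

lemma pull_lattice:
  assumes "\<omega> \<in> invariant_forms inoue_cover {g2, g1, g3} k" "g \<in> lattice"
  shows "pull g \<omega> = \<omega>" "affine_map g"
  using pull_lat[of \<omega>] affine_lat assms by (auto simp: invariant_forms_def lattice_def)

lemma dil_closed:
  assumes \<omega>: "\<omega> \<in> invariant_forms inoue_cover {g2, g1, g3} k"
  shows "pull (dil \<alpha>) \<omega> \<in> invariant_forms inoue_cover {g2, g1, g3} k"
    "pull (dil (1 / \<alpha>)) \<omega> \<in> invariant_forms inoue_cover {g2, g1, g3} k"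
proof -
  have gens: "g \<in> lattice" if "g \<in> {g2, g1, g3}" for g using that lat_in_lattice by auto
  show "pull (dil \<alpha>) \<omega> \<in> invariant_forms inoue_cover {g2, g1, g3} k"
  proof (rule pull_invariant_forms[OF \<omega> open_inoue_cover affine_dil dil_in_cover])
    show "\<exists>g'. affine_map g' \<and> pull g' \<omega> = \<omega> \<and> dil \<alpha> \<circ> g = g' \<circ> dil \<alpha>" if "g \<in> {g2, g1, g3}" for g
      using dil_conj_lattice[OF gens[OF that]] pull_lattice[OF \<omega>] by blast
  qed (use alpha in simp)
  show "pull (dil (1 / \<alpha>)) \<omega> \<in> invariant_forms inoue_cover {g2, g1, g3} k"
  proof (rule pull_invariant_forms[OF \<omega> open_inoue_cover affine_dil dil_in_cover])
    show "\<exists>g'. affine_map g' \<and> pull g' \<omega> = \<omega> \<and> dil (1 / \<alpha>) \<circ> g = g' \<circ> dil (1 / \<alpha>)" if "g \<in> {g2, g1, g3}" for g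
      using dil_inverse_conj_lattice[OF gens[OF that]] pull_lattice[OF \<omega>] by blast
  qed (use alpha in simp)
qed

text \<open>The coordinate of the base circle: \<open>g\<^sub>0\<close> shifts it by \<open>1\<close>.\<close>

definition s_of :: "R4 \<Rightarrow> real" where "s_of z = ln (t_of z) / ln \<alpha>"

lemma ln_alpha: "ln \<alpha> > 0"
  using alpha by simp

lemma smooth_s_of [simp]: "smooth_on inoue_cover s_of"
  unfolding s_of_def[abs_def] divide_inverse
  by (intro smooth_on_mult smooth_on_ln smooth_on_const open_inoue_cover smooth_coordinates) (simp add: inoue_cover_eq)

lemma s_of_lat: "s_of (lat m1 m2 m3 x) = s_of x"
  by (cases x) (simp add: s_of_def lat_def heis_def)

lemma s_of_dil: "x \<in> inoue_cover \<Longrightarrow> s_of (dil \<alpha> x) = s_of x + 1"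
  using alpha ln_alpha by (cases x) (auto simp: s_of_def dil_def inoue_cover_def ln_mult add_divide_distrib)

lemma lat_inverse_generators:
  "g1 \<circ> lat (- 1) 0 0 = id" "lat (- 1) 0 0 \<circ> g1 = id" "g2 \<circ> lat 0 (- 1) 0 = id" "lat 0 (- 1) 0 \<circ> g2 = id"
  "g3 \<circ> lat 0 0 (- 1) = id" "lat 0 0 (- 1) \<circ> g3 = id"
  by (simp_all add: lat_compose lat_0)

text \<open>The tower adds \<open>g\<^sub>3\<close>, \<open>g\<^sub>1\<close>, \<open>g\<^sub>2\<close> and \<open>g\<^sub>0\<close>, in this order, so that every generator normalises the group
  below it. The factor \<open>\<alpha>\<close> in the last storey is the monodromy of the local system of \<open>\<theta>\<close>.\<close>

sublocale L1: deck_step inoue_cover "{}" g3 "lat 0 0 (- 1)" 1 F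
proof unfold_locales
  fix \<omega> k assume "\<omega> \<in> invariant_forms inoue_cover {} k"
  then show "pull g3 \<omega> \<in> invariant_forms inoue_cover {} k" "pull (lat 0 0 (- 1)) \<omega> \<in> invariant_forms inoue_cover {} k"
    using pull_in_diff_forms[OF open_inoue_cover affine_lat lat_in_cover] by (auto simp: invariant_forms_def)
qed (simp_all add: open_inoue_cover affine_lat lat_in_cover lat_inverse_generators F_lat)

sublocale L2: deck_step inoue_cover "{g3}" g1 "lat (- 1) 0 0" 1 l1
proof unfold_locales
  fix \<omega> k assume \<omega>: "\<omega> \<in> invariant_forms inoue_cover {g3} k"
  have "\<exists>g'. affine_map g' \<and> pull g' \<omega> = \<omega> \<and> lat m 0 0 \<circ> g = g' \<circ> lat m 0 0" if "g \<in> {g3}" for g m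
    using that \<omega> affine_lat by (intro exI[of _ g3]) (auto simp: invariant_forms_def lat_compose)
  then show "pull g1 \<omega> \<in> invariant_forms inoue_cover {g3} k" "pull (lat (- 1) 0 0) \<omega> \<in> invariant_forms inoue_cover {g3} k"
    by (intro lat_commute_closed[OF \<omega>]; blast)+
qed (auto simp: open_inoue_cover affine_lat lat_in_cover lat_inverse_generators l_lat)

sublocale L3: deck_step inoue_cover "{g1, g3}" g2 "lat 0 (- 1) 0" 1 l2
  by unfold_locales
    (auto simp: open_inoue_cover affine_lat lat_in_cover lat_inverse_generators l_lat intro: g2_closed[simplified])

sublocale L4: deck_step inoue_cover "{g2, g1, g3}" "dil \<alpha>" "dil (1 / \<alpha>)" \<alpha> s_of
  using alpha dil_closed
  by unfold_locales
    (auto simp: open_inoue_cover affine_lat affine_dil lat_in_cover dil_in_cover dil_compose s_of_lat s_of_dil)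

text \<open>The quotient by \<open>g\<^sub>3\<close> has the cohomology of a circle.\<close>

lemma represents_1:
  "represents {g3} 0 (span {one_form0})" "represents {g3} 1 (span {df F})" "represents {g3} (Suc (Suc k)) (span {})"
proof -
  note [simp] = dR_0 lat_in_cover
  show "represents {g3} 0 (span {one_form0})"
    using L1.represents_step_0[unfolded L1.fixed_eq_invariant_forms[OF refl], where A="{one_form0}" and B="{}" and \<beta>=2] represents_cover(1)
    by (simp add: pull_one_form0)
  show "represents {g3} 1 (span {df F})"
    using L1.represents_step[unfolded L1.fixed_eq_invariant_forms[OF refl],
        where k=0 and s=one_form0 and B="{}" and A'="{}" and B'="{}" and \<beta>=2 and \<beta>'=2] represents_cover
    by (simp add: pull_one_form0 fun_mult_one_form0 flip: df_def)
  show "represents {g3} (Suc (Suc k)) (span {})"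
    using L1.represents_step[unfolded L1.fixed_eq_invariant_forms[OF refl],
        where k="Suc k" and s=0 and B="{}" and A'="{}" and B'="{}" and \<beta>=2 and \<beta>'=2] represents_cover
    by (simp add: span_insert_0 linear_0[OF linear_pull])
qed

text \<open>This is \<open>dl\<^sub>1 \<and> dF\<close>, written as an exact form on the cover.\<close>

definition E1 :: "R4 form" where "E1 = dR (fun_mult l1 (df F))"

text \<open>The quotient by \<open>g\<^sub>1, g\<^sub>3\<close> has the cohomology of a torus. As \<open>dF\<close> and \<open>dl\<^sub>1\<close> are invariant, both
  eigenvalues involved are \<open>1\<close>.\<close>

lemma represents_2:
  "represents {g1, g3} 0 (span {one_form0})" "represents {g1, g3} 1 (span {df l1, df F})"
  "represents {g1, g3} 2 (span {E1})" "represents {g1, g3} (Suc (Suc (Suc k))) (span {})"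
proof -
  note [simp] = dR_0 lat_in_cover pull_lat_dF
  show "represents {g1, g3} 0 (span {one_form0})"
    using L2.represents_step_0[unfolded L2.fixed_eq_invariant_forms[OF refl], where A="{one_form0}" and B="{}" and \<beta>=2] represents_1(1)
    by (simp add: pull_one_form0)
  show "represents {g1, g3} 1 (span {df l1, df F})"
    using L2.represents_step[unfolded L2.fixed_eq_invariant_forms[OF refl],
        where k=0 and s=one_form0 and B="{}" and A'="{df F}" and B'="{}" and \<beta>=2 and \<beta>'=2] represents_1
    by (simp add: pull_one_form0 fun_mult_one_form0 flip: df_def)
  show "represents {g1, g3} 2 (span {E1})"
    using L2.represents_step[unfolded L2.fixed_eq_invariant_forms[OF refl],
        where k=1 and s="df F" and B="{}" and A'="{}" and B'="{}" and \<beta>=2 and \<beta>'=2]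
      represents_1(2) represents_1(3)[of 0]
    by (simp add: E1_def numeral_2_eq_2)
  show "represents {g1, g3} (Suc (Suc (Suc k))) (span {})"
    using L2.represents_step[unfolded L2.fixed_eq_invariant_forms[OF refl],
        where k="Suc (Suc k)" and s=0 and B="{}" and A'="{}" and B'="{}" and \<beta>=2 and \<beta>'=2] represents_1(3)
    by (simp add: span_insert_0 linear_0[OF linear_pull])
qed

end

text \<open>Linear independence of the representatives is read off at one point, where \<open>dx, dy, dw, dt\<close> have
  simple relations to the invariant forms.\<close>

abbreviation base_point :: R4 where "base_point \<equiv> (0, 0, 0, 1)"

lemma base_point_in: "base_point \<in> inoue_cover"
  by (simp add: inoue_cover_def)

lemma base_point_eval:
  "df (\<lambda>p. x_of p) base_point [v] = x_of v" "df (\<lambda>p. w_of p) base_point [v] = w_of v"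
  "df u_of base_point [v] = y_of v" "zeta base_point [v] = x_of v"
proof -
  show x: "df (\<lambda>p. x_of p) base_point [v] = x_of v" and w: "df (\<lambda>p. w_of p) base_point [v] = w_of v"
    by (rule df_eval[OF bounded_linear_imp_has_derivative[OF bounded_linear_coordinates(1)] base_point_in],
        rule df_eval[OF bounded_linear_imp_has_derivative[OF bounded_linear_coordinates(3)] base_point_in])
  have "((\<lambda>p. y_of p / t_of p) has_derivative
      (\<lambda>h. - y_of base_point * (inverse (t_of base_point) * t_of h * inverse (t_of base_point)) + y_of h / t_of base_point)) (at base_point)"
    by (rule has_derivative_divide[OF bounded_linear_imp_has_derivative[OF bounded_linear_coordinates(2)]
          bounded_linear_imp_has_derivative[OF bounded_linear_coordinates(4)]]) simp
  then have "(u_of has_derivative (\<lambda>h. y_of h)) (at base_point)"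
    unfolding u_of_def[abs_def] by simp
  from df_eval[OF this base_point_in] show "df u_of base_point [v] = y_of v" .
  show "zeta base_point [v] = x_of v" by (simp add: zeta_def x u_of_def)
qed

lemma span_pair_eq:
  fixes x y :: "'v::real_vector"
  assumes "u = b1 *\<^sub>R x + b2 *\<^sub>R y" "w = a1 *\<^sub>R x + a2 *\<^sub>R y" and d: "b1 * a2 - b2 * a1 \<noteq> (0::real)"
  shows "span {u, w} = span {x, y}"
proof (rule span_eq[THEN iffD2], intro conjI subsetI)
  have "b1 *\<^sub>R x + b2 *\<^sub>R y \<in> span {x, y}" "a1 *\<^sub>R x + a2 *\<^sub>R y \<in> span {x, y}"
    by (intro span_add span_scale span_base; simp)+
  then show "v \<in> span {x, y}" if "v \<in> {u, w}" for v using that assms(1,2) by auto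
next
  let ?d = "b1 * a2 - b2 * a1"
  have "?d *\<^sub>R x = a2 *\<^sub>R u - b2 *\<^sub>R w" "?d *\<^sub>R y = b1 *\<^sub>R w - a1 *\<^sub>R u"
    unfolding assms(1,2) by (simp_all add: algebra_simps)
  then have "x = inverse ?d *\<^sub>R (a2 *\<^sub>R u - b2 *\<^sub>R w)" "y = inverse ?d *\<^sub>R (b1 *\<^sub>R w - a1 *\<^sub>R u)"
    using d by (metis scaleR_left_imp_eq scaleR_scaleR right_inverse scaleR_one)+
  moreover have "inverse ?d *\<^sub>R (a2 *\<^sub>R u - b2 *\<^sub>R w) \<in> span {u, w}" "inverse ?d *\<^sub>R (b1 *\<^sub>R w - a1 *\<^sub>R u) \<in> span {u, w}"
    by (intro span_scale span_diff span_base; simp)+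
  ultimately show "v \<in> span {u, w}" if "v \<in> {x, y}" for v using that by auto
qed

lemma span_pairE:
  assumes "v \<in> span {x, y}" obtains r s where "v = r *\<^sub>R x + s *\<^sub>R (y::'v::real_vector)"
proof -
  obtain r where "v - r *\<^sub>R x \<in> span {y}" using assms by (auto simp: span_insert)
  then obtain s where "v - r *\<^sub>R x = s *\<^sub>R y" by (auto simp: span_singleton)
  then have "v = r *\<^sub>R x + s *\<^sub>R y" by (metis add.commute diff_add_cancel)
  then show ?thesis by (rule that)
qed

context inoue_data
begin

lemma dl_eval_x: "df l1 base_point [(1, 0, 0, 0)] = 0"
proof -
  let ?v = "[(1, 0, 0, 0)] :: R4 list"
  have "b1 * df l1 base_point ?v + b2 * df l2 base_point ?v = 0" "a1 * df l1 base_point ?v + a2 * df l2 base_point ?v = 0"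
    using base_point_eval(2,3)[of "(1, 0, 0, 0)"] by (simp_all add: dw_du_eq)
  then show ?thesis
    using lattice_coordinates(1)[of "df l1 base_point ?v" "df l2 base_point ?v" 0 0] by (simp add: mult.commute)
qed

lemma df_l1_nonzero: "df l1 \<noteq> 0"
proof
  assume 0: "df l1 = 0"
  have "b2 * df l2 base_point [v] = y_of v" "a2 * df l2 base_point [v] = w_of v" for v
    using base_point_eval(2,3)[of v] by (simp_all add: dw_du_eq 0)
  from this(1)[of "(0, 1, 0, 0)"] this(2)[of "(0, 1, 0, 0)"] this(1)[of "(0, 0, 1, 0)"] this(2)[of "(0, 0, 1, 0)"]
  have "a2 = 0" "b2 = 0" by auto
  then show False using delta by simp
qed

lemma dF_independent:
  assumes "y *\<^sub>R df l1 + x *\<^sub>R df F = 0" shows "x = 0"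
proof -
  have "\<kappa> * df F base_point [(1, 0, 0, 0)] = 1"
    using base_point_eval(4)[of "(1, 0, 0, 0)"] by (simp add: zeta_eq dl_eval_x)
  moreover have "(y *\<^sub>R df l1 + x *\<^sub>R df F) base_point [(1, 0, 0, 0)] = 0" by (simp add: assms)
  ultimately show ?thesis by (auto simp: dl_eval_x)
qed

text \<open>A solution \<open>q\<close> of \<open>g\<^sub>2\<^sup>* q - q = dF - (r/2) dl\<^sub>1\<close>. The product \<open>l\<^sub>2 dF\<close> alone fails because \<open>dF\<close> is not
  \<open>g\<^sub>2\<close>-invariant; the quadratic term compensates this.\<close>

definition q2 :: "R4 form" where
  "q2 = fun_mult l2 (df F) + (of_int r / 2) *\<^sub>R fun_mult (\<lambda>z. l2 z * l2 z) (df l1)"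

lemma df_F_in: "df F \<in> diff_forms inoue_cover (Suc 0)" and df_l_in: "df l1 \<in> diff_forms inoue_cover (Suc 0)"
  "df l2 \<in> diff_forms inoue_cover (Suc 0)"
  by (intro df_in smooth_F smooth_l)+

lemma E1_eq: "E1 = wedge1 (df l1) (df F)"
  unfolding E1_def by (rule dR_fun_mult_df[OF smooth_l(1) smooth_F])

lemma dR_q2: "dR q2 = wedge1 (df l2) (df F) + of_int r *\<^sub>R fun_mult l2 (wedge1 (df l2) (df l1))"
proof -
  have s: "smooth_on inoue_cover (\<lambda>z. l2 z * l2 z)" by (intro smooth_on_mult open_inoue_cover smooth_l)
  have "dR q2 = dR (fun_mult l2 (df F)) + dR ((of_int r / 2) *\<^sub>R fun_mult (\<lambda>z. l2 z * l2 z) (df l1))"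
    unfolding q2_def
    by (rule ext_deriv_add[OF fun_mult_in_diff_forms[OF open_inoue_cover smooth_l(2) df_F_in]
        subspace_scale[OF subspace_diff_forms[OF open_inoue_cover] fun_mult_in_diff_forms[OF open_inoue_cover s df_l_in(1)]]])
  also have "dR ((of_int r / 2) *\<^sub>R fun_mult (\<lambda>z. l2 z * l2 z) (df l1))
      = (of_int r / 2) *\<^sub>R wedge1 (df (\<lambda>z. l2 z * l2 z)) (df l1)"
    by (simp only: ext_deriv_scale[OF fun_mult_in_diff_forms[OF open_inoue_cover s df_l_in(1)]] dR_fun_mult_df[OF s smooth_l(1)])
  also have "wedge1 (df (\<lambda>z. l2 z * l2 z)) (df l1) = 2 *\<^sub>R fun_mult l2 (wedge1 (df l2) (df l1))"
    by (simp only: df_mult[OF smooth_l(2) smooth_l(2)] wedge1_add_left wedge1_fun_mult_left scaleR_2)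
  also have "dR (fun_mult l2 (df F)) = wedge1 (df l2) (df F)" by (rule dR_fun_mult_df[OF smooth_l(2) smooth_F])
  also have "(of_int r / 2) *\<^sub>R (2 *\<^sub>R \<beta>) = of_int r *\<^sub>R \<beta>" for \<beta> :: "R4 form"
    by (simp only: scaleR_scaleR) simp
  finally show ?thesis .
qed

text \<open>The two-forms produced by the tower are, up to the factor \<open>\<kappa>\<close>, the invariant forms \<open>dl\<^sub>i \<and> \<zeta>\<close>.\<close>

lemma wedge1_zeta:
  "wedge1 (df l1) zeta = \<kappa> *\<^sub>R E1" "wedge1 (df l2) zeta = \<kappa> *\<^sub>R dR q2"
  by (simp_all add: zeta_eq wedge1_scale_right wedge1_add_right wedge1_fun_mult_right E1_eq dR_q2 wedge1_self[OF df_l_in(1)])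

lemma pull_g2_E1: "pull g2 E1 = E1"
  unfolding E1_eq pull_wedge1 pull_lat_dl pull_lat_dF
  using wedge1_add_right[of "df l1" "df F" "- (of_int r *\<^sub>R df l1)"] wedge1_scale_right[of "df l1" "- of_int r" "df l1"]
  by (simp add: wedge1_self[OF df_l_in(1)])

lemma q2_transform: "pull g2 q2 - q2 = df F - (of_int r / 2) *\<^sub>R df l1"
proof (rule one_form_eqI)
  have s: "smooth_on inoue_cover (\<lambda>z. l2 z * l2 z)" by (intro smooth_on_mult open_inoue_cover smooth_l)
  have q: "q2 \<in> diff_forms inoue_cover (Suc 0)" unfolding q2_def
    by (intro subspace_add[OF subspace_diff_forms] subspace_scale[OF subspace_diff_forms] fun_mult_in_diff_forms
        open_inoue_cover smooth_l s df_F_in df_l_in)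
  then show "pull g2 q2 - q2 \<in> diff_forms inoue_cover (Suc 0)"
    by (intro subspace_diff[OF subspace_diff_forms] pull_in_diff_forms open_inoue_cover affine_lat lat_in_cover)
  show "df F - (of_int r / 2) *\<^sub>R df l1 \<in> diff_forms inoue_cover (Suc 0)"
    by (intro subspace_diff[OF subspace_diff_forms] subspace_scale[OF subspace_diff_forms] open_inoue_cover df_F_in df_l_in)
  fix x v assume "x \<in> inoue_cover"
  then show "(pull g2 q2 - q2) x [v] = (df F - (of_int r / 2) *\<^sub>R df l1) x [v]"
    unfolding q2_def linear_add[OF linear_pull] linear_cmul[OF linear_pull] pull_fun_mult pull_lat_dl pull_lat_dF
    by (simp add: l_lat algebra_simps)
qed

lemma sum_span_pair:
  assumes "\<And>r. d (r *\<^sub>R b) = r *\<^sub>R d b"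
  shows "{p + d q | p q. p \<in> span {a} \<and> q \<in> span {b}} = span {a, d b :: 'v::real_vector}"
proof (intro equalityI subsetI)
  fix x assume "x \<in> {p + d q | p q. p \<in> span {a} \<and> q \<in> span {b}}"
  then obtain k r where "x = k *\<^sub>R a + r *\<^sub>R d b" using assms by (auto simp: span_singleton)
  moreover have "k *\<^sub>R a + r *\<^sub>R d b \<in> span {a, d b}" by (intro span_add span_scale span_base) simp_all
  ultimately show "x \<in> span {a, d b}" by simp
next
  fix x assume "x \<in> span {a, d b}"
  then obtain r s where "x = r *\<^sub>R a + s *\<^sub>R d b" by (rule span_pairE)
  then have "x = r *\<^sub>R a + d (s *\<^sub>R b)" using assms by simp
  then show "x \<in> {p + d q | p q. p \<in> span {a} \<and> q \<in> span {b}}" by (auto simp: span_singleton)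
qed

text \<open>On \<open>H\<^sup>1\<close> of the quotient by \<open>g\<^sub>1, g\<^sub>3\<close> the map \<open>g\<^sub>2\<close> acts by a nontrivial Jordan block, as
  \<open>g\<^sub>2\<^sup>* dF = dF - r dl\<^sub>1\<close>; the kernel of \<open>g\<^sub>2\<^sup>* - 1\<close> is spanned by \<open>dl\<^sub>1\<close> and the cokernel by \<open>dF\<close>.\<close>

lemma represents_3_1: "represents {g2, g1, g3} 1 (span {df l1, df l2})"
proof -
  note rep0 = represents_2(1) and rep1 = represents_2(2)
  note fixed = L3.fixed_eq_invariant_forms[OF refl]
  let ?q = "fun_mult l2 one_form0"
  have one: "one_form0 \<in> invariant_forms inoue_cover {g1, g3} 0"
    by (rule represents_cohomologyD(2)[OF rep0]) (simp add: span_base)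
  have q_in: "?q \<in> invariant_forms inoue_cover {g1, g3} 0" by (rule L3.mult_in[OF one])
  have Tq: "pull g2 ?q - ?q = one_form0" using L3.T_fun_mult[OF one] pull_one_form0[of g2] lat_in_cover by simp
  have dl1: "df l1 \<in> span {df l1, df F}" "df F \<in> span {df l1, df F}" by (simp_all add: span_base)
  have "represents {g2, g1, g3} (Suc 0) {p + dR q | p q. p \<in> span {df l1} \<and> q \<in> span {?q}}"
  proof (rule L3.represents_cohomology_fixed_Suc[unfolded fixed, unfolded scaleR_one])
    show "subspace (span {df l1})" "subspace (span {?q})" by (rule subspace_span)+
    have "df l1 \<in> closed_part (invariant_forms inoue_cover {g2, g1, g3}) dR (Suc 0)"
      using represents_cohomologyD(2,3)[OF rep1 dl1(1)] pull_lat_dl(1) unfolding closed_part_def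
      by (simp add: invariant_forms_def)
    then show "span {df l1} \<subseteq> closed_part (invariant_forms inoue_cover {g2, g1, g3}) dR (Suc 0)"
      by (intro span_minimal cochain_complex.subspace_closed_part[OF L3.cochain_complex_fixed[unfolded fixed]]) simp
    have "span {df l1} \<subseteq> span {df l1, df F}" by (intro span_mono) auto
    then show "span {df l1} \<inter> exact_part (invariant_forms inoue_cover {g1, g3}) dR (Suc 0) \<subseteq> {0}"
      using represents_cohomologyD(4)[OF rep1] by auto
  next
    fix z assume z: "z \<in> invariant_forms inoue_cover {g1, g3} (Suc 0)" "dR z = 0"
      and e: "pull g2 z - z \<in> exact_part (invariant_forms inoue_cover {g1, g3}) dR (Suc 0)"
    obtain p where p: "p \<in> span {df l1, df F}" "z - p \<in> exact_part (invariant_forms inoue_cover {g1, g3}) dR (Suc 0)"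
      using represents_cohomologyD(5)[OF rep1] z by auto
    obtain y x where yx: "p = y *\<^sub>R df l1 + x *\<^sub>R df F" using p(1) by (rule span_pairE)
    have "pull g2 p - p = - (x * of_int r) *\<^sub>R df l1"
      unfolding yx linear_add[OF linear_pull] linear_cmul[OF linear_pull] pull_lat_dl pull_lat_dF
      by (simp add: fun_eq_iff algebra_simps)
    moreover have "pull g2 (z - p) - (z - p) \<in> exact_part (invariant_forms inoue_cover {g1, g3}) dR (Suc 0)"
      using L3.T_minus_id_exact[OF p(2)] by simp
    from subspace_diff[OF L3.subspace_exact_part e this]
    have "pull g2 p - p \<in> exact_part (invariant_forms inoue_cover {g1, g3}) dR (Suc 0)"
      by (simp add: linear_diff[OF linear_pull])
    ultimately have "- (x * of_int r) *\<^sub>R df l1 = 0"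
      using represents_cohomologyD(4)[OF rep1 span_scale[OF dl1(1), of "- (x * of_int r)"]] by simp
    then have "x = 0" using df_l1_nonzero r by simp
    then have "p \<in> span {df l1}" by (simp add: yx span_scale span_base)
    then show "\<exists>p\<in>span {df l1}. z - p \<in> exact_part (invariant_forms inoue_cover {g1, g3}) dR (Suc 0)"
      using p(2) by blast
  next
    show "span {?q} \<subseteq> invariant_forms inoue_cover {g1, g3} 0"
      using q_in subspace_invariant_forms[OF open_inoue_cover] by (intro span_minimal) auto
  next
    fix q assume "q \<in> span {?q}"
    then obtain x where x: "q = x *\<^sub>R ?q" by (auto simp: span_singleton)
    have Tq': "pull g2 q - q = x *\<^sub>R one_form0"
      unfolding x linear_cmul[OF linear_pull] by (simp add: Tq flip: scaleR_diff_right)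
    then show "dR (pull g2 q - q) = 0" using ext_deriv_scale[OF one_form0_in, of x] dR_one_form0 by simp
    fix y assume y: "y \<in> invariant_forms inoue_cover {g1, g3} 0" "dR y = 0"
      and e: "pull g2 q - q - (pull g2 y - y) \<in> exact_part (invariant_forms inoue_cover {g1, g3}) dR 0"
    obtain s where "y = s *\<^sub>R one_form0"
      using cover.closed_0_form_const[OF invariant_forms_diff_forms[OF y(1)] y(2)] by blast
    then have "pull g2 y - y = 0" using pull_one_form0[of g2] lat_in_cover by (simp add: pull_scale)
    then have "x *\<^sub>R one_form0 = 0" using e Tq' by (simp add: exact_part_def)
    then have "fun_mult l2 (x *\<^sub>R one_form0) = fun_mult l2 0" by (rule arg_cong)
    moreover have "x *\<^sub>R ?q = fun_mult l2 (x *\<^sub>R one_form0)" by (simp add: fun_eq_iff mult.left_commute)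
    ultimately show "q = 0" unfolding x by simp
  next
    fix z assume z: "z \<in> invariant_forms inoue_cover {g1, g3} 0" "dR z = 0"
    obtain x where x: "z = x *\<^sub>R one_form0"
      using cover.closed_0_form_const[OF invariant_forms_diff_forms[OF z(1)] z(2)] by blast
    have "z - (pull g2 (x *\<^sub>R ?q) - x *\<^sub>R ?q) - (pull g2 0 - 0) = 0"
      by (simp add: x pull_scale Tq linear_0[OF linear_pull] flip: scaleR_diff_right)
    then have "z - (pull g2 (x *\<^sub>R ?q) - x *\<^sub>R ?q) - (pull g2 0 - 0) \<in> exact_part (invariant_forms inoue_cover {g1, g3}) dR 0"
      using subspace_0[OF L3.subspace_exact_part] by (simp only:)
    moreover have "x *\<^sub>R ?q \<in> span {?q}" by (intro span_scale span_base) simp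
    ultimately show "\<exists>q\<in>span {?q}. \<exists>y\<in>invariant_forms inoue_cover {g1, g3} 0.
        dR y = 0 \<and> z - (pull g2 q - q) - (pull g2 y - y) \<in> exact_part (invariant_forms inoue_cover {g1, g3}) dR 0"
      using subspace_0[OF subspace_invariant_forms[OF open_inoue_cover]] dR_0 by blast
  qed
  also have "{p + dR q | p q. p \<in> span {df l1} \<and> q \<in> span {?q}} = span {df l1, dR ?q}"
    by (rule sum_span_pair) (rule ext_deriv_scale[OF invariant_forms_diff_forms[OF q_in]])
  finally show ?thesis by (simp add: fun_mult_one_form0 flip: df_def)
qed

text \<open>The cokernel of \<open>g\<^sub>2\<^sup>* - 1\<close> on \<open>H\<^sup>1\<close> is spanned by \<open>dF\<close> and contributes \<open>dq\<close>; on \<open>H\<^sup>2\<close>, which is spanned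
  by the invariant form \<open>E1\<close>, the action is trivial.\<close>

lemma represents_3_2: "represents {g2, g1, g3} 2 (span {E1, dR q2})"
proof -
  note rep1 = represents_2(2) and rep2 = represents_2(3)
  note fixed = L3.fixed_eq_invariant_forms[OF refl]
  let ?C = "invariant_forms inoue_cover {g1, g3}"
  have base: "df l1 \<in> span {df l1, df F}" "df F \<in> span {df l1, df F}" by (simp_all add: span_base)
  note dl1 = represents_cohomologyD(2,3)[OF rep1 base(1)] and dF = represents_cohomologyD(2,3)[OF rep1 base(2)]
  have E1: "E1 \<in> ?C 2" "dR E1 = 0" using represents_cohomologyD(2,3)[OF rep2, of E1] by (simp_all add: span_base)
  have q_in: "q2 \<in> ?C 1"
    unfolding q2_def using l_lat
    by (intro subspace_add[OF subspace_invariant_forms] subspace_scale[OF subspace_invariant_forms]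
        fun_mult_in_invariant_forms open_inoue_cover smooth_on_mult smooth_l dl1 dF) auto
  have "represents {g2, g1, g3} (Suc 1) {p + dR q | p q. p \<in> span {E1} \<and> q \<in> span {q2}}"
  proof (rule L3.represents_cohomology_fixed_Suc[unfolded fixed, unfolded scaleR_one])
    show "subspace (span {E1})" "subspace (span {q2})" by (rule subspace_span)+
    have "E1 \<in> closed_part (invariant_forms inoue_cover {g2, g1, g3}) dR (Suc 1)"
      using E1 pull_g2_E1 unfolding closed_part_def by (simp add: invariant_forms_def numeral_2_eq_2)
    then show "span {E1} \<subseteq> closed_part (invariant_forms inoue_cover {g2, g1, g3}) dR (Suc 1)"
      by (intro span_minimal cochain_complex.subspace_closed_part[OF L3.cochain_complex_fixed[unfolded fixed]]) simp
    show "span {E1} \<inter> exact_part ?C dR (Suc 1) \<subseteq> {0}"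
      using represents_cohomologyD(4)[OF rep2] by (auto simp: numeral_2_eq_2)
    show "span {q2} \<subseteq> ?C 1"
      using q_in subspace_invariant_forms[OF open_inoue_cover] by (intro span_minimal) auto
  next
    fix z assume "z \<in> ?C (Suc 1)" "dR z = 0"
    then show "\<exists>p\<in>span {E1}. z - p \<in> exact_part ?C dR (Suc 1)"
      using represents_cohomologyD(5)[OF rep2] by (simp add: numeral_2_eq_2)
  next
    fix q assume "q \<in> span {q2}"
    then obtain x where x: "q = x *\<^sub>R q2" by (auto simp: span_singleton)
    have Tq: "pull g2 q - q = x *\<^sub>R df F + (- (x * of_int r / 2)) *\<^sub>R df l1"
      unfolding x pull_scale scaleR_diff_right[symmetric] q2_transform by (simp add: scaleR_diff_right)
    have lin: "dR (x *\<^sub>R df F + y *\<^sub>R df l1) = 0" for x y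
      using ext_deriv_add[OF subspace_scale[OF subspace_diff_forms[OF open_inoue_cover] df_F_in, of x]
          subspace_scale[OF subspace_diff_forms[OF open_inoue_cover] df_l_in(1), of y]]
        ext_deriv_scale[OF df_F_in, of x] ext_deriv_scale[OF df_l_in(1), of y] dl1(2) dF(2)
      by simp
    show "dR (pull g2 q - q) = 0" unfolding Tq by (rule lin)
    fix y assume y: "y \<in> ?C 1" "dR y = 0" and e: "pull g2 q - q - (pull g2 y - y) \<in> exact_part ?C dR 1"
    obtain p where p: "p \<in> span {df l1, df F}" "y - p \<in> exact_part ?C dR 1"
      using represents_cohomologyD(5)[OF rep1 y] by blast
    obtain y1 x1 where yx: "p = y1 *\<^sub>R df l1 + x1 *\<^sub>R df F" using p(1) by (rule span_pairE)
    have Tp: "pull g2 p - p = - (x1 * of_int r) *\<^sub>R df l1"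
      unfolding yx linear_add[OF linear_pull] linear_cmul[OF linear_pull] pull_lat_dl pull_lat_dF
      by (simp add: fun_eq_iff algebra_simps)
    have "pull g2 (y - p) - (y - p) \<in> exact_part ?C dR 1" using L3.T_minus_id_exact[OF p(2)] by simp
    from subspace_add[OF L3.subspace_exact_part e this]
    moreover have "pull g2 q - q - (pull g2 y - y) + (pull g2 (y - p) - (y - p)) = pull g2 q - q - (pull g2 p - p)"
      by (simp add: linear_diff[OF linear_pull])
    ultimately have "pull g2 q - q - (pull g2 p - p) \<in> exact_part ?C dR 1" by (simp only:)
    moreover have "pull g2 q - q - (pull g2 p - p) = (x1 * of_int r - x * of_int r / 2) *\<^sub>R df l1 + x *\<^sub>R df F"
      unfolding Tq Tp by (simp add: fun_eq_iff algebra_simps)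
    moreover have "(x1 * of_int r - x * of_int r / 2) *\<^sub>R df l1 + x *\<^sub>R df F \<in> span {df l1, df F}"
      by (intro span_add span_scale base)
    ultimately have "(x1 * of_int r - x * of_int r / 2) *\<^sub>R df l1 + x *\<^sub>R df F = 0"
      using represents_cohomologyD(4)[OF rep1] by (simp only:)
    then have "x = 0" by (rule dF_independent)
    then show "q = 0" by (simp add: x)
  next
    fix z assume z: "z \<in> ?C 1" "dR z = 0"
    obtain p where p: "p \<in> span {df l1, df F}" "z - p \<in> exact_part ?C dR 1"
      using represents_cohomologyD(5)[OF rep1 z] by blast
    obtain y x where yx: "p = y *\<^sub>R df l1 + x *\<^sub>R df F" using p(1) by (rule span_pairE)
    \<comment> \<open>The multiple of \<open>dF\<close> that \<open>g\<^sub>2\<^sup>* - 1\<close> sends to the remaining multiple of \<open>dl\<^sub>1\<close>.\<close>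
    let ?c = "- (y / of_int r + x / 2)"
    have Tq: "pull g2 (x *\<^sub>R q2) - x *\<^sub>R q2 = x *\<^sub>R df F + (- (x * of_int r / 2)) *\<^sub>R df l1"
      unfolding pull_scale scaleR_diff_right[symmetric] q2_transform by (simp add: scaleR_diff_right)
    have Ty: "pull g2 (?c *\<^sub>R df F) - ?c *\<^sub>R df F = (y + x * of_int r / 2) *\<^sub>R df l1"
      unfolding pull_scale pull_lat_dF using r by (simp add: fun_eq_iff field_simps)
    have "z - (pull g2 (x *\<^sub>R q2) - x *\<^sub>R q2) - (pull g2 (?c *\<^sub>R df F) - ?c *\<^sub>R df F) = z - p"
      unfolding Tq Ty yx by (simp add: fun_eq_iff algebra_simps)
    with p(2) have "z - (pull g2 (x *\<^sub>R q2) - x *\<^sub>R q2) - (pull g2 (?c *\<^sub>R df F) - ?c *\<^sub>R df F) \<in> exact_part ?C dR 1"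
      by (simp only:)
    moreover have "x *\<^sub>R q2 \<in> span {q2}" by (intro span_scale span_base) simp
    moreover have "?c *\<^sub>R df F \<in> ?C 1" by (rule subspace_scale[OF subspace_invariant_forms[OF open_inoue_cover] dF(1)])
    moreover have "dR (?c *\<^sub>R df F) = 0" using ext_deriv_scale[OF df_F_in, of ?c] dF(2) by simp
    ultimately show "\<exists>q\<in>span {q2}. \<exists>y\<in>?C 1.
        dR y = 0 \<and> z - (pull g2 q - q) - (pull g2 y - y) \<in> exact_part ?C dR 1"
      by blast
  qed
  also have "{p + dR q | p q. p \<in> span {E1} \<and> q \<in> span {q2}} = span {E1, dR q2}"
    by (rule sum_span_pair) (rule ext_deriv_scale[OF invariant_forms_diff_forms[OF q_in]])
  finally show ?thesis by (simp add: numeral_2_eq_2)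
qed

definition E3 :: "R4 form" where "E3 = dR (fun_mult l2 E1)"

text \<open>Together with the two lemmas above: the Betti numbers of the Heisenberg nilmanifold are \<open>1, 2, 2, 1\<close>.\<close>

lemma represents_3:
  "represents {g2, g1, g3} 0 (span {one_form0})" "represents {g2, g1, g3} 3 (span {E3})"
  "represents {g2, g1, g3} 4 (span {})"
proof -
  note [simp] = dR_0 lat_in_cover
  show "represents {g2, g1, g3} 0 (span {one_form0})"
    using L3.represents_step_0[unfolded L3.fixed_eq_invariant_forms[OF refl], where A="{one_form0}" and B="{}" and \<beta>=2]
      represents_2(1) by (simp add: pull_one_form0)
  show "represents {g2, g1, g3} 3 (span {E3})"
    using L3.represents_step[unfolded L3.fixed_eq_invariant_forms[OF refl],
        where k=2 and s=E1 and B="{}" and A'="{}" and B'="{}" and \<beta>=2 and \<beta>'=2] represents_2(3) represents_2(4)[of 0]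
    by (simp add: E3_def pull_g2_E1 numeral_2_eq_2 numeral_3_eq_3)
  show "represents {g2, g1, g3} 4 (span {})"
    using L3.represents_step[unfolded L3.fixed_eq_invariant_forms[OF refl],
        where k=3 and s=0 and B="{}" and A'="{}" and B'="{}" and \<beta>=2 and \<beta>'=2] represents_2(4)[of 0] represents_2(4)[of 1]
    by (simp add: span_insert_0 linear_0[OF linear_pull] numeral_3_eq_3 numeral_eq_Suc)
qed

end

context inoue_data
begin

abbreviation "du \<equiv> df u_of"
abbreviation "dw \<equiv> df (\<lambda>z. w_of z)"
abbreviation "du_zeta \<equiv> wedge1 du zeta"
abbreviation "dw_zeta \<equiv> wedge1 dw zeta"

text \<open>Representatives that are eigenvectors of \<open>g\<^sub>0\<close>.\<close>

lemma represents_3_eigen: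
  "represents {g2, g1, g3} 1 (span {du, dw})" "represents {g2, g1, g3} 2 (span {du_zeta, dw_zeta})"
proof -
  show "represents {g2, g1, g3} 1 (span {du, dw})"
    using represents_3_1 span_pair_eq[OF dw_du_eq(2) dw_du_eq(1) delta] by simp
  have "du_zeta = (b1 * \<kappa>) *\<^sub>R E1 + (b2 * \<kappa>) *\<^sub>R dR q2" "dw_zeta = (a1 * \<kappa>) *\<^sub>R E1 + (a2 * \<kappa>) *\<^sub>R dR q2"
    unfolding dw_du_eq by (simp_all add: wedge1_add_left wedge1_scale_left wedge1_zeta)
  moreover have "(b1 * \<kappa>) * (a2 * \<kappa>) - (b2 * \<kappa>) * (a1 * \<kappa>) \<noteq> 0"
  proof -
    have "(b1 * \<kappa>) * (a2 * \<kappa>) - (b2 * \<kappa>) * (a1 * \<kappa>) = \<kappa>\<^sup>2 * \<delta>" by (simp add: power2_eq_square algebra_simps)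
    then show ?thesis using kappa(1) delta by simp
  qed
  ultimately have "span {du_zeta, dw_zeta} = span {E1, dR q2}" by (rule span_pair_eq)
  then show "represents {g2, g1, g3} 2 (span {du_zeta, dw_zeta})" using represents_3_2 by simp
qed

text \<open>Up to a constant, \<open>E3\<close> is the volume form \<open>du \<and> dw \<and> \<zeta>\<close> of the fibres \<open>t = const\<close>, which
  \<open>g\<^sub>0\<close> preserves.\<close>

lemma pull_dil_E3: "pull (dil \<alpha>) E3 = E3"
proof -
  have \<alpha>: "\<alpha> > 0" using alpha by simp
  have E1: "E1 \<in> diff_forms inoue_cover 2" "dR E1 = 0"
    using represents_cohomologyD(2,3)[OF represents_2(3), of E1]
    by (simp_all add: span_base invariant_forms_diff_forms)
  have E3: "E3 = wedge1 (df l2) E1"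
    unfolding E3_def using df_fun_mult[OF smooth_l(2) E1(1)] E1(2) by simp
  have 1: "wedge1 (df l1) (wedge1 (df l1) zeta) = 0" "wedge1 (df l2) (wedge1 (df l2) zeta) = 0"
    by (rule wedge1_wedge1_self)+
  have 2: "wedge1 (df l2) (wedge1 (df l1) zeta) = \<kappa> *\<^sub>R E3" by (simp add: wedge1_zeta wedge1_scale_right E3)
  then have 3: "wedge1 (df l1) (wedge1 (df l2) zeta) = - (\<kappa> *\<^sub>R E3)" using wedge1_wedge1_swap[of "df l1" "df l2" zeta] by simp
  have "wedge1 du dw_zeta = a1 *\<^sub>R (b1 *\<^sub>R 0 + b2 *\<^sub>R (\<kappa> *\<^sub>R E3)) + a2 *\<^sub>R (b1 *\<^sub>R (- (\<kappa> *\<^sub>R E3)) + b2 *\<^sub>R 0)"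
    unfolding dw_du_eq wedge1_add_left wedge1_scale_left wedge1_add_right wedge1_scale_right 1 2 3 ..
  also have "\<dots> = - (\<delta> * \<kappa>) *\<^sub>R E3" by (simp add: fun_eq_iff algebra_simps)
  finally have vol: "wedge1 du dw_zeta = - (\<delta> * \<kappa>) *\<^sub>R E3" .
  have "pull (dil \<alpha>) (wedge1 du dw_zeta) = wedge1 du dw_zeta"
    using \<alpha> by (simp add: pull_wedge1 pull_dil_df wedge1_scale_left wedge1_scale_right)
  then have "- (\<delta> * \<kappa>) *\<^sub>R pull (dil \<alpha>) E3 = - (\<delta> * \<kappa>) *\<^sub>R E3" unfolding vol pull_scale .
  moreover have "- (\<delta> * \<kappa>) \<noteq> 0" using delta kappa(1) by simp
  ultimately show ?thesis by (metis scaleR_left_imp_eq)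
qed

text \<open>\<open>\<alpha> g\<^sub>0\<^sup>*\<close> has the eigenvalues \<open>\<alpha>\<close> on \<open>1\<close>, \<open>1\<close> on \<open>du\<close>, \<open>\<alpha>\<^sup>2\<close> on \<open>dw\<close>, \<open>1\<close> on \<open>du \<and> \<zeta>\<close>, \<open>\<alpha>\<^sup>2\<close> on
  \<open>dw \<and> \<zeta>\<close> and \<open>\<alpha>\<close> on \<open>E3\<close>. So only \<open>du\<close> and \<open>du \<and> \<zeta>\<close> contribute, each of them to its own degree and,
  after multiplication with \<open>ds\<close>, to the next one.\<close>

lemma represents_4:
  "represents_cohomology L4.fixed dR 0 {0}"
  "represents_cohomology L4.fixed dR 1 (span {du})"
  "represents_cohomology L4.fixed dR 2 (span {dR (fun_mult s_of du), du_zeta})"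
  "represents_cohomology L4.fixed dR 3 (span {dR (fun_mult s_of du_zeta)})"
  "represents_cohomology L4.fixed dR 4 {0}"
proof -
  have \<alpha>: "\<alpha> > 0" "\<alpha> \<noteq> 1" "\<alpha> * \<alpha> \<noteq> 1"
    using alpha by (auto simp: less_1_mult less_imp_neq[symmetric])
  have one: "pull (dil \<alpha>) one_form0 = one_form0" by (rule pull_one_form0) (rule dil_in_cover[OF \<alpha>(1)])
  note [simp] = dR_0 one pull_dil_df[OF \<alpha>(1)] pull_wedge1 wedge1_scale_left pull_dil_E3 linear_0[OF linear_pull]
  show "represents_cohomology L4.fixed dR 0 {0}"
    using L4.represents_step_0[where A="{}" and B="{one_form0}" and \<beta>=\<alpha>] represents_3(1) \<alpha> by simp
  show "represents_cohomology L4.fixed dR 1 (span {du})"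
    using L4.represents_step[where k=0 and s=0 and B="{one_form0}" and \<beta>=\<alpha> and A'="{du}" and B'="{dw}" and \<beta>'="\<alpha> * \<alpha>"]
      represents_3(1) represents_3_eigen(1) \<alpha> by (simp add: span_insert_0 insert_commute)
  show "represents_cohomology L4.fixed dR 2 (span {dR (fun_mult s_of du), du_zeta})"
    using L4.represents_step[where k=1 and s=du and B="{dw}" and \<beta>="\<alpha> * \<alpha>" and A'="{du_zeta}" and B'="{dw_zeta}" and \<beta>'="\<alpha> * \<alpha>"]
      represents_3_eigen \<alpha> by (simp add: numeral_2_eq_2 insert_commute)
  show "represents_cohomology L4.fixed dR 3 (span {dR (fun_mult s_of du_zeta)})"
    using L4.represents_step[where k=2 and s=du_zeta and B="{dw_zeta}" and \<beta>="\<alpha> * \<alpha>" and A'="{}" and B'="{E3}" and \<beta>'=\<alpha>]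
      represents_3(2) represents_3_eigen(2) \<alpha> by (simp add: numeral_2_eq_2 numeral_3_eq_3)
  show "represents_cohomology L4.fixed dR 4 {0}"
    using L4.represents_step[where k=3 and s=0 and B="{E3}" and \<beta>=\<alpha> and A'="{}" and B'="{}" and \<beta>'=\<alpha>]
      represents_3(2,3) \<alpha> by (simp add: span_insert_0 numeral_3_eq_3 numeral_eq_Suc)
qed

lemma ds_eval: "df s_of base_point [v] = t_of v / ln \<alpha>"
proof -
  have "((\<lambda>z. ln (t_of z)) has_derivative (\<lambda>v. t_of v)) (at base_point)"
    using has_derivative_ln[OF _ bounded_linear_imp_has_derivative[OF bounded_linear_coordinates(4)], of base_point UNIV] by simp
  from has_derivative_mult_left[OF this, of "inverse (ln \<alpha>)"]
  have "(s_of has_derivative (\<lambda>v. t_of v * inverse (ln \<alpha>))) (at base_point)"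
    unfolding s_of_def[abs_def] divide_inverse .
  from df_eval[OF this base_point_in] show ?thesis by (simp add: divide_inverse)
qed

lemma representatives_independent:
  "du \<noteq> 0" "dR (fun_mult s_of du_zeta) \<noteq> 0"
  "x *\<^sub>R dR (fun_mult s_of du) + y *\<^sub>R du_zeta = 0 \<Longrightarrow> x = 0 \<and> y = 0"
proof -
  let ?ex = "(1, 0, 0, 0) :: R4" and ?ey = "(0, 1, 0, 0) :: R4" and ?et = "(0, 0, 0, 1) :: R4"
  have "du base_point [?ey] = 1" by (simp add: base_point_eval)
  then show "du \<noteq> 0" by auto
  have du_in: "du \<in> diff_forms inoue_cover (Suc 0)" by (intro df_in smooth_u_of)
  have duz: "du_zeta \<in> diff_forms inoue_cover 2" "dR du_zeta = 0"
    using represents_cohomologyD(2,3)[OF represents_3_eigen(2), of du_zeta]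
    by (simp_all add: span_base invariant_forms_diff_forms)
  have d2: "dR (fun_mult s_of du) = wedge1 (df s_of) du" by (rule dR_fun_mult_df) simp_all
  have d3: "dR (fun_mult s_of du_zeta) = wedge1 (df s_of) du_zeta"
    using df_fun_mult[OF smooth_s_of duz(1)] duz(2) by simp
  have "dR (fun_mult s_of du_zeta) base_point [?et, ?ey, ?ex] = 1 / ln \<alpha>"
    unfolding d3 by (simp add: wedge1_alt_sum ds_eval base_point_eval)
  then show "dR (fun_mult s_of du_zeta) \<noteq> 0" using ln_alpha by auto
  assume "x *\<^sub>R dR (fun_mult s_of du) + y *\<^sub>R du_zeta = 0"
  then have "(x *\<^sub>R dR (fun_mult s_of du) + y *\<^sub>R du_zeta) base_point vs = 0" for vs by simp
  from this[of "[?et, ?ey]"] this[of "[?ey, ?ex]"] show "x = 0 \<and> y = 0"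
    unfolding d2 using ln_alpha by (simp add: wedge1_alt_sum ds_eval base_point_eval)
qed

end

section \<open>Forms on a quotient manifold\<close>

text \<open>\<open>G\<close> is the group acting on \<open>X\<close>, consisting of functions that are extensional on \<open>X\<close>; \<open>A\<close> consists of
  affine maps of the whole space with the same orbits. The last assumption is proper
  discontinuity in the form of a covering of the quotient by charts.\<close>

locale affine_quotient =
  fixes X :: "'a::euclidean_space set" and G A :: "('a \<Rightarrow> 'a) set"
  assumes X: "open X"
    and A_affine: "g \<in> A \<Longrightarrow> affine_map g" and A_dom: "g \<in> A \<Longrightarrow> g x \<in> X \<longleftrightarrow> x \<in> X"
    and A_id: "id \<in> A" and A_compose: "g \<in> A \<Longrightarrow> h \<in> A \<Longrightarrow> g \<circ> h \<in> A"
    and A_inverse: "g \<in> A \<Longrightarrow> \<exists>h\<in>A. h \<circ> g = id"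
    and orbit: "x \<in> X \<Longrightarrow> orbit_map G x = (\<lambda>g. g x) ` A"
    and cover: "x \<in> X \<Longrightarrow> \<exists>V. open V \<and> x \<in> V \<and> V \<subseteq> X \<and> inj_on (orbit_map G) V"
begin

abbreviation "\<pi> \<equiv> orbit_map G"
abbreviation "S \<equiv> quotient_atlas X G"

definition chart_domain :: "'a set \<Rightarrow> bool" where
  "chart_domain V \<longleftrightarrow> open V \<and> V \<subseteq> X \<and> inj_on \<pi> V"

definition chart :: "'a set \<Rightarrow> ('a set, 'a) chart" where
  "chart V = (\<pi> ` V, inv_into V \<pi>)"

lemma atlas_eq: "S = {chart V | V. chart_domain V}"
  by (simp add: quotient_atlas_def chart_def chart_domain_def)

lemma chart_image_chart: "chart_domain V \<Longrightarrow> chart_image (chart V) = V"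
  by (auto simp: chart_image_def chart_def chart_domain_def image_image)

lemma atlasE:
  assumes "c \<in> S" obtains V where "chart_domain V" "c = chart V" "chart_image c = V"
  using assms chart_image_chart unfolding atlas_eq by blast

lemma orbit_eq_iff:
  assumes "x \<in> X" "y \<in> X" shows "\<pi> x = \<pi> y \<longleftrightarrow> (\<exists>g\<in>A. y = g x)"
proof
  assume "\<pi> x = \<pi> y"
  moreover have "id y \<in> \<pi> y" unfolding orbit[OF assms(2)] using A_id by blast
  ultimately show "\<exists>g\<in>A. y = g x" using orbit[OF assms(1)] by auto
next
  assume "\<exists>g\<in>A. y = g x"
  then obtain g where g: "g \<in> A" "y = g x" by blast
  obtain h where h: "h \<in> A" "h \<circ> g = id" using A_inverse[OF g(1)] by blast
  have "f x \<in> \<pi> y" if "f \<in> A" for f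
  proof -
    have "f x = (f \<circ> h) y" using fun_cong[OF h(2), of x] g(2) by simp
    then show ?thesis unfolding orbit[OF assms(2)] using A_compose[OF that h(1)] by blast
  qed
  moreover have "f y \<in> \<pi> x" if "f \<in> A" for f
  proof -
    have "f y = (f \<circ> g) x" using g(2) by simp
    then show ?thesis unfolding orbit[OF assms(1)] using A_compose[OF that g(1)] by blast
  qed
  ultimately show "\<pi> x = \<pi> y" unfolding orbit[OF assms(1)] orbit[OF assms(2)] by blast
qed

text \<open>Changes of coordinates are locally deck transformations.\<close>

lemma transition_eq:
  assumes V: "chart_domain V" "chart_domain V'" and g: "g \<in> A" and y: "y \<in> V" "g y \<in> V'"
  shows "transition (chart V) (chart V') y = g y"
proof -
  have inj: "inj_on \<pi> V" "inj_on \<pi> V'" and sub: "V \<subseteq> X" "V' \<subseteq> X" using V by (auto simp: chart_domain_def)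
  have "inv_into (\<pi> ` V) (inv_into V \<pi>) y = \<pi> y"
    using y(1) inj(1) by (intro inv_into_f_eq) (auto simp: inj_on_inv_into)
  moreover have "\<pi> y = \<pi> (g y)" using y sub g by (subst orbit_eq_iff) auto
  ultimately show ?thesis using inj(2) y(2) by (simp add: transition_def chart_def)
qed

lemma pullback_transition:
  assumes V: "chart_domain V" "chart_domain V'" and g: "g \<in> A" and x: "x \<in> V" "g x \<in> V'"
  shows "pullback (transition (chart V) (chart V')) \<beta> x vs = pull g \<beta> x vs"
proof -
  note Dg = affine_map_has_derivative[OF A_affine[OF g]]
  have "continuous_on UNIV g"
    by (rule continuous_at_imp_continuous_on) (use Dg has_derivative_continuous in blast)
  then have "open (V \<inter> g -` V')"
    using V by (intro open_Int open_vimage) (auto simp: chart_domain_def)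
  then have "frechet_derivative (transition (chart V) (chart V')) (at x) = frechet_derivative g (at x)"
    by (rule frechet_derivative_cong_open(1)) (use x transition_eq[OF V g] in auto)
  then show ?thesis
    using transition_eq[OF V g x] by (simp add: pullback_def pull_def frechet_derivativeI[OF Dg])
qed

definition push :: "'a form \<Rightarrow> ('a set, 'a) mform" where
  "push \<beta> = induced_form X G \<beta>"

lemma push_chart: "chart_domain V \<Longrightarrow> push \<beta> (chart V) x vs = (if x \<in> V then \<beta> x vs else 0)"
  unfolding push_def induced_form_def using chart_image_chart atlas_eq by auto

lemma push_outside: "c \<notin> S \<Longrightarrow> push \<beta> c = 0"
  by (simp add: push_def induced_form_def fun_eq_iff)

lemma linear_push: "linear push"
  by (rule linearI) (auto simp: push_def induced_form_def fun_eq_iff)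

lemma push_in_forms:
  assumes "\<beta> \<in> invariant_forms X A k"
  shows "push \<beta> \<in> forms S k"
proof -
  note \<beta> = invariant_forms_diff_forms[OF assms]
  have "is_form k (chart_image c) (push \<beta> c)" if c: "c \<in> S" for c
  proof -
    obtain V where V: "chart_domain V" "c = chart V" "chart_image c = V" using c by (rule atlasE)
    have oV: "open V" "V \<subseteq> X" using V(1) by (auto simp: chart_domain_def)
    have "push \<beta> c \<in> diff_forms V k"
    proof (rule diff_formsI)
      show "push \<beta> c x vs = 0" if "x \<notin> V \<or> length vs \<noteq> k" for x vs
        using that diff_forms_zero[OF \<beta>] by (auto simp: V(2) push_chart[OF V(1)])
      show "alternating_multilinear k (push \<beta> c x)" if "x \<in> V" for x
      proof -
        have "push \<beta> c x = \<beta> x" using that by (simp add: V(2) push_chart[OF V(1)] fun_eq_iff)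
        then show ?thesis using diff_forms_alternating[OF \<beta>] that oV by auto
      qed
      show "smooth_on V (\<lambda>x. push \<beta> c x vs)" for vs
        using smooth_on_subset[OF diff_forms_smooth[OF \<beta>] oV(2)]
        by (subst smooth_on_cong[OF oV(1)]) (auto simp: V(2) push_chart[OF V(1)])
    qed
    then show ?thesis by (simp add: diff_forms_def V(3))
  qed
  moreover have "push \<beta> c x = pullback (transition c c') (push \<beta> c') x"
    if c: "c \<in> S" "c' \<in> S" and x: "x \<in> snd c ` (fst c \<inter> fst c')" for c c' x
  proof
    fix vs
    obtain V where V: "chart_domain V" "c = chart V" "chart_image c = V" using c(1) by (rule atlasE)
    obtain V' where V': "chart_domain V'" "c' = chart V'" "chart_image c' = V'" using c(2) by (rule atlasE)
    obtain y y' where y: "y \<in> V" "y' \<in> V'" "\<pi> y = \<pi> y'" "x = inv_into V \<pi> (\<pi> y)"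
      using x by (auto simp: V(2) V'(2) chart_def)
    have xy: "x = y" unfolding y(4) using V(1) y(1) by (simp add: chart_domain_def)
    have X: "y \<in> X" "y' \<in> X" using y V(1) V'(1) by (auto simp: chart_domain_def)
    obtain g where g: "g \<in> A" "y' = g y" using orbit_eq_iff[OF X] y(3) by blast
    have "pullback (transition c c') (push \<beta> c') x vs = pull g (push \<beta> c') x vs"
      unfolding V(2) V'(2) xy by (rule pullback_transition[OF V(1) V'(1) g(1) y(1)]) (use y(2) g(2) in simp)
    also have "\<dots> = pull g \<beta> x vs"
      using y(2) g(2) by (simp add: pull_def V'(2) xy push_chart[OF V'(1)])
    also have "\<dots> = push \<beta> c x vs"
      using y(1) invariant_forms_pull[OF assms g(1)] by (simp add: V(2) xy push_chart[OF V(1)])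
    finally show "push \<beta> c x vs = pullback (transition c c') (push \<beta> c') x vs" by simp
  qed
  ultimately show ?thesis using push_outside[of _ \<beta>] by (auto simp: forms_def zero_fun_def)
qed

lemma push_inject:
  assumes "\<beta> \<in> invariant_forms X A k" "push \<beta> = 0" shows "\<beta> = 0"
proof (intro ext)
  fix x vs
  show "\<beta> x vs = 0 x vs"
  proof (cases "x \<in> X")
    case True
    then obtain V where V: "chart_domain V" "x \<in> V" using cover by (auto simp: chart_domain_def)
    have "push \<beta> (chart V) x vs = 0" by (simp add: assms(2))
    then show ?thesis using V by (simp add: push_chart[OF V(1)])
  qed (use diff_forms_zero[OF invariant_forms_diff_forms[OF assms(1)]] in simp)
qed

text \<open>The value at \<open>x\<close> of the invariant form is read off in any chart around \<open>x\<close>. Independence of the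
  chart is compatibility for the identity, invariance is compatibility for the other elements.\<close>

lemma push_surj:
  assumes \<omega>: "\<omega> \<in> forms S k" shows "\<exists>\<beta>\<in>invariant_forms X A k. push \<beta> = \<omega>"
proof -
  have form: "\<omega> (chart V) \<in> diff_forms V k" if "chart_domain V" for V
  proof -
    have "chart V \<in> S" using that by (auto simp: atlas_eq)
    then have "is_form k (chart_image (chart V)) (\<omega> (chart V))" using \<omega> unfolding forms_def by blast
    then show ?thesis by (simp add: diff_forms_def chart_image_chart[OF that])
  qed
  have trans: "\<omega> (chart V) x vs = pull g (\<omega> (chart V')) x vs"
    if V: "chart_domain V" "chart_domain V'" and g: "g \<in> A" and x: "x \<in> V" "g x \<in> V'" for V V' g x vs
  proof -
    have "x \<in> X" "g x \<in> X" using V x by (auto simp: chart_domain_def)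
    then have "\<pi> x = \<pi> (g x)" using orbit_eq_iff g by blast
    then have "\<pi> x \<in> \<pi> ` V \<inter> \<pi> ` V'" using x by auto
    moreover have "inv_into V \<pi> (\<pi> x) = x" using x V(1) by (simp add: chart_domain_def)
    ultimately have "x \<in> snd (chart V) ` (fst (chart V) \<inter> fst (chart V'))" unfolding chart_def fst_conv snd_conv by (metis image_eqI)
    moreover have "chart V \<in> S" "chart V' \<in> S" using V by (auto simp: atlas_eq)
    ultimately have "\<omega> (chart V) x = pullback (transition (chart V) (chart V')) (\<omega> (chart V')) x"
      using \<omega> unfolding forms_def by blast
    then show ?thesis using pullback_transition[OF V g x] by simp
  qed
  define nb where "nb x = (SOME V. chart_domain V \<and> x \<in> V)" for x
  have nb: "chart_domain (nb x)" "x \<in> nb x" if "x \<in> X" for x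
    using someI_ex[of "\<lambda>V. chart_domain V \<and> x \<in> V"] cover[OF that] unfolding nb_def chart_domain_def by blast+
  define \<beta> where "\<beta> x vs = (if x \<in> X then \<omega> (chart (nb x)) x vs else 0)" for x vs
  have \<beta>: "\<beta> x vs = \<omega> (chart V) x vs" if "chart_domain V" "x \<in> V" for x vs V
  proof -
    have x: "x \<in> X" using that by (auto simp: chart_domain_def)
    show ?thesis using trans[OF that(1) nb(1)[OF x] A_id that(2)] nb(2)[OF x] x by (simp add: \<beta>_def)
  qed
  have "\<beta> \<in> diff_forms X k"
  proof (rule diff_formsI)
    show "\<beta> x vs = 0" if "x \<notin> X \<or> length vs \<noteq> k" for x vs
      using that diff_forms_zero[OF form[OF nb(1)]] by (auto simp: \<beta>_def)
    show "alternating_multilinear k (\<beta> x)" if "x \<in> X" for x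
    proof -
      have "\<beta> x = \<omega> (chart (nb x)) x" using that by (simp add: \<beta>_def fun_eq_iff)
      then show ?thesis using diff_forms_alternating[OF form[OF nb(1)[OF that]] nb(2)[OF that]] by simp
    qed
    show "smooth_on X (\<lambda>x. \<beta> x vs)" for vs
    proof (rule smooth_on_local)
      fix x assume x: "x \<in> X"
      have "open (nb x)" using nb(1)[OF x] by (simp add: chart_domain_def)
      moreover from this have "smooth_on (nb x) (\<lambda>x. \<beta> x vs)"
        using diff_forms_smooth[OF form[OF nb(1)[OF x]]] smooth_on_cong[of "nb x" "\<lambda>y. \<beta> y vs"] \<beta>[OF nb(1)[OF x]] by simp
      ultimately show "\<exists>V. open V \<and> x \<in> V \<and> smooth_on V (\<lambda>x. \<beta> x vs)" using nb(2)[OF x] by blast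
    qed
  qed
  moreover have "pull g \<beta> x vs = \<beta> x vs" if g: "g \<in> A" for g x vs
  proof (cases "x \<in> X")
    case True
    then have gx: "g x \<in> X" using A_dom[OF g] by simp
    have "\<beta> x vs = pull g (\<omega> (chart (nb (g x)))) x vs"
      using trans[OF nb(1)[OF True] nb(1)[OF gx] g nb(2)[OF True] nb(2)[OF gx]] True by (simp add: \<beta>_def)
    then show ?thesis using gx by (simp add: pull_def \<beta>_def)
  qed (simp add: pull_def \<beta>_def A_dom[OF g])
  ultimately have "\<beta> \<in> invariant_forms X A k" by (auto simp: invariant_forms_def fun_eq_iff)
  moreover have "push \<beta> c x vs = \<omega> c x vs" for c x vs
  proof (cases "c \<in> S")
    case True
    then obtain V where V: "chart_domain V" "c = chart V" "chart_image c = V" by (rule atlasE)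
    show ?thesis
      using \<beta>[OF V(1)] diff_forms_zero[OF form[OF V(1)]] by (simp add: V(2) push_chart[OF V(1)])
  next
    case False
    then have "\<omega> c = (\<lambda>x vs. 0)" using \<omega> unfolding forms_def by blast
    then show ?thesis using push_outside[OF False] by simp
  qed
  ultimately show ?thesis by (intro bexI[of _ \<beta>]) (auto simp: fun_eq_iff)
qed

lemma twisted_d_push:
  assumes "\<beta> \<in> diff_forms X k"
  shows "twisted_d (push \<eta>) (push \<beta>) = push (\<lambda>x vs. ext_deriv X \<beta> x vs - wedge1 \<eta> \<beta> x vs)"
proof (intro ext)
  fix c x vs
  let ?\<gamma> = "\<lambda>x vs. ext_deriv X \<beta> x vs - wedge1 \<eta> \<beta> x vs"
  show "twisted_d (push \<eta>) (push \<beta>) c x vs = push ?\<gamma> c x vs"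
  proof (cases "c \<in> S")
    case False
    then show ?thesis
      by (simp add: twisted_d_def push_outside wedge1_alt_sum ext_deriv_alt_sum alt_sum_zero frechet_derivative_const)
  next
    case True
    then obtain V where V: "chart_domain V" "c = chart V" "chart_image c = V" by (rule atlasE)
    have oV: "open V" "V \<subseteq> X" using V(1) by (auto simp: chart_domain_def)
    show ?thesis
    proof (cases "x \<in> V")
      case True
      have "frechet_derivative (\<lambda>y. push \<beta> c y ws) (at x) = frechet_derivative (\<lambda>y. \<beta> y ws) (at x)" for ws
        by (rule frechet_derivative_cong_open(1)[OF oV(1) True]) (simp add: V(2) push_chart[OF V(1)])
      moreover have "wedge1 (push \<eta> c) (push \<beta> c) x vs = wedge1 \<eta> \<beta> x vs"
        using True by (simp add: wedge1_alt_sum V(2) push_chart[OF V(1)])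
      moreover have "x \<in> X" using True oV by blast
      ultimately show ?thesis
        using True by (simp add: twisted_d_def V(3) ext_deriv_alt_sum) (simp add: V(2) push_chart[OF V(1)] ext_deriv_alt_sum)
    next
      case False
      then show ?thesis
        by (simp add: twisted_d_def V(3) ext_deriv_alt_sum wedge1_alt_sum)
           (simp add: V(2) push_chart[OF V(1)] alt_sum_zero)
    qed
  qed
qed

end

section \<open>Reading off the cohomology\<close>

lemma mform_operations: "mform_zero = 0" "mform_add = (+)" "mform_scale = (*\<^sub>R)"
  by (simp_all add: mform_zero_def mform_add_def mform_scale_def fun_eq_iff)

lemma coh_class_iff:
  assumes "subspace (coboundaries A \<eta> k)" "\<omega> \<in> cocycles A \<eta> k"
  shows "\<omega>' \<in> coh_class A \<eta> k \<omega> \<longleftrightarrow> \<omega>' \<in> cocycles A \<eta> k \<and> \<omega>' - \<omega> \<in> coboundaries A \<eta> k"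
proof -
  have "(\<exists>\<beta>\<in>coboundaries A \<eta> k. \<omega>' = \<omega> + \<beta>) \<longleftrightarrow> \<omega>' - \<omega> \<in> coboundaries A \<eta> k"
    by (metis add_diff_cancel_left' add.commute diff_add_cancel)
  then show ?thesis using assms(2) by (auto simp: coh_class_def cohomologous_def mform_operations)
qed

text \<open>\<open>\<psi>\<close> parametrises a complement of the coboundaries in the cocycles. The isomorphism maps a
  cohomology class to the parameter of the unique element of the complement that it contains.\<close>

lemma cohomology_iso_of_complement:
  fixes \<psi> :: "'v::real_vector \<Rightarrow> ('m, 'a::euclidean_space) mform"
  assumes Z: "subspace (cocycles A \<eta> k)" and B: "subspace (coboundaries A \<eta> k)" "coboundaries A \<eta> k \<subseteq> cocycles A \<eta> k"
    and \<psi>: "linear \<psi>" "\<And>v. \<psi> v \<in> cocycles A \<eta> k" "\<And>v. \<psi> v \<in> coboundaries A \<eta> k \<Longrightarrow> v = 0"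
    and span: "\<And>z. z \<in> cocycles A \<eta> k \<Longrightarrow> \<exists>v. z - \<psi> v \<in> coboundaries A \<eta> k"
  shows "\<exists>F :: _ \<Rightarrow> 'v. cohomology_iso A \<eta> k F"
proof -
  note iff = coh_class_iff[OF B(1)]
  define F where "F C = (THE v. \<psi> v \<in> C)" for C
  have F: "F (coh_class A \<eta> k z) = v \<longleftrightarrow> z - \<psi> v \<in> coboundaries A \<eta> k" if z: "z \<in> cocycles A \<eta> k" for z v
  proof -
    have mem: "\<psi> v \<in> coh_class A \<eta> k z \<longleftrightarrow> z - \<psi> v \<in> coboundaries A \<eta> k" for v
      using iff[OF z] \<psi>(2) subspace_neg[OF B(1)] by (metis minus_diff_eq)
    have uniq: "v = v'" if "z - \<psi> v \<in> coboundaries A \<eta> k" "z - \<psi> v' \<in> coboundaries A \<eta> k" for v v'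
    proof -
      have "\<psi> (v' - v) \<in> coboundaries A \<eta> k"
        using subspace_diff[OF B(1) that] by (simp add: linear_diff[OF \<psi>(1)])
      then show ?thesis using \<psi>(3) by fastforce
    qed
    obtain w where w: "z - \<psi> w \<in> coboundaries A \<eta> k" using span[OF z] by blast
    have "F (coh_class A \<eta> k z) = w" unfolding F_def mem using w uniq by blast
    then show ?thesis using w uniq by blast
  qed
  have classes: "cohomology A \<eta> k = coh_class A \<eta> k ` cocycles A \<eta> k"
    by (auto simp: cohomology_def quotient_def coh_class_def)
  have "inj_on F (cohomology A \<eta> k)"
    unfolding classes
  proof (intro inj_onI)
    fix C C' assume "C \<in> coh_class A \<eta> k ` cocycles A \<eta> k" "C' \<in> coh_class A \<eta> k ` cocycles A \<eta> k" and eq: "F C = F C'"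
    then obtain z z' where z: "z \<in> cocycles A \<eta> k" "C = coh_class A \<eta> k z" "z' \<in> cocycles A \<eta> k" "C' = coh_class A \<eta> k z'" by blast
    then have "z - \<psi> (F C) \<in> coboundaries A \<eta> k" "z' - \<psi> (F C) \<in> coboundaries A \<eta> k" using F eq by metis+
    from subspace_diff[OF B(1) this] have zz: "z - z' \<in> coboundaries A \<eta> k" by simp
    have "y - z \<in> coboundaries A \<eta> k \<longleftrightarrow> y - z' \<in> coboundaries A \<eta> k" for y
      using subspace_add[OF B(1) _ zz, of "y - z"] subspace_diff[OF B(1) _ zz, of "y - z'"] by auto
    then show "C = C'" using iff[OF z(1)] iff[OF z(3)] z(2,4) by blast
  qed
  moreover have "F ` cohomology A \<eta> k = UNIV"
  proof -
    have "F (coh_class A \<eta> k (\<psi> v)) = v" for v using F[OF \<psi>(2)] subspace_0[OF B(1)] by simp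
    then show ?thesis unfolding classes using \<psi>(2) by (metis UNIV_eq_I image_eqI)
  qed
  moreover have "F (coh_class A \<eta> k (z + z')) = F (coh_class A \<eta> k z) + F (coh_class A \<eta> k z')"
    if z: "z \<in> cocycles A \<eta> k" "z' \<in> cocycles A \<eta> k" for z z'
  proof -
    have "(z - \<psi> (F (coh_class A \<eta> k z))) + (z' - \<psi> (F (coh_class A \<eta> k z'))) \<in> coboundaries A \<eta> k"
      using F[OF z(1)] F[OF z(2)] by (intro subspace_add[OF B(1)]) blast+
    then show ?thesis using F[OF subspace_add[OF Z z]] by (simp add: linear_add[OF \<psi>(1)] add_diff_add)
  qed
  moreover have "F (coh_class A \<eta> k (r *\<^sub>R z)) = r *\<^sub>R F (coh_class A \<eta> k z)" if z: "z \<in> cocycles A \<eta> k" for r z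
  proof -
    have "r *\<^sub>R (z - \<psi> (F (coh_class A \<eta> k z))) \<in> coboundaries A \<eta> k"
      using F[OF z] by (intro subspace_scale[OF B(1)]) blast
    then show ?thesis using F[OF subspace_scale[OF Z z, of r]] by (simp add: linear_cmul[OF \<psi>(1)] scaleR_diff_right)
  qed
  ultimately show ?thesis by (auto simp: cohomology_iso_def bij_betw_def mform_operations)
qed

lemma cohomology_trivial:
  assumes B: "subspace (coboundaries A \<eta> k)" "coboundaries A \<eta> k = cocycles A \<eta> k"
  shows "cohomology A \<eta> k = {coh_class A \<eta> k mform_zero}"
proof -
  have 0: "0 \<in> cocycles A \<eta> k" using B subspace_0 by metis
  have "coh_class A \<eta> k z = cocycles A \<eta> k" if "z \<in> cocycles A \<eta> k" for z
  proof (rule Set.set_eqI)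
    show "y \<in> coh_class A \<eta> k z \<longleftrightarrow> y \<in> cocycles A \<eta> k" for y
      using coh_class_iff[OF B(1) that, of y] subspace_diff[OF B(1), of y z] that unfolding B(2) by blast
  qed
  then have "coh_class A \<eta> k z = coh_class A \<eta> k 0" if "z \<in> cocycles A \<eta> k" for z using that 0 by simp
  then have "coh_class A \<eta> k ` cocycles A \<eta> k = {coh_class A \<eta> k 0}" using 0 by blast
  moreover have "cohomology A \<eta> k = coh_class A \<eta> k ` cocycles A \<eta> k"
    by (auto simp: cohomology_def quotient_def coh_class_def)
  ultimately show ?thesis by (simp add: mform_operations)
qed

context inoue_data
begin

section \<open>The Inoue surface as a quotient\<close>

lemma alpha_pos: "\<alpha> > 0" "\<alpha> \<noteq> 0"
  using alpha by auto

lemma dil_powi_step: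
  "dil (\<alpha> powi (n + 1)) = dil \<alpha> \<circ> dil (\<alpha> powi n)" "dil (\<alpha> powi (n - 1)) = dil (1 / \<alpha>) \<circ> dil (\<alpha> powi n)"
  using alpha_pos by (simp_all add: dil_compose power_int_add power_int_diff field_simps)

lemma dil_powi_conj_lattice: "g \<in> lattice \<Longrightarrow> \<exists>g'\<in>lattice. dil (\<alpha> powi n) \<circ> g = g' \<circ> dil (\<alpha> powi n)"
proof (induction n arbitrary: g rule: int_induct[where k=0])
  case base
  then show ?case by (intro bexI[of _ g]) (simp_all add: dil_compose)
next
  case (step1 n)
  then obtain g' where g': "g' \<in> lattice" "dil (\<alpha> powi n) \<circ> g = g' \<circ> dil (\<alpha> powi n)" by blast
  obtain g'' where g'': "g'' \<in> lattice" "dil \<alpha> \<circ> g' = g'' \<circ> dil \<alpha>" using dil_conj_lattice[OF g'(1)] by blast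
  have "dil (\<alpha> powi (n + 1)) \<circ> g = g'' \<circ> dil (\<alpha> powi (n + 1))"
    unfolding dil_powi_step using g'(2) g''(2) by (metis comp_assoc)
  then show ?case using g''(1) by blast
next
  case (step2 n)
  then obtain g' where g': "g' \<in> lattice" "dil (\<alpha> powi n) \<circ> g = g' \<circ> dil (\<alpha> powi n)" by blast
  obtain g'' where g'': "g'' \<in> lattice" "dil (1 / \<alpha>) \<circ> g' = g'' \<circ> dil (1 / \<alpha>)"
    using dil_inverse_conj_lattice[OF g'(1)] by blast
  have "dil (\<alpha> powi (n - 1)) \<circ> g = g'' \<circ> dil (\<alpha> powi (n - 1))"
    unfolding dil_powi_step using g'(2) g''(2) by (metis comp_assoc)
  then show ?case using g''(1) by blast
qed

text \<open>Every element of the group is the restriction of one of these maps, since \<open>g\<^sub>0\<close> normalises the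
  lattice.\<close>

definition deck :: "(R4 \<Rightarrow> R4) set" where
  "deck = {g \<circ> dil (\<alpha> powi n) | g n. g \<in> lattice}"

lemma deckI: "g \<in> lattice \<Longrightarrow> g \<circ> dil (\<alpha> powi n) \<in> deck"
  unfolding deck_def by blast

lemma dil_powi_add: "dil (\<alpha> powi m) \<circ> dil (\<alpha> powi n) = dil (\<alpha> powi (m + n))"
  using alpha_pos by (simp add: dil_compose power_int_add)

lemma deck_compose: assumes "g \<in> deck" "h \<in> deck" shows "g \<circ> h \<in> deck"
proof -
  obtain k m k' n where g: "g = k \<circ> dil (\<alpha> powi m)" "k \<in> lattice" and h: "h = k' \<circ> dil (\<alpha> powi n)" "k' \<in> lattice"
    using assms unfolding deck_def by blast
  obtain l where l: "l \<in> lattice" "dil (\<alpha> powi m) \<circ> k' = l \<circ> dil (\<alpha> powi m)" using dil_powi_conj_lattice[OF h(2)] by blast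
  have "g \<circ> h = (k \<circ> l) \<circ> dil (\<alpha> powi (m + n))"
    unfolding g h using l(2) dil_powi_add[of m n] by (metis comp_assoc)
  then show ?thesis using deckI[OF lattice_compose[OF g(2) l(1)]] by metis
qed

lemma deck_inverse: assumes "g \<in> deck" shows "\<exists>h\<in>deck. h \<circ> g = id \<and> g \<circ> h = id"
proof -
  obtain k n where g: "g = k \<circ> dil (\<alpha> powi n)" "k \<in> lattice" using assms unfolding deck_def by blast
  obtain k' where k': "k' \<in> lattice" "k \<circ> k' = id" "k' \<circ> k = id" using lattice_inverse[OF g(2)] by blast
  obtain l where l: "l \<in> lattice" "dil (\<alpha> powi (- n)) \<circ> k' = l \<circ> dil (\<alpha> powi (- n))"
    using dil_powi_conj_lattice[OF k'(1)] by blast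
  have d: "dil (\<alpha> powi n) \<circ> dil (\<alpha> powi (- n)) = id" "dil (\<alpha> powi (- n)) \<circ> dil (\<alpha> powi n) = id"
    unfolding dil_powi_add by (simp_all add: dil_compose)
  let ?h = "dil (\<alpha> powi (- n)) \<circ> k'"
  have "?h \<circ> g = dil (\<alpha> powi (- n)) \<circ> (k' \<circ> k) \<circ> dil (\<alpha> powi n)" unfolding g by (simp only: comp_assoc)
  then have 1: "?h \<circ> g = id" using k'(3) d(2) by simp
  have "g \<circ> ?h = k \<circ> (dil (\<alpha> powi n) \<circ> dil (\<alpha> powi (- n))) \<circ> k'" unfolding g by (simp only: comp_assoc)
  then have 2: "g \<circ> ?h = id" using k'(2) d(1) by simp
  show ?thesis using 1 2 deckI[OF l(1), of "- n"] l(2) by metis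
qed

lemma deck_affine: "g \<in> deck \<Longrightarrow> affine_map g"
  unfolding deck_def lattice_def using affine_map_compose affine_lat affine_dil by blast

lemma deck_dom: "g \<in> deck \<Longrightarrow> g x \<in> inoue_cover \<longleftrightarrow> x \<in> inoue_cover"
  unfolding deck_def lattice_def using alpha_pos by (auto simp: lat_in_cover dil_in_cover)

lemma generators_in_deck: "{dil \<alpha>, g1, g2, g3} \<subseteq> deck" "id \<in> deck"
proof -
  have "lat m1 m2 m3 \<in> deck" for m1 m2 m3 using deckI[OF lat_in_lattice, of _ _ _ 0] by (simp add: dil_compose)
  moreover have "dil \<alpha> \<in> deck" using deckI[OF lat_in_lattice[of 0 0 0], of 1] by (simp add: lat_0)
  ultimately show "{dil \<alpha>, g1, g2, g3} \<subseteq> deck" "id \<in> deck" unfolding lat_0[symmetric] by blast+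
qed

definition G :: "(R4 \<Rightarrow> R4) set" where
  "G = generate (BijGroup inoue_cover) ((\<lambda>g. restrict g inoue_cover) ` {dil \<alpha>, g1, g2, g3})"

lemma deck_Bij: assumes "g \<in> deck" shows "restrict g inoue_cover \<in> Bij inoue_cover"
proof -
  obtain h where h: "h \<in> deck" "h \<circ> g = id" "g \<circ> h = id" using deck_inverse[OF assms] by blast
  have "bij_betw g inoue_cover inoue_cover"
    by (rule bij_betw_byWitness[where f'=h])
       (use h deck_dom[OF assms] deck_dom[OF h(1)] in \<open>auto simp: fun_eq_iff\<close>)
  then show ?thesis by (simp add: Bij_def)
qed

lemma deck_mult:
  assumes "g \<in> deck" "h \<in> deck"
  shows "restrict g inoue_cover \<otimes>\<^bsub>BijGroup inoue_cover\<^esub> restrict h inoue_cover = restrict (g \<circ> h) inoue_cover"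
  using deck_Bij[OF assms(1)] deck_Bij[OF assms(2)] deck_dom[OF assms(2)]
  by (auto simp: BijGroup_def compose_def fun_eq_iff)

lemma deck_inv:
  assumes "g \<in> deck" "h \<in> deck" "h \<circ> g = id"
  shows "inv\<^bsub>BijGroup inoue_cover\<^esub> (restrict g inoue_cover) = restrict h inoue_cover"
proof (rule group.inv_equality[OF group_BijGroup])
  show "restrict h inoue_cover \<otimes>\<^bsub>BijGroup inoue_cover\<^esub> restrict g inoue_cover = \<one>\<^bsub>BijGroup inoue_cover\<^esub>"
    unfolding deck_mult[OF assms(2,1)] assms(3) by (auto simp: BijGroup_def)
qed (use deck_Bij assms in \<open>auto simp: BijGroup_def\<close>)

lemma G_subset: "f \<in> G \<Longrightarrow> \<exists>g\<in>deck. f = restrict g inoue_cover"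
  unfolding G_def
proof (induction rule: generate.induct)
  case one
  have "\<one>\<^bsub>BijGroup inoue_cover\<^esub> = restrict id inoue_cover" by (auto simp: BijGroup_def)
  then show ?case using generators_in_deck(2) by blast
next
  case (incl h)
  then show ?case using generators_in_deck(1) by blast
next
  case (inv h)
  then obtain g where g: "g \<in> deck" "h = restrict g inoue_cover" using generators_in_deck(1) by blast
  obtain g' where "g' \<in> deck" "g' \<circ> g = id" using deck_inverse[OF g(1)] by blast
  then show ?case using deck_inv[OF g(1)] g(2) by blast
next
  case (eng h h')
  then show ?case using deck_mult deck_compose by metis
qed

text \<open>The elements of \<open>deck\<close> that act on the cover as elements of the group: a set of affine maps
  that is closed under composition and inverses and has the orbits of the group.\<close>

definition Gdeck :: "(R4 \<Rightarrow> R4) set" where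
  "Gdeck = {g \<in> deck. restrict g inoue_cover \<in> G}"

lemma Gdeck_deck: "g \<in> Gdeck \<Longrightarrow> g \<in> deck"
  by (simp add: Gdeck_def)

lemma Gdeck_generators: "{dil \<alpha>, g1, g2, g3} \<subseteq> Gdeck"
  using generators_in_deck(1) unfolding Gdeck_def G_def by (auto intro!: generate.incl)

text \<open>Proper discontinuity: \<open>s\<close> is shifted by the exponent of \<open>g\<^sub>0\<close>, and if that is \<open>0\<close>, then \<open>l\<^sub>1\<close> and \<open>l\<^sub>2\<close>
  are shifted by \<open>m1\<close> and \<open>m2\<close>, and if these are \<open>0\<close> as well, \<open>x\<close> is shifted by \<open>\<kappa> m3\<close>.\<close>

lemma deck_small_displacement:
  assumes g: "g \<in> deck" and y: "y \<in> inoue_cover"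
    and "\<bar>s_of (g y) - s_of y\<bar> < 1" "\<bar>l1 (g y) - l1 y\<bar> < 1" "\<bar>l2 (g y) - l2 y\<bar> < 1" "\<bar>x_of (g y) - x_of y\<bar> < \<bar>\<kappa>\<bar>"
  shows "g y = y"
proof -
  obtain m1 m2 m3 n where eq: "g = lat m1 m2 m3 \<circ> dil (\<alpha> powi n)" using g unfolding deck_def lattice_def by blast
  have "s_of (dil (\<alpha> powi n) y) = s_of y + of_int n"
  proof -
    have "t_of y > 0" using y by (simp add: inoue_cover_eq)
    then have "ln (\<alpha> powi n * t_of y) = of_int n * ln \<alpha> + ln (t_of y)"
      using alpha_pos by (simp add: ln_mult ln_powr flip: powr_real_of_int')
    moreover have "t_of (dil (\<alpha> powi n) y) = \<alpha> powi n * t_of y" by (cases y) (simp add: dil_def)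
    ultimately show ?thesis using ln_alpha by (simp add: s_of_def add_divide_distrib)
  qed
  then have "\<bar>real_of_int n\<bar> < 1" using assms(3) by (simp add: eq s_of_lat)
  then have n: "n = 0" by linarith
  then have eq': "g = lat m1 m2 m3" by (simp add: eq dil_compose)
  have "\<bar>real_of_int m1\<bar> < 1" "\<bar>real_of_int m2\<bar> < 1" using assms(4,5) by (simp_all add: eq' l_lat[OF y])
  then have m: "m1 = 0" "m2 = 0" by linarith+
  have "x_of (g y) = x_of y + \<kappa> * of_int m3" by (simp add: eq' m lat_def x_of_heis Q_def)
  then have "\<bar>\<kappa>\<bar> * \<bar>real_of_int m3\<bar> < \<bar>\<kappa>\<bar> * 1" using assms(6) by (simp add: abs_mult)
  then have "\<bar>real_of_int m3\<bar> < 1"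
    using mult_less_cancel_left_pos[of "\<bar>\<kappa>\<bar>" "\<bar>real_of_int m3\<bar>" 1] kappa(1) by simp
  then have "m3 = 0" by linarith
  then show ?thesis by (simp add: eq' m lat_0)
qed

lemma Gdeck_id: "id \<in> Gdeck"
proof -
  have "restrict id inoue_cover = \<one>\<^bsub>BijGroup inoue_cover\<^esub>" by (auto simp: BijGroup_def)
  then show ?thesis using generators_in_deck(2) generate.one unfolding Gdeck_def G_def by auto
qed

lemma Gdeck_compose: "g \<in> Gdeck \<Longrightarrow> h \<in> Gdeck \<Longrightarrow> g \<circ> h \<in> Gdeck"
  unfolding Gdeck_def G_def using deck_compose deck_mult generate.eng by (metis (no_types, lifting) mem_Collect_eq)

lemma Gdeck_inverse: assumes "g \<in> Gdeck" shows "\<exists>h\<in>Gdeck. h \<circ> g = id"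
proof -
  obtain h where h: "h \<in> deck" "h \<circ> g = id" using deck_inverse[OF Gdeck_deck[OF assms]] by blast
  have "(\<lambda>g. restrict g inoue_cover) ` {dil \<alpha>, g1, g2, g3} \<subseteq> carrier (BijGroup inoue_cover)"
    using generators_in_deck(1) deck_Bij by (auto simp: BijGroup_def)
  then have "inv\<^bsub>BijGroup inoue_cover\<^esub> (restrict g inoue_cover) \<in> G"
    using assms unfolding G_def by (intro group.generate_m_inv_closed[OF group_BijGroup]) (auto simp: Gdeck_def G_def)
  then have "h \<in> Gdeck" using h deck_inv[OF Gdeck_deck[OF assms] h] by (simp add: Gdeck_def)
  then show ?thesis using h(2) by blast
qed

lemma orbit_Gdeck: "x \<in> inoue_cover \<Longrightarrow> orbit_map G x = (\<lambda>g. g x) ` Gdeck"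
proof (intro equalityI subsetI)
  fix y assume x: "x \<in> inoue_cover" and "y \<in> orbit_map G x"
  then obtain f where f: "f \<in> G" "y = f x" unfolding orbit_map_def by blast
  then obtain g where "g \<in> deck" "f = restrict g inoue_cover" using G_subset by blast
  then show "y \<in> (\<lambda>g. g x) ` Gdeck" using f x by (auto simp: Gdeck_def)
next
  fix y assume x: "x \<in> inoue_cover" and "y \<in> (\<lambda>g. g x) ` Gdeck"
  then obtain g where g: "g \<in> deck" "restrict g inoue_cover \<in> G" "y = g x" unfolding Gdeck_def by blast
  then have "y = restrict g inoue_cover x" using x by simp
  then show "y \<in> orbit_map G x" unfolding orbit_map_def using g(2) by blast
qed

lemma cover_by_charts:
  assumes x: "x \<in> inoue_cover"
  shows "\<exists>V. open V \<and> x \<in> V \<and> V \<subseteq> inoue_cover \<and> inj_on (orbit_map G) V"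
proof -
  define V where "V = {z \<in> inoue_cover. \<bar>s_of z - s_of x\<bar> < 1/2} \<inter> {z \<in> inoue_cover. \<bar>l1 z - l1 x\<bar> < 1/2}
     \<inter> {z \<in> inoue_cover. \<bar>l2 z - l2 x\<bar> < 1/2} \<inter> {z \<in> inoue_cover. \<bar>x_of z - x_of x\<bar> < \<bar>\<kappa>\<bar> / 2}"
  have op: "open {z \<in> inoue_cover. \<bar>f z - f x\<bar> < r}" if "smooth_on inoue_cover f" for f and r :: real
  proof -
    have "open (inoue_cover \<inter> f -` ball (f x) r)"
      by (rule continuous_open_preimage[OF smooth_on_imp_continuous_on[OF that] open_inoue_cover open_ball])
    moreover have "inoue_cover \<inter> f -` ball (f x) r = {z \<in> inoue_cover. \<bar>f z - f x\<bar> < r}"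
      by (auto simp: dist_real_def abs_minus_commute)
    ultimately show ?thesis by simp
  qed
  have "open V" unfolding V_def by (intro open_Int op smooth_s_of smooth_l smooth_coordinates)
  moreover have "x \<in> V" "V \<subseteq> inoue_cover" using x kappa(1) by (auto simp: V_def)
  moreover have "inj_on (orbit_map G) V"
  proof (rule inj_onI)
    fix y z assume yz: "y \<in> V" "z \<in> V" "orbit_map G y = orbit_map G z"
    then have y: "y \<in> inoue_cover" and z: "z \<in> inoue_cover" by (auto simp: V_def)
    have "id z \<in> orbit_map G z" unfolding orbit_Gdeck[OF z] using Gdeck_id by blast
    then have "z \<in> (\<lambda>g. g y) ` Gdeck" using yz(3) orbit_Gdeck[OF y] by simp
    then obtain g where g: "g \<in> Gdeck" "z = g y" by blast
    have ny: "\<bar>s_of y - s_of x\<bar> < 1/2" "\<bar>l1 y - l1 x\<bar> < 1/2" "\<bar>l2 y - l2 x\<bar> < 1/2" "\<bar>x_of y - x_of x\<bar> < \<bar>\<kappa>\<bar> / 2"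
      and nz: "\<bar>s_of z - s_of x\<bar> < 1/2" "\<bar>l1 z - l1 x\<bar> < 1/2" "\<bar>l2 z - l2 x\<bar> < 1/2" "\<bar>x_of z - x_of x\<bar> < \<bar>\<kappa>\<bar> / 2"
      using yz(1,2) unfolding V_def by blast+
    have tri: "\<bar>u - v\<bar> < e" if "\<bar>u - c\<bar> < e / 2" "\<bar>v - c\<bar> < e / 2" for u v c e :: real
      using that unfolding abs_less_iff by linarith
    have "g y = y"
    proof (rule deck_small_displacement[OF Gdeck_deck[OF g(1)] y])
      show "\<bar>s_of (g y) - s_of y\<bar> < 1" unfolding g(2)[symmetric] by (rule tri[OF nz(1) ny(1)])
      show "\<bar>l1 (g y) - l1 y\<bar> < 1" unfolding g(2)[symmetric] by (rule tri[OF nz(2) ny(2)])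
      show "\<bar>l2 (g y) - l2 y\<bar> < 1" unfolding g(2)[symmetric] by (rule tri[OF nz(3) ny(3)])
      show "\<bar>x_of (g y) - x_of y\<bar> < \<bar>\<kappa>\<bar>" unfolding g(2)[symmetric] by (rule tri[OF nz(4) ny(4)])
    qed
    then show "y = z" using g(2) by simp
  qed
  ultimately show ?thesis by blast
qed

sublocale quot: affine_quotient inoue_cover G Gdeck
proof (rule affine_quotient.intro)
  show "open inoue_cover" by (rule open_inoue_cover)
  show "affine_map g" if "g \<in> Gdeck" for g by (rule deck_affine[OF Gdeck_deck[OF that]])
  show "g x \<in> inoue_cover \<longleftrightarrow> x \<in> inoue_cover" if "g \<in> Gdeck" for g x by (rule deck_dom[OF Gdeck_deck[OF that]])
qed (rule Gdeck_id, erule (1) Gdeck_compose, erule Gdeck_inverse, erule orbit_Gdeck, erule cover_by_charts)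

section \<open>Untwisting\<close>

text \<open>The local sections of the kernel of \<open>d\<^sub>\<theta>\<close> on functions are the multiples of \<open>t\<close>. Division by \<open>t\<close> turns
  \<open>d\<^sub>\<theta>\<close> into \<open>d\<close>, and invariance under \<open>g\<^sub>0\<close> into the condition \<open>\<alpha> g\<^sub>0\<^sup>* \<gamma> = \<gamma>\<close>.\<close>

definition untwist :: "R4 form \<Rightarrow> (R4 set, R4) mform" where
  "untwist \<gamma> = quot.push (fun_mult (\<lambda>z. t_of z) \<gamma>)"

abbreviation \<theta> :: "(R4 set, R4) mform" where "\<theta> \<equiv> quot.push dt_over_t"

lemma linear_untwist: "linear untwist"
proof -
  have "linear (fun_mult (\<lambda>z. t_of z))" by (intro linearI) (auto simp: fun_eq_iff algebra_simps)
  from linear_compose[OF this quot.linear_push] show ?thesis by (simp add: untwist_def[abs_def] o_def)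
qed

lemma t_of_lattice: "g \<in> lattice \<Longrightarrow> t_of (g z) = t_of z"
  by (cases z) (auto simp: lattice_def lat_def heis_def)

lemma t_of_dil: "t_of (dil s z) = s * t_of z"
  by (cases z) (simp add: dil_def)

lemma fun_mult_t_invariant:
  assumes "\<gamma> \<in> L4.fixed k"
  shows "fun_mult (\<lambda>z. t_of z) \<gamma> \<in> invariant_forms inoue_cover Gdeck k"
proof -
  have \<gamma>: "\<gamma> \<in> invariant_forms inoue_cover {g2, g1, g3} k" "\<alpha> *\<^sub>R pull (dil \<alpha>) \<gamma> = \<gamma>"
    using assms by (simp_all add: L4.fixed_def)
  let ?\<omega> = "fun_mult (\<lambda>z. t_of z) \<gamma>"
  have lattice: "pull g ?\<omega> = ?\<omega>" if "g \<in> lattice" for g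
    using t_of_lattice[OF that] by (simp add: pull_fun_mult pull_lattice[OF \<gamma>(1) that] fun_eq_iff)
  have "pull (dil \<alpha>) ?\<omega> = fun_mult (\<lambda>z. t_of z) (\<alpha> *\<^sub>R pull (dil \<alpha>) \<gamma>)"
    by (simp add: pull_fun_mult fun_eq_iff t_of_dil)
  then have dil: "pull (dil \<alpha>) ?\<omega> = ?\<omega>" by (simp only: \<gamma>(2))
  have powi: "pull (dil (\<alpha> powi n)) ?\<omega> = ?\<omega>" for n
    by (rule pull_powers[of "\<lambda>n. dil (\<alpha> powi n)"])
       (simp_all add: affine_dil dil_compose(2) dil_powi_step(1) dil del: dil_compose(1))
  have "pull g ?\<omega> = ?\<omega>" if g: "g \<in> Gdeck" for g
  proof -
    obtain k n where k: "g = k \<circ> dil (\<alpha> powi n)" "k \<in> lattice" using Gdeck_deck[OF g] unfolding deck_def by blast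
    have "affine_map k" using k(2) affine_lat by (auto simp: lattice_def)
    from pull_compose[OF this, of "dil (\<alpha> powi n)" ?\<omega>] show ?thesis unfolding k(1) lattice[OF k(2)] powi by simp
  qed
  moreover have "?\<omega> \<in> diff_forms inoue_cover k"
    by (rule fun_mult_in_diff_forms[OF open_inoue_cover smooth_coordinates(4) invariant_forms_diff_forms[OF \<gamma>(1)]])
  ultimately show ?thesis by (simp add: invariant_forms_def)
qed

lemma fun_mult_t_surj:
  assumes "\<omega> \<in> invariant_forms inoue_cover Gdeck k"
  shows "\<exists>\<gamma>\<in>L4.fixed k. fun_mult (\<lambda>z. t_of z) \<gamma> = \<omega>"
proof -
  let ?f = "\<lambda>z. inverse (t_of z)"
  note \<omega> = invariant_forms_diff_forms[OF assms]
  have t: "t_of z > 0" if "z \<in> inoue_cover" for z using that by (simp add: inoue_cover_eq)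
  have f: "smooth_on inoue_cover ?f" by (rule smooth_on_inverse[OF open_inoue_cover smooth_coordinates(4) t])
  have inv: "pull g \<omega> = \<omega>" if "g \<in> {dil \<alpha>, g1, g2, g3}" for g
    using that Gdeck_generators invariant_forms_pull[OF assms] by blast
  have "pull g (fun_mult ?f \<omega>) = fun_mult ?f \<omega>" if "g \<in> {g2, g1, g3}" for g
  proof -
    have "t_of (g z) = t_of z" for z using that t_of_lattice lat_in_lattice by blast
    then have "?f \<circ> g = ?f" by (simp add: fun_eq_iff)
    moreover have "pull g \<omega> = \<omega>" using inv that by blast
    ultimately show ?thesis by (simp only: pull_fun_mult)
  qed
  then have "fun_mult ?f \<omega> \<in> invariant_forms inoue_cover {g2, g1, g3} k"
    using fun_mult_in_diff_forms[OF open_inoue_cover f \<omega>] by (simp add: invariant_forms_def)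
  moreover have "\<alpha> *\<^sub>R pull (dil \<alpha>) (fun_mult ?f \<omega>) = fun_mult ?f \<omega>"
  proof -
    have "pull (dil \<alpha>) \<omega> = \<omega>" using inv by blast
    then show ?thesis
      using alpha_pos by (simp only: pull_fun_mult) (simp add: fun_eq_iff t_of_dil)
  qed
  ultimately have "fun_mult ?f \<omega> \<in> L4.fixed k" by (simp add: L4.fixed_def)
  moreover have "t_of z * (inverse (t_of z) * \<omega> z vs) = \<omega> z vs" for z vs
    using t[of z] diff_forms_zero[OF \<omega>, of z vs] by (cases "z \<in> inoue_cover") (simp_all add: field_simps)
  then have "fun_mult (\<lambda>z. t_of z) (fun_mult ?f \<omega>) = \<omega>" by (simp add: fun_eq_iff)
  ultimately show ?thesis by blast
qed

lemma fixed_diff_forms: "\<gamma> \<in> L4.fixed k \<Longrightarrow> \<gamma> \<in> diff_forms inoue_cover k"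
  by (simp add: L4.fixed_def invariant_forms_def)

lemma dR_fixed: "\<gamma> \<in> L4.fixed k \<Longrightarrow> dR \<gamma> \<in> L4.fixed (Suc k)"
  by (rule cochain_complex.d_in[OF L4.cochain_complex_fixed])

lemma untwist_inject:
  assumes "\<gamma> \<in> L4.fixed k" "untwist \<gamma> = 0" shows "\<gamma> = 0"
proof -
  have 0: "fun_mult (\<lambda>z. t_of z) \<gamma> = 0"
    using quot.push_inject[OF fun_mult_t_invariant[OF assms(1)]] assms(2) by (simp add: untwist_def)
  have "\<gamma> z vs = 0" for z vs
  proof (cases "z \<in> inoue_cover")
    case True
    have "fun_mult (\<lambda>z. t_of z) \<gamma> z vs = 0" by (simp add: 0)
    then show ?thesis using True by (simp add: inoue_cover_eq)
  qed (use diff_forms_zero[OF fixed_diff_forms[OF assms(1)]] in simp)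
  then show ?thesis by (simp add: fun_eq_iff)
qed

lemma untwist_image: "untwist ` L4.fixed k = forms quot.S k"
proof (intro equalityI subsetI)
  fix \<omega> assume "\<omega> \<in> untwist ` L4.fixed k"
  then show "\<omega> \<in> forms quot.S k" using quot.push_in_forms[OF fun_mult_t_invariant] by (auto simp: untwist_def)
next
  fix \<omega> assume "\<omega> \<in> forms quot.S k"
  then obtain \<beta> where "\<beta> \<in> invariant_forms inoue_cover Gdeck k" "quot.push \<beta> = \<omega>" using quot.push_surj by blast
  then show "\<omega> \<in> untwist ` L4.fixed k" using fun_mult_t_surj by (force simp: untwist_def)
qed

text \<open>\<open>d\<^sub>\<theta> (t \<gamma>) = dt \<and> \<gamma> + t d\<gamma> - (dt / t) \<and> t \<gamma> = t d\<gamma>\<close>.\<close>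

lemma twisted_d_untwist:
  assumes "\<gamma> \<in> L4.fixed k"
  shows "twisted_d \<theta> (untwist \<gamma>) = untwist (dR \<gamma>)"
proof -
  let ?t = "\<lambda>z. t_of z"
  note \<gamma> = fixed_diff_forms[OF assms]
  have "wedge1 dt_over_t (fun_mult ?t \<gamma>) z vs = wedge1 (df ?t) \<gamma> z vs" for z vs
  proof (cases "z \<in> inoue_cover")
    case True
    have "dt_over_t z [v] * t_of z = df ?t z [v]" for v
      using True df_eval[OF bounded_linear_imp_has_derivative[OF bounded_linear_coordinates(4)] True]
      by (cases z; cases v) (auto simp: dt_over_t_def inoue_cover_eq)
    then show ?thesis by (simp add: wedge1_alt_sum mult.assoc[symmetric])
  next
    case False
    then show ?thesis by (simp add: wedge1_alt_sum diff_forms_zero[OF \<gamma>] alt_sum_zero)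
  qed
  then have "(\<lambda>z vs. dR (fun_mult ?t \<gamma>) z vs - wedge1 dt_over_t (fun_mult ?t \<gamma>) z vs) = fun_mult ?t (dR \<gamma>)"
    by (simp add: df_fun_mult[OF smooth_coordinates(4) \<gamma>] fun_eq_iff)
  then show ?thesis
    using quot.twisted_d_push[OF fun_mult_in_diff_forms[OF open_inoue_cover smooth_coordinates(4) \<gamma>], of dt_over_t]
    by (simp add: untwist_def)
qed

lemma cocycles_eq: "cocycles quot.S \<theta> k = untwist ` closed_part L4.fixed dR k"
proof (intro equalityI subsetI)
  fix \<omega> assume \<omega>: "\<omega> \<in> cocycles quot.S \<theta> k"
  then obtain \<gamma> where \<gamma>: "\<gamma> \<in> L4.fixed k" "\<omega> = untwist \<gamma>"
    using untwist_image[of k] unfolding cocycles_def by blast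
  have "untwist (dR \<gamma>) = 0"
    using \<omega> twisted_d_untwist[OF \<gamma>(1)] \<gamma>(2) by (simp add: cocycles_def mform_operations)
  then have "dR \<gamma> = 0" by (rule untwist_inject[OF dR_fixed[OF \<gamma>(1)]])
  then show "\<omega> \<in> untwist ` closed_part L4.fixed dR k" using \<gamma> by (auto simp: closed_part_def)
next
  fix \<omega> assume "\<omega> \<in> untwist ` closed_part L4.fixed dR k"
  then obtain \<gamma> where "\<gamma> \<in> L4.fixed k" "dR \<gamma> = 0" "\<omega> = untwist \<gamma>" by (auto simp: closed_part_def)
  then show "\<omega> \<in> cocycles quot.S \<theta> k"
    using twisted_d_untwist untwist_image[of k] linear_0[OF linear_untwist] by (auto simp: cocycles_def mform_operations)
qed

lemma coboundaries_eq: "coboundaries quot.S \<theta> k = untwist ` exact_part L4.fixed dR k"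
proof (cases k)
  case (Suc j)
  then show ?thesis
    unfolding Suc coboundaries_def exact_part_def nat.case untwist_image[symmetric] image_image
    by (intro image_cong refl twisted_d_untwist)
qed (simp add: coboundaries_def exact_part_def mform_operations linear_0[OF linear_untwist])

lemma subspace_cocycles: "subspace (cocycles quot.S \<theta> k)" "subspace (coboundaries quot.S \<theta> k)"
  "coboundaries quot.S \<theta> k \<subseteq> cocycles quot.S \<theta> k"
  unfolding cocycles_eq coboundaries_eq
  using cochain_complex.subspace_closed_part[OF L4.cochain_complex_fixed]
    cochain_complex.subspace_exact_part[OF L4.cochain_complex_fixed]
    cochain_complex.exact_part_subset[OF L4.cochain_complex_fixed] linear_subspace_image[OF linear_untwist]
  by (simp_all add: image_mono)

lemma cohomology_iso_of_represents:
  fixes \<psi> :: "'v::real_vector \<Rightarrow> R4 form"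
  assumes rep: "represents_cohomology L4.fixed dR k (range \<psi>)" and \<psi>: "linear \<psi>" "\<And>v. \<psi> v = 0 \<Longrightarrow> v = 0"
  shows "\<exists>F :: _ \<Rightarrow> 'v. cohomology_iso quot.S \<theta> k F"
proof (rule cohomology_iso_of_complement[OF subspace_cocycles, where \<psi>="untwist \<circ> \<psi>"])
  note repD = represents_cohomologyD[OF rep]
  show "linear (untwist \<circ> \<psi>)" by (rule linear_compose[OF \<psi>(1) linear_untwist])
  show "(untwist \<circ> \<psi>) v \<in> cocycles quot.S \<theta> k" for v
    using repD(2,3)[of "\<psi> v"] by (auto simp: cocycles_eq closed_part_def)
  show "v = 0" if v: "(untwist \<circ> \<psi>) v \<in> coboundaries quot.S \<theta> k" for v
  proof -
    obtain e where e: "e \<in> exact_part L4.fixed dR k" "untwist (\<psi> v) = untwist e"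
      using v by (auto simp: coboundaries_eq)
    have eC: "e \<in> L4.fixed k"
      using e(1) cochain_complex.exact_part_subset[OF L4.cochain_complex_fixed] by (auto simp: closed_part_def)
    have "\<psi> v - e \<in> L4.fixed k"
      by (rule subspace_diff[OF cochain_complex.sub[OF L4.cochain_complex_fixed] _ eC]) (rule repD(2), simp)
    moreover have "untwist (\<psi> v - e) = 0" using e(2) by (simp add: linear_diff[OF linear_untwist])
    ultimately have "\<psi> v - e = 0" by (rule untwist_inject)
    then have "\<psi> v \<in> exact_part L4.fixed dR k" using e(1) by simp
    then have "\<psi> v = 0" by (rule repD(4)[OF rangeI])
    then show ?thesis by (rule \<psi>(2))
  qed
  fix z assume "z \<in> cocycles quot.S \<theta> k"
  then obtain \<gamma> where \<gamma>: "\<gamma> \<in> L4.fixed k" "dR \<gamma> = 0" "z = untwist \<gamma>" by (auto simp: cocycles_eq closed_part_def)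
  then obtain v where "\<gamma> - \<psi> v \<in> exact_part L4.fixed dR k" using repD(5) by blast
  then have "untwist (\<gamma> - \<psi> v) \<in> coboundaries quot.S \<theta> k" unfolding coboundaries_eq by blast
  then show "\<exists>v. z - (untwist \<circ> \<psi>) v \<in> coboundaries quot.S \<theta> k"
    using \<gamma>(3) by (auto simp: linear_diff[OF linear_untwist])
qed

lemma cohomology_trivial_of_represents:
  assumes rep: "represents_cohomology L4.fixed dR k {0}"
  shows "cohomology quot.S \<theta> k = {coh_class quot.S \<theta> k mform_zero}"
proof (rule cohomology_trivial[OF subspace_cocycles(2)])
  have "closed_part L4.fixed dR k \<subseteq> exact_part L4.fixed dR k"
    using represents_cohomologyD(5)[OF rep] by (auto simp: closed_part_def)
  then have "closed_part L4.fixed dR k = exact_part L4.fixed dR k"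
    using cochain_complex.exact_part_subset[OF L4.cochain_complex_fixed] by blast
  then show "coboundaries quot.S \<theta> k = cocycles quot.S \<theta> k" by (simp add: cocycles_eq coboundaries_eq)
qed

lemma cohomology_iso_line:
  assumes "represents_cohomology L4.fixed dR k (span {x})" "x \<noteq> 0"
  shows "\<exists>F :: _ \<Rightarrow> real. cohomology_iso quot.S \<theta> k F"
proof (rule cohomology_iso_of_represents[where \<psi>="\<lambda>r. r *\<^sub>R x"])
  show "represents_cohomology L4.fixed dR k (range (\<lambda>r. r *\<^sub>R x))" using assms(1) by (simp add: span_singleton)
  show "linear (\<lambda>r. r *\<^sub>R x)" by (rule linear_scaleR_left)
qed (use assms(2) in simp)

theorem inoue_cohomology:
  "(\<exists>F :: _ \<Rightarrow> real. cohomology_iso quot.S \<theta> 1 F) \<and>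
   (\<exists>F :: _ \<Rightarrow> real^2. cohomology_iso quot.S \<theta> 2 F) \<and>
   (\<exists>F :: _ \<Rightarrow> real. cohomology_iso quot.S \<theta> 3 F) \<and>
   cohomology quot.S \<theta> 0 = {coh_class quot.S \<theta> 0 mform_zero} \<and>
   cohomology quot.S \<theta> 4 = {coh_class quot.S \<theta> 4 mform_zero}"
proof (intro conjI)
  show "\<exists>F :: _ \<Rightarrow> real. cohomology_iso quot.S \<theta> 1 F"
    by (rule cohomology_iso_line[OF represents_4(2) representatives_independent(1)])
  show "\<exists>F :: _ \<Rightarrow> real. cohomology_iso quot.S \<theta> 3 F"
    by (rule cohomology_iso_line[OF represents_4(4) representatives_independent(2)])
  show "cohomology quot.S \<theta> 0 = {coh_class quot.S \<theta> 0 mform_zero}"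
    by (rule cohomology_trivial_of_represents[OF represents_4(1)])
  show "cohomology quot.S \<theta> 4 = {coh_class quot.S \<theta> 4 mform_zero}"
    by (rule cohomology_trivial_of_represents[OF represents_4(5)])
  let ?x = "dR (fun_mult s_of du)" and ?y = du_zeta
  let ?\<psi> = "\<lambda>v :: real^2. v $ 1 *\<^sub>R ?x + v $ 2 *\<^sub>R ?y"
  show "\<exists>F :: _ \<Rightarrow> real^2. cohomology_iso quot.S \<theta> 2 F"
  proof (rule cohomology_iso_of_represents[where \<psi>="?\<psi>"])
    have "range ?\<psi> = span {?x, ?y}"
    proof (intro equalityI subsetI)
      fix z assume "z \<in> span {?x, ?y}"
      then obtain r s where "z = r *\<^sub>R ?x + s *\<^sub>R ?y" by (rule span_pairE)
      then have "z = ?\<psi> (vector [r, s])" by simp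
      then show "z \<in> range ?\<psi>" by blast
    next
      fix z assume "z \<in> range ?\<psi>"
      then obtain v where "z = ?\<psi> v" by blast
      moreover have "?\<psi> v \<in> span {?x, ?y}" by (intro span_add span_scale span_base) simp_all
      ultimately show "z \<in> span {?x, ?y}" by (simp only:)
    qed
    then show "represents_cohomology L4.fixed dR 2 (range ?\<psi>)" using represents_4(3) by simp
    show "linear ?\<psi>" by (intro linearI) (simp_all add: scaleR_add_left scaleR_add_right)
    show "v = 0" if "?\<psi> v = 0" for v using representatives_independent(3)[OF that] by (simp add: vec_eq_iff forall_2)
  qed
qed

end

theorem proposition4p4:
  fixes N :: "int^2^2" and \<alpha> :: real and a b c :: "real^2" and p q r :: int
  assumes "det N = 1"
    and "\<alpha> > 1"
    and "a \<noteq> 0" and "map_matrix real_of_int N *v a = \<alpha> *\<^sub>R a"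
    and "b \<noteq> 0" and "map_matrix real_of_int N *v b = (1 / \<alpha>) *\<^sub>R b"
    and "r \<noteq> 0"
    and "c = c v* transpose (map_matrix real_of_int N) + inoue_e N a b
           + ((b$1 * a$2 - b$2 * a$1) / of_int r) *\<^sub>R vector [of_int p, of_int q]"
  defines "S \<equiv> inoue_surface \<alpha> a b c r 0"
    and "\<theta> \<equiv> lee_form \<alpha> a b c r 0"
  shows "(\<exists>F :: _ \<Rightarrow> real. cohomology_iso S \<theta> 1 F) \<and>
         (\<exists>F :: _ \<Rightarrow> real^2. cohomology_iso S \<theta> 2 F) \<and>
         (\<exists>F :: _ \<Rightarrow> real. cohomology_iso S \<theta> 3 F) \<and>
         cohomology S \<theta> 0 = {coh_class S \<theta> 0 mform_zero} \<and>
         cohomology S \<theta> 4 = {coh_class S \<theta> 4 mform_zero}"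
proof -
  let ?n = "\<lambda>i j. real_of_int (N $ i $ j)"
  have mult: "(map_matrix real_of_int N *v v) $ i = ?n i 1 * v $ 1 + ?n i 2 * v $ 2" for v i
    by (simp add: matrix_vector_mult_def map_matrix_def sum_2)
  have eig_a: "?n i 1 * a $ 1 + ?n i 2 * a $ 2 = \<alpha> * a $ i" for i
    using arg_cong[OF assms(4), of "\<lambda>v. v $ i"] by (simp add: mult)
  have eig_b: "?n i 1 * b $ 1 + ?n i 2 * b $ 2 = b $ i / \<alpha>" for i
    using arg_cong[OF assms(6), of "\<lambda>v. v $ i"] by (simp add: mult)
  have c: "c $ i = (c $ 1 * ?n i 1 + c $ 2 * ?n i 2) + inoue_e N a b $ i
      + (b$1 * a$2 - b$2 * a$1) / of_int r * (vector [of_int p, of_int q] :: real^2) $ i" for i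
    by (subst assms(8)) (simp add: vector_matrix_mult_def transpose_def map_matrix_def sum_2 mult.commute)
  \<comment> \<open>Eigenvectors for different eigenvalues are not parallel.\<close>
  have delta: "b$1 * a$2 - b$2 * a$1 \<noteq> 0"
  proof
    assume 0: "b$1 * a$2 - b$2 * a$1 = 0"
    have "\<exists>s. b$1 = s * a$1 \<and> b$2 = s * a$2"
    proof (cases "a$1 = 0")
      case True
      then have "a$2 \<noteq> 0" using assms(3) by (auto simp: vec_eq_iff forall_2)
      then show ?thesis using True 0 by (intro exI[of _ "b$2 / a$2"]) simp
    next
      case False
      then show ?thesis using 0 by (intro exI[of _ "b$1 / a$1"]) (simp add: field_simps)
    qed
    then obtain s where s: "b$1 = s * a$1" "b$2 = s * a$2" by blast
    have "\<alpha> * b $ i = b $ i / \<alpha>" for i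
    proof -
      have "b $ i = s * a $ i" using s by (cases "i = 1") (auto, metis exhaust_2)
      then have "\<alpha> * b $ i = s * (?n i 1 * a $ 1 + ?n i 2 * a $ 2)" by (simp add: eig_a)
      also have "\<dots> = b $ i / \<alpha>" using eig_b[of i] s by (simp add: algebra_simps)
      finally show ?thesis .
    qed
    then have "\<alpha> * \<alpha> * b $ i = b $ i" for i using assms(2) by (simp add: field_simps)
    then have "(\<alpha> * \<alpha> - 1) * b $ i = 0" for i by (simp add: algebra_simps)
    moreover have "\<alpha> * \<alpha> \<noteq> 1" using assms(2) less_1_mult[of \<alpha> \<alpha>] by auto
    ultimately show False using assms(5) by (simp add: vec_eq_iff)
  qed
  interpret inoue_data \<alpha> "a$1" "a$2" "b$1" "b$2" "c$1" "c$2" "(b$1 * a$2 - b$2 * a$1) / of_int r"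
    "N$1$1" "N$1$2" "N$2$1" "N$2$2" p q r
    "\<lambda>m n. 1/2 * of_int m * (of_int m - 1) * a$1 * b$1 + 1/2 * of_int n * (of_int n - 1) * a$2 * b$2 + of_int m * of_int n * b$1 * a$2"
  proof unfold_locales
    show "\<alpha> > 1" by (rule assms(2))
    show "N$1$1 * N$2$2 - N$1$2 * N$2$1 = 1" using assms(1) by (simp add: det_2)
    show "b$1 * a$2 - b$2 * a$1 \<noteq> 0" by (rule delta)
    show "r \<noteq> 0" by (rule assms(7))
    show "?n 1 1 * a$1 + ?n 1 2 * a$2 = \<alpha> * a$1" "?n 2 1 * a$1 + ?n 2 2 * a$2 = \<alpha> * a$2" by (rule eig_a)+
    show "?n 1 1 * b$1 + ?n 1 2 * b$2 = b$1 / \<alpha>" "?n 2 1 * b$1 + ?n 2 2 * b$2 = b$2 / \<alpha>" by (rule eig_b)+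
    show "c$1 = ?n 1 1 * c$1 + ?n 1 2 * c$2
        + (1/2 * ?n 1 1 * (?n 1 1 - 1) * a$1 * b$1 + 1/2 * ?n 1 2 * (?n 1 2 - 1) * a$2 * b$2 + ?n 1 1 * ?n 1 2 * b$1 * a$2)
        + (b$1 * a$2 - b$2 * a$1) / of_int r * of_int p"
      by (subst c) (simp add: inoue_e_def mult.commute)
    show "c$2 = ?n 2 1 * c$1 + ?n 2 2 * c$2
        + (1/2 * ?n 2 1 * (?n 2 1 - 1) * a$1 * b$1 + 1/2 * ?n 2 2 * (?n 2 2 - 1) * a$2 * b$2 + ?n 2 1 * ?n 2 2 * b$1 * a$2)
        + (b$1 * a$2 - b$2 * a$1) / of_int r * of_int q"
      by (subst c) (simp add: inoue_e_def mult.commute)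
  qed
  have "inoue_g0 \<alpha> 0 = dil \<alpha>" by (simp add: inoue_g0_def dil_def)
  moreover have "inoue_g a b c 1 = g1" "inoue_g a b c 2 = g2" "inoue_g3 a b r = g3"
    by (simp_all add: inoue_g_def inoue_g3_def lat_def heis_def fun_eq_iff)
  ultimately have G: "inoue_group \<alpha> a b c r 0 = G" by (simp add: inoue_group_def G_def)
  have "S = quot.S" by (simp add: S_def inoue_surface_def G)
  moreover have "\<theta> = quot.push dt_over_t" by (simp add: \<theta>_def lee_form_def quot.push_def G)
  ultimately show ?thesis using inoue_cohomology by simp
qed

end
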